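(* Let $\mathcal H$ be an infinite-dimensional separable complex Hilbert space. The following statements are equivalent: 1. $2\,s(PE(I-P))\prec_w\mathrm{Spr}^+(E)$ for all self-adjoint $E,P\in B(\mathcal H)$ with $P=P^2$. 2. $s(EF-FE)\prec_w\frac12\,\mathrm{Spr}^+(E\oplus E)\cdot\mathrm{Spr}^+(F\oplus F)$ for all self-adjoint $E,F\in B(\mathcal H)$. 3. $s(EX-XF)\prec_w\mathrm{Spr}^+(E\oplus F)\cdot s(X)$ for all self-adjoint $E,F\in B(\mathcal H)$ and all $X\in B(\mathcal H)$. 4. $s(E-F)\prec_w\mathrm{Spr}^+(E\oplus F)$ for all self-adjoint $E,F\in B(\mathcal H)$. 5. $2\,s(SEC^* )\prec_w\mathrm{Spr}^+(E\oplus 0_{\mathcal H})$ for all $C,S\in B(\mathcal H)$ with $C^*C+S^*S=I$ and all self-adjoint $E\in B(\mathcal H)$.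
   Context: $\mathbb N=\{1,2,\dots\}$, $\mathbb Z_0=\mathbb Z\setminus\{0\}$. For operators $E,F$ on $\mathcal H$, $E\oplus F$ is the block diagonal operator on $\mathcal H\oplus\mathcal H$. The product $\cdot$ of sequences is entrywise. Spectral scale: for a bounded self-adjoint operator $A$ on an infinite-dimensional separable complex Hilbert space $\mathcal L$, $\lambda(A)=(\lambda_i(A))_{i\in\mathbb Z_0}$ is defined, for $i\in\mathbb N$, by $$\lambda_i(A)=\inf_{\dim\mathcal S=i-1}\ \sup_{\psi\in\mathcal S^\perp,\|\psi\|=1}\langle A\psi,\psi\rangle,\qquad \lambda_{-i}(A)=\sup_{\dim\mathcal S=i-1}\ \inf_{\psi\in\mathcal S^\perp,\|\psi\|=1}\langle A\psi,\psi\rangle,$$ where $\mathcal S$ ranges over $(i-1)$-dimensional subspaces of $\mathcal L$. Spectral spread: $\mathrm{Spr}^+(A)=(\lambda_i(A)-\lambda_{-i}(A))_{i\in\mathbb N}$. Generalized singular values of a bounded operator $T$: $s(T)=(\lambda_i(|T|))_{i\in\mathbb N}$, $|T|=(T^*T)^{1/2}$. Submajorization: for a bounded real sequence $a=(a_i)_{i\in\mathbb M}$, $\mathbb M\in\{\mathbb N,\mathbb Z_0\}$, put $a^\downarrow_i=\lambda_i(D_a)$, $i\in\mathbb N$, where $D_a$ is the diagonal operator with diagonal $a$ on $\ell^2(\mathbb M)$; equivalently $\sum_{i=1}^k a_i^\downarrow=\sup\{\sum_{i\in F}a_i: F\subseteq\mathbb M, |F|=k\}$. Then $a\prec_w b$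 means $\sum_{i=1}^k a_i^\downarrow\le\sum_{i=1}^k b_i^\downarrow$ for all $k\in\mathbb N$. *)

theory Defs
  imports "HOL-Analysis.Analysis"
begin

section \<open>Complex Hilbert spaces\<close>

class complex_vector = real_vector +
  fixes scaleC :: "complex \<Rightarrow> 'a \<Rightarrow> 'a" (infixr "*\<^sub>C" 75)
  assumes scaleC_add_right: "c *\<^sub>C (x + y) = c *\<^sub>C x + c *\<^sub>C y"
    and scaleC_add_left: "(c + d) *\<^sub>C x = c *\<^sub>C x + d *\<^sub>C x"
    and scaleC_scaleC: "c *\<^sub>C (d *\<^sub>C x) = (c * d) *\<^sub>C x"
    and scaleC_of_real: "complex_of_real r *\<^sub>C x = r *\<^sub>R x"

global_interpretation complex_vector: vector_space "scaleC :: complex \<Rightarrow> 'a \<Rightarrow> 'a::complex_vector"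
  defines cdependent = complex_vector.dependent
    and cspan = complex_vector.span
  by standard
    (use scaleC_of_real[of 1] in
      \<open>auto simp: scaleC_add_right scaleC_add_left scaleC_scaleC\<close>)

text \<open>
  The inner product is linear in its first argument. Norm and topology are those of the
  underlying real inner product space, whose inner product is the real part of the complex one,
  so the norm of \<open>x\<close> is the square root of \<open>cinner x x\<close>.
\<close>

class complex_inner = complex_vector + real_inner +
  fixes cinner :: "'a \<Rightarrow> 'a \<Rightarrow> complex"
  assumes cinner_commute: "cinner x y = cnj (cinner y x)"
    and cinner_add_left: "cinner (x + y) z = cinner x z + cinner y z"
    and cinner_scaleC_left: "cinner (c *\<^sub>C x) y = c * cinner x y"
    and inner_eq_Re_cinner: "inner x y = Re (cinner x y)"

class chilbert_space = complex_inner + complete_space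

lemma cinner_self: "cinner x x = complex_of_real ((norm x)\<^sup>2)" for x :: "'a::complex_inner"
  using cinner_commute[of x x] inner_eq_Re_cinner[of x x]
  by (simp add: complex_eq_iff power2_norm_eq_inner)

text \<open>The orthogonal direct sum \<open>H \<oplus> H\<close> is the product type.\<close>

instantiation prod :: (complex_vector, complex_vector) complex_vector
begin

definition scaleC_prod_def: "c *\<^sub>C p = (c *\<^sub>C fst p, c *\<^sub>C snd p)"

instance
  by standard
    (auto simp: scaleC_prod_def scaleC_add_right scaleC_add_left scaleC_scaleC scaleC_of_real
      prod_eq_iff)

end

instantiation prod :: (complex_inner, complex_inner) complex_inner
begin

definition cinner_prod_def: "cinner p q = cinner (fst p) (fst q) + cinner (snd p) (snd q)"

instance
proof
  fix p q r :: "'a \<times> 'b" and c :: complex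
  show "cinner p q = cnj (cinner q p)"
    unfolding cinner_prod_def
    by (subst (1 2) cinner_commute) simp
  show "cinner (p + q) r = cinner p r + cinner q r"
    by (simp add: cinner_prod_def cinner_add_left)
  show "cinner (c *\<^sub>C p) q = c * cinner p q"
    by (simp add: cinner_prod_def scaleC_prod_def cinner_scaleC_left algebra_simps)
  show "inner p q = Re (cinner p q)"
    by (simp add: cinner_prod_def inner_prod_def inner_eq_Re_cinner)
qed

end

instance prod :: (chilbert_space, chilbert_space) chilbert_space ..


section \<open>Bounded operators\<close>

definition bounded_clinear :: "('a::complex_inner \<Rightarrow> 'b::complex_inner) \<Rightarrow> bool" where
  "bounded_clinear A \<longleftrightarrow> bounded_linear A \<and> (\<forall>c x. A (c *\<^sub>C x) = c *\<^sub>C A x)"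

text \<open>On a Hilbert space a bounded operator has exactly one adjoint (Riesz).\<close>

definition cadjoint :: "('a::complex_inner \<Rightarrow> 'b::complex_inner) \<Rightarrow> 'b \<Rightarrow> 'a" where
  "cadjoint A = (THE B. \<forall>x y. cinner (A x) y = cinner x (B y))"

definition selfadjoint :: "('a::complex_inner \<Rightarrow> 'a) \<Rightarrow> bool" where
  "selfadjoint A \<longleftrightarrow> bounded_clinear A \<and> (\<forall>x y. cinner (A x) y = cinner x (A y))"

definition positive_op :: "('a::complex_inner \<Rightarrow> 'a) \<Rightarrow> bool" where
  "positive_op A \<longleftrightarrow> selfadjoint A \<and> (\<forall>x. 0 \<le> Re (cinner (A x) x))"

definition op_sqrt :: "('a::complex_inner \<Rightarrow> 'a) \<Rightarrow> 'a \<Rightarrow> 'a" where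
  "op_sqrt A = (THE R. positive_op R \<and> R \<circ> R = A)"

definition op_abs :: "('a::complex_inner \<Rightarrow> 'a) \<Rightarrow> 'a \<Rightarrow> 'a" where
  "op_abs T = op_sqrt (cadjoint T \<circ> T)"

text \<open>The block diagonal operator with diagonal blocks \<open>E\<close> and \<open>F\<close>.\<close>

abbreviation block_diag :: "('a \<Rightarrow> 'a) \<Rightarrow> ('b \<Rightarrow> 'b) \<Rightarrow> 'a \<times> 'b \<Rightarrow> 'a \<times> 'b" (infixr "\<oplus>" 65)
  where "E \<oplus> F \<equiv> map_prod E F"


section \<open>Spectral scale, spectral spread and singular values\<close>

text \<open>
  The complex subspaces of finite dimension \<open>n\<close>. (The library's dimension function assigns \<open>0\<close> to
  infinite-dimensional subspaces and is therefore avoided.)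
\<close>

definition cfindim_subspaces :: "nat \<Rightarrow> 'a::complex_vector set set" where
  "cfindim_subspaces n = {cspan B |B. finite B \<and> \<not> cdependent B \<and> card B = n}"

definition unit_perp :: "'a::complex_inner set \<Rightarrow> 'a set" where
  "unit_perp S = {\<psi>. (\<forall>x\<in>S. cinner \<psi> x = 0) \<and> norm \<psi> = 1}"

text \<open>
  \<open>spectral_scale A i\<close> is meaningful for nonzero \<open>i\<close> and bounded self-adjoint \<open>A\<close> on an
  infinite-dimensional space: \<open>cinner (A \<psi>) \<psi>\<close> is then real, and all suprema and infima are over
  nonempty bounded sets of reals.
\<close>

definition spectral_scale :: "('a::complex_inner \<Rightarrow> 'a) \<Rightarrow> int \<Rightarrow> real" where
  "spectral_scale A i =
    (if 0 < i
     then (INF S\<in>cfindim_subspaces (nat (i - 1)). SUP \<psi>\<in>unit_perp S. Re (cinner (A \<psi>) \<psi>))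
     else (SUP S\<in>cfindim_subspaces (nat (- i - 1)). INF \<psi>\<in>unit_perp S. Re (cinner (A \<psi>) \<psi>)))"

text \<open>
  Sequences indexed by the positive integers are functions on \<^typ>\<open>nat\<close>, the \<open>i\<close>-th entry being
  stored at argument \<open>i - 1\<close>.
\<close>

definition spectral_spread :: "('a::complex_inner \<Rightarrow> 'a) \<Rightarrow> nat \<Rightarrow> real" where
  "spectral_spread A n = spectral_scale A (int n + 1) - spectral_scale A (- (int n + 1))"

definition singular_values :: "('a::complex_inner \<Rightarrow> 'a) \<Rightarrow> nat \<Rightarrow> real" where
  "singular_values T n = spectral_scale (op_abs T) (int n + 1)"


section \<open>The Hilbert space of square summable families\<close>

typedef 'i ell2 = "{f :: 'i \<Rightarrow> complex. (\<lambda>i. (cmod (f i))\<^sup>2) summable_on UNIV}"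
  by (rule exI[of _ "\<lambda>_. 0"]) simp

setup_lifting type_definition_ell2

lemma square_summable_scale:
  assumes "(\<lambda>i. (cmod (f i))\<^sup>2) summable_on UNIV" "\<And>i. cmod (a i) \<le> B"
  shows "(\<lambda>i. (cmod (a i * f i))\<^sup>2) summable_on UNIV"
proof (rule summable_on_comparison_test)
  show "(\<lambda>i. B\<^sup>2 * (cmod (f i))\<^sup>2) summable_on UNIV"
    using assms(1) by (rule summable_on_cmult_right)
  show "(cmod (a i * f i))\<^sup>2 \<le> B\<^sup>2 * (cmod (f i))\<^sup>2" for i
    using assms(2)[of i] by (auto simp: norm_mult power_mult_distrib intro!: mult_right_mono power_mono)
qed auto

lemma square_summable_add:
  assumes "(\<lambda>i. (cmod (f i))\<^sup>2) summable_on UNIV" "(\<lambda>i. (cmod (g i))\<^sup>2) summable_on UNIV"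
  shows "(\<lambda>i. (cmod (f i + g i))\<^sup>2) summable_on UNIV"
proof (rule summable_on_comparison_test)
  show "(\<lambda>i. 2 * (cmod (f i))\<^sup>2 + 2 * (cmod (g i))\<^sup>2) summable_on UNIV"
    using assms by (intro summable_on_add summable_on_cmult_right)
  show "(cmod (f i + g i))\<^sup>2 \<le> 2 * (cmod (f i))\<^sup>2 + 2 * (cmod (g i))\<^sup>2" for i
  proof -
    have "(cmod (f i + g i))\<^sup>2 \<le> (cmod (f i) + cmod (g i))\<^sup>2"
      by (intro power_mono norm_triangle_ineq) auto
    also have "\<dots> \<le> 2 * (cmod (f i))\<^sup>2 + 2 * (cmod (g i))\<^sup>2"
      using sum_squares_bound[of "cmod (f i)" "cmod (g i)"]
      by (simp add: power2_sum)
    finally show ?thesis .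
  qed
qed auto

lemma square_summable_mult:
  assumes "(\<lambda>i. (cmod (f i))\<^sup>2) summable_on UNIV" "(\<lambda>i. (cmod (g i))\<^sup>2) summable_on UNIV"
  shows "(\<lambda>i. f i * cnj (g i)) summable_on UNIV"
proof -
  have "(\<lambda>i. cmod (f i * cnj (g i))) summable_on UNIV"
  proof (rule summable_on_comparison_test)
    show "(\<lambda>i. (cmod (f i))\<^sup>2 + (cmod (g i))\<^sup>2) summable_on UNIV"
      using assms by (rule summable_on_add)
    show "cmod (f i * cnj (g i)) \<le> (cmod (f i))\<^sup>2 + (cmod (g i))\<^sup>2" for i
      using sum_squares_bound[of "cmod (f i)" "cmod (g i)"]
        mult_nonneg_nonneg[OF norm_ge_zero norm_ge_zero, of "f i" "g i"]
      unfolding norm_mult complex_mod_cnj by linarith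
  qed auto
  then show ?thesis
    by (rule abs_summable_summable)
qed

instantiation ell2 :: (type) real_vector
begin

lift_definition zero_ell2 :: "'a ell2" is "\<lambda>_. 0" by simp

lift_definition plus_ell2 :: "'a ell2 \<Rightarrow> 'a ell2 \<Rightarrow> 'a ell2" is "\<lambda>f g i. f i + g i"
  by (rule square_summable_add)

lift_definition uminus_ell2 :: "'a ell2 \<Rightarrow> 'a ell2" is "\<lambda>f i. - f i" by simp

lift_definition minus_ell2 :: "'a ell2 \<Rightarrow> 'a ell2 \<Rightarrow> 'a ell2" is "\<lambda>f g i. f i - g i"
  using square_summable_add[of _ "\<lambda>i. - _ i"] by simp

lift_definition scaleR_ell2 :: "real \<Rightarrow> 'a ell2 \<Rightarrow> 'a ell2" is "\<lambda>r f i. complex_of_real r * f i"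
  by (rule square_summable_scale) auto

instance
  by standard (transfer; simp add: fun_eq_iff algebra_simps)+

end

instantiation ell2 :: (type) complex_vector
begin

lift_definition scaleC_ell2 :: "complex \<Rightarrow> 'a ell2 \<Rightarrow> 'a ell2" is "\<lambda>c f i. c * f i"
  by (rule square_summable_scale) auto

instance
  by standard (transfer; simp add: fun_eq_iff algebra_simps)+

end

instantiation ell2 :: (type) complex_inner
begin

lift_definition cinner_ell2 :: "'a ell2 \<Rightarrow> 'a ell2 \<Rightarrow> complex" is
  "\<lambda>f g. \<Sum>\<^sub>\<infinity>i. f i * cnj (g i)" .

definition inner_ell2 :: "'a ell2 \<Rightarrow> 'a ell2 \<Rightarrow> real" where
  "inner_ell2 f g = Re (cinner f g)"

definition norm_ell2 :: "'a ell2 \<Rightarrow> real" where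
  "norm_ell2 f = sqrt (inner f f)"

definition sgn_ell2 :: "'a ell2 \<Rightarrow> 'a ell2" where
  "sgn_ell2 f = f /\<^sub>R norm f"

definition dist_ell2 :: "'a ell2 \<Rightarrow> 'a ell2 \<Rightarrow> real" where
  "dist_ell2 f g = norm (f - g)"

definition uniformity_ell2 :: "('a ell2 \<times> 'a ell2) filter" where
  "uniformity_ell2 = (INF e\<in>{0<..}. principal {(f, g). dist f g < e})"

definition open_ell2 :: "'a ell2 set \<Rightarrow> bool" where
  "open_ell2 U \<longleftrightarrow> (\<forall>f\<in>U. eventually (\<lambda>(f', g). f' = f \<longrightarrow> g \<in> U) uniformity)"

lemma inner_ell2_self: "inner f f = (\<Sum>\<^sub>\<infinity>i. (cmod (Rep_ell2 f i))\<^sup>2)" for f :: "'a ell2"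
proof -
  have "cinner f f = (\<Sum>\<^sub>\<infinity>i. complex_of_real ((cmod (Rep_ell2 f i))\<^sup>2))"
    unfolding cinner_ell2.rep_eq by (simp flip: complex_norm_square)
  also have "\<dots> = complex_of_real (\<Sum>\<^sub>\<infinity>i. (cmod (Rep_ell2 f i))\<^sup>2)"
    using Rep_ell2[of f] by (intro infsumI has_sum_of_real) auto
  finally show ?thesis
    by (simp add: inner_ell2_def)
qed

instance
proof
  fix f g h :: "'a ell2" and c :: complex and r :: real
  show comm: "cinner f g = cnj (cinner g f)" for f g :: "'a ell2"
    by transfer (simp flip: infsum_cnj add: mult.commute)
  show add: "cinner (f + g) h = cinner f h + cinner g h" for f g h :: "'a ell2"
    by transfer (simp add: distrib_right infsum_add square_summable_mult)
  show scale: "cinner (c *\<^sub>C f) g = c * cinner f g" for c and f g :: "'a ell2"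
    by transfer (simp add: mult.assoc infsum_cmult_right square_summable_mult)
  show "inner f g = Re (cinner f g)"
    by (rule inner_ell2_def)
  show "inner f g = inner g f"
    unfolding inner_ell2_def by (subst comm) simp
  show "inner (f + g) h = inner f h + inner g h"
    unfolding inner_ell2_def by (simp add: add)
  show "inner (r *\<^sub>R f) g = r * inner f g"
    unfolding inner_ell2_def scaleC_of_real[symmetric] by (simp add: scale)
  show "0 \<le> inner f f"
    unfolding inner_ell2_self by (rule infsum_nonneg) simp
  show "inner f f = 0 \<longleftrightarrow> f = 0"
  proof
    assume "inner f f = 0"
    then have "(cmod (Rep_ell2 f i))\<^sup>2 = 0" for i
      using Rep_ell2[of f] unfolding inner_ell2_self
      by (intro nonneg_infsum_le_0D[of _ UNIV]) auto
    then show "f = 0"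
      by transfer (simp add: fun_eq_iff)
  next
    assume "f = 0"
    then show "inner f f = 0"
      unfolding inner_ell2_self by transfer simp
  qed
  show "dist f g = norm (f - g)" "norm f = sqrt (inner f f)" "sgn f = f /\<^sub>R norm f"
    by (simp_all add: dist_ell2_def norm_ell2_def sgn_ell2_def)
  show "uniformity = (INF e\<in>{0<..}. principal {(f::'a ell2, g). dist f g < e})"
    by (rule uniformity_ell2_def)
  show "open U \<longleftrightarrow> (\<forall>f\<in>U. eventually (\<lambda>(f', g). f' = f \<longrightarrow> g \<in> U) uniformity)" for U :: "'a ell2 set"
    by (rule open_ell2_def)
qed

end

lemma norm_ell2_square: "(norm f)\<^sup>2 = (\<Sum>\<^sub>\<infinity>i. (cmod (Rep_ell2 f i))\<^sup>2)"
  unfolding power2_norm_eq_inner inner_ell2_self ..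

lemma sum_le_norm_ell2:
  assumes "finite F"
  shows "(\<Sum>i\<in>F. (cmod (Rep_ell2 f i))\<^sup>2) \<le> (norm f)\<^sup>2"
  unfolding norm_ell2_square
  using Rep_ell2[of f] assms by (intro finite_sum_le_infsum) auto

instance ell2 :: (type) chilbert_space
proof
  fix X :: "nat \<Rightarrow> 'a ell2"
  assume "Cauchy X"
  have coord: "cmod (Rep_ell2 f i) \<le> norm f" for f :: "'a ell2" and i
    by (rule power2_le_imp_le) (use sum_le_norm_ell2[of "{i}" f] in auto)
  have "Cauchy (\<lambda>n. Rep_ell2 (X n) i)" for i
  proof (rule metric_CauchyI)
    fix e :: real assume "0 < e"
    then obtain M where "\<And>m n. m \<ge> M \<Longrightarrow> n \<ge> M \<Longrightarrow> dist (X m) (X n) < e"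
      using metric_CauchyD[OF \<open>Cauchy X\<close>] by meson
    then show "\<exists>M. \<forall>m\<ge>M. \<forall>n\<ge>M. dist (Rep_ell2 (X m) i) (Rep_ell2 (X n) i) < e"
      using coord[of "X _ - X _" i]
      unfolding dist_norm minus_ell2.rep_eq by (meson le_less_trans)
  qed
  then have "\<exists>l. (\<lambda>n. Rep_ell2 (X n) i) \<longlonglongrightarrow> l" for i
    by (simp add: Cauchy_convergent_iff convergent_def)
  then obtain l where l: "\<And>i. (\<lambda>n. Rep_ell2 (X n) i) \<longlonglongrightarrow> l i"
    by metis
  have bound: "(\<Sum>i\<in>F. (cmod (Rep_ell2 (X m) i - l i))\<^sup>2) \<le> e\<^sup>2"
    if "finite F" "0 < e" "\<And>n. n \<ge> M \<Longrightarrow> dist (X m) (X n) < e" for F e M m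
  proof (rule LIMSEQ_le_const2)
    show "(\<lambda>n. \<Sum>i\<in>F. (cmod (Rep_ell2 (X m) i - Rep_ell2 (X n) i))\<^sup>2)
        \<longlonglongrightarrow> (\<Sum>i\<in>F. (cmod (Rep_ell2 (X m) i - l i))\<^sup>2)"
      by (intro tendsto_intros l)
    have "(\<Sum>i\<in>F. (cmod (Rep_ell2 (X m) i - Rep_ell2 (X n) i))\<^sup>2) \<le> e\<^sup>2" if "n \<ge> M" for n
    proof -
      have "(\<Sum>i\<in>F. (cmod (Rep_ell2 (X m) i - Rep_ell2 (X n) i))\<^sup>2) \<le> (norm (X m - X n))\<^sup>2"
        using sum_le_norm_ell2[OF \<open>finite F\<close>, of "X m - X n"] by (simp add: minus_ell2.rep_eq)
      also have "\<dots> \<le> e\<^sup>2"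
        using \<open>\<And>n. n \<ge> M \<Longrightarrow> dist (X m) (X n) < e\<close>[OF \<open>n \<ge> M\<close>]
        by (intro power_mono) (auto simp: dist_norm)
      finally show ?thesis .
    qed
    then show "\<exists>N. \<forall>n\<ge>N. (\<Sum>i\<in>F. (cmod (Rep_ell2 (X m) i - Rep_ell2 (X n) i))\<^sup>2) \<le> e\<^sup>2"
      by blast
  qed
  have summ: "(\<lambda>i. (cmod (Rep_ell2 (X m) i - l i))\<^sup>2) summable_on UNIV"
    if "0 < e" "\<And>n. n \<ge> M \<Longrightarrow> dist (X m) (X n) < e" for e M m
    by (rule nonneg_bdd_above_summable_on)
      (use bound[OF _ that] in \<open>auto intro!: bdd_aboveI\<close>)
  obtain M1 where M1: "\<And>m n. m \<ge> M1 \<Longrightarrow> n \<ge> M1 \<Longrightarrow> dist (X m) (X n) < 1"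
    using metric_CauchyD[OF \<open>Cauchy X\<close>, of 1] by auto
  have "(\<lambda>i. (cmod (l i))\<^sup>2) summable_on UNIV"
    using square_summable_add[of "Rep_ell2 (X M1)" "\<lambda>i. - (Rep_ell2 (X M1) i - l i)"]
      Rep_ell2[of "X M1"] summ[of 1 M1 M1] M1
    by (simp add: norm_minus_commute)
  then have rep: "Rep_ell2 (Abs_ell2 l) = l"
    by (simp add: Abs_ell2_inverse)
  have "X \<longlonglongrightarrow> Abs_ell2 l"
  proof (rule metric_LIMSEQ_I)
    fix e :: real assume "0 < e"
    then have "0 < e / 2" by simp
    then obtain M where M: "\<And>m n. m \<ge> M \<Longrightarrow> n \<ge> M \<Longrightarrow> dist (X m) (X n) < e / 2"
      using metric_CauchyD[OF \<open>Cauchy X\<close>, of "e / 2"] by meson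
    have "dist (X m) (Abs_ell2 l) < e" if "m \<ge> M" for m
    proof -
      have "(norm (X m - Abs_ell2 l))\<^sup>2 \<le> (e / 2)\<^sup>2"
        unfolding norm_ell2_square minus_ell2.rep_eq rep
        by (intro infsum_le_finite_sums summ[OF \<open>0 < e / 2\<close>] bound[OF _ \<open>0 < e / 2\<close>] M[OF that])
      then have "norm (X m - Abs_ell2 l) \<le> e / 2"
        by (rule power2_le_imp_le) (use \<open>0 < e\<close> in auto)
      then show ?thesis
        using \<open>0 < e\<close> by (simp add: dist_norm)
    qed
    then show "\<exists>M. \<forall>m\<ge>M. dist (X m) (Abs_ell2 l) < e"
      by blast
  qed
  then show "convergent X"
    by (rule convergentI)
qed


section \<open>Submajorization\<close>

text \<open>
  The diagonal operator on \<open>\<ell>\<^sup>2\<close> with diagonal \<open>a\<close>. It is a bounded operator only if \<open>a\<close> is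
  bounded; the value for unbounded \<open>a\<close> is a dummy.
\<close>

lift_definition diag_op :: "('i \<Rightarrow> real) \<Rightarrow> 'i ell2 \<Rightarrow> 'i ell2" is
  "\<lambda>a f. if bounded (range a) then (\<lambda>i. complex_of_real (a i) * f i) else (\<lambda>_. 0)"
proof -
  fix a :: "'i \<Rightarrow> real" and f :: "'i \<Rightarrow> complex"
  assume f: "(\<lambda>i. (cmod (f i))\<^sup>2) summable_on UNIV"
  show "(\<lambda>i. (cmod ((if bounded (range a) then \<lambda>i. complex_of_real (a i) * f i else (\<lambda>_. 0)) i))\<^sup>2)
    summable_on UNIV"
  proof (cases "bounded (range a)")
    case True
    then obtain B where "\<And>i. cmod (complex_of_real (a i)) \<le> B"
      unfolding bounded_iff by auto
    from square_summable_scale[of f "\<lambda>i. complex_of_real (a i)", OF f this] True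
    show ?thesis by simp
  qed simp
qed

definition decreasing_rearrangement :: "('i \<Rightarrow> real) \<Rightarrow> nat \<Rightarrow> real" where
  "decreasing_rearrangement a n = spectral_scale (diag_op a) (int n + 1)"

definition submajorized :: "('i \<Rightarrow> real) \<Rightarrow> ('j \<Rightarrow> real) \<Rightarrow> bool" (infix "\<prec>\<^sub>w" 50) where
  "a \<prec>\<^sub>w b \<longleftrightarrow>
    (\<forall>k\<ge>1. (\<Sum>n<k. decreasing_rearrangement a n) \<le> (\<Sum>n<k. decreasing_rearrangement b n))"

definition all_equivalent :: "bool list \<Rightarrow> bool" where
  "all_equivalent Ps \<longleftrightarrow> (\<forall>P\<in>set Ps. \<forall>Q\<in>set Ps. P \<longleftrightarrow> Q)"

end

theory Submission
  imports Defs
begin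

text \<open>
  All five statements are true, so they are equivalent. Approximate eigenvectors, chosen greedily, give a
  Ky Fan principle: for contractions \<open>W\<close>, \<open>V\<close> with \<open>norm (W x) = norm (V x)\<close> and orthonormal
  \<open>x\<^sub>1, \<dots>, x\<^sub>k\<close>, the sum of \<open>\<langle>E W x\<^sub>j, W x\<^sub>j\<rangle> - \<langle>E V x\<^sub>j, V x\<^sub>j\<rangle>\<close> is at most the sum of the first \<open>k\<close>
  entries of the spread of \<open>E\<close>. With \<open>W = (A + B) / sqrt 2\<close> and \<open>V = (A - B) / sqrt 2\<close> this bounds
  the sum of \<open>2 Re \<langle>E A x\<^sub>j, B x\<^sub>j\<rangle>\<close>. On the other hand, an approximate polar decomposition of \<open>T\<close> bounds
  the first \<open>k\<close> singular values by a sum of \<open>Re \<langle>T x\<^sub>j, U x\<^sub>j\<rangle>\<close> with a contraction \<open>U\<close>, and each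
  statement follows from a suitable choice of \<open>A\<close> and \<open>B\<close>, on \<open>H\<close> or on \<open>H \<oplus> H\<close>. For the two
  inequalities whose right-hand side is a product, one factor is first split into weighted rank-one layers
  and a small remainder, and the layers are recombined by summation by parts.
\<close>

section \<open>Complex inner products and bounded operators\<close>

text \<open>The operators need not be compact: from some index on, the scale can be constant at an
  end of the essential spectrum, where eigenvectors may be missing. Hence nothing is diagonalised,
  and every estimate carries a tolerance that is removed only at the level of finite sums. A
  truncated spectral expansion is replaced by flattening: the weights
  \<open>upper_scale A i - upper_scale A n\<close> are subtracted along approximate eigenvectors,
  which leaves a form bounded by about \<open>upper_scale A n\<close>, whether or not that value is
  attained.

  The factor 1/2 in the commutator estimate has two sources. A scalar commutes with
  \<open>E\<close>, so the flattened part of \<open>F\<close> can be recentred and its norm is about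
  half a spread entry. A self-adjoint rank-one layer of \<open>F\<close> is tested by a skew
  operator on \<open>H\<close> itself and is charged to the spread of \<open>E\<close>, whose entry
  \<open>i div 2\<close> is at most the entry \<open>i\<close> for
  \<open>E \<oplus> E\<close>.\<close>

lemma cinner_zero_left [simp]: "cinner 0 x = 0"
  using cinner_add_left[of 0 0 x] by simp

lemma cinner_zero_right [simp]: "cinner x 0 = 0"
  by (subst cinner_commute) simp

lemma cinner_add_right: "cinner x (y + z) = cinner x y + cinner x z"
  using cinner_add_left[of y z x] cinner_commute[of x "y + z"] cinner_commute[of x y]
    cinner_commute[of x z] by simp

lemma cinner_scaleC_right: "cinner x (c *\<^sub>C y) = cnj c * cinner x y"
  using cinner_scaleC_left[of c y x] cinner_commute[of x "c *\<^sub>C y"] cinner_commute[of x y] by simp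

lemma cinner_minus_left: "cinner (- x) y = - cinner x y"
  using cinner_add_left[of x "- x" y] by (simp add: eq_neg_iff_add_eq_0 add.commute)

lemma cinner_minus_right: "cinner x (- y) = - cinner x y"
  using cinner_add_right[of x y "- y"] by (simp add: eq_neg_iff_add_eq_0 add.commute)

lemma cinner_diff_left: "cinner (x - y) z = cinner x z - cinner y z"
  using cinner_add_left[of x "- y" z] by (simp add: cinner_minus_left)

lemma cinner_diff_right: "cinner x (y - z) = cinner x y - cinner x z"
  using cinner_add_right[of x y "- z"] by (simp add: cinner_minus_right)

lemma cinner_sum_left: "cinner (\<Sum>i\<in>I. f i) y = (\<Sum>i\<in>I. cinner (f i) y)"
  by (induction I rule: infinite_finite_induct) (auto simp: cinner_add_left)

lemma cinner_sum_right: "cinner x (\<Sum>i\<in>I. f i) = (\<Sum>i\<in>I. cinner x (f i))"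
  by (induction I rule: infinite_finite_induct) (auto simp: cinner_add_right)

lemma cinner_scaleR_left: "cinner (r *\<^sub>R x) y = complex_of_real r * cinner x y"
  by (simp flip: scaleC_of_real add: cinner_scaleC_left)

lemma cinner_scaleR_right: "cinner x (r *\<^sub>R y) = complex_of_real r * cinner x y"
  by (simp flip: scaleC_of_real add: cinner_scaleC_right)

lemmas cinner_simps = cinner_add_left cinner_add_right cinner_diff_left cinner_diff_right
  cinner_minus_left cinner_minus_right cinner_scaleC_left cinner_scaleC_right
  cinner_scaleR_left cinner_scaleR_right

lemma norm_scaleC: "norm (c *\<^sub>C x) = cmod c * norm x" for x :: "'a::complex_inner"
proof (rule power2_eq_imp_eq)
  have "complex_of_real ((norm (c *\<^sub>C x))\<^sup>2) = c * cnj c * complex_of_real ((norm x)\<^sup>2)"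
    unfolding cinner_self[symmetric] by (simp add: cinner_simps)
  also have "\<dots> = complex_of_real ((cmod c * norm x)\<^sup>2)"
    by (simp add: complex_norm_square[symmetric] power_mult_distrib)
  finally show "(norm (c *\<^sub>C x))\<^sup>2 = (cmod c * norm x)\<^sup>2"
    by (simp only: of_real_eq_iff)
qed auto

lemma cmod_cinner_le: "cmod (cinner x y) \<le> norm x * norm y" for x y :: "'a::complex_inner"
proof -
  \<comment> \<open>Turning \<open>x\<close> by the phase \<open>c\<close> makes the inner product
    real and nonnegative, so that the real Cauchy-Schwarz inequality applies. Since
    \<open>sgn 0 = 0\<close>, only \<open>cmod c \<le> 1\<close> holds in general.\<close>
  define c where "c = cnj (sgn (cinner x y))"
  have "cmod c \<le> 1"
    by (simp add: c_def norm_sgn)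
  have "complex_of_real (cmod (cinner x y)) = c * cinner x y"
    by (cases "cinner x y = 0")
      (auto simp: c_def sgn_div_norm scaleR_conv_of_real field_simps complex_norm_square[symmetric] power2_eq_square)
  then have "cmod (cinner x y) = Re (cinner (c *\<^sub>C x) y)"
    unfolding cinner_scaleC_left by (metis Re_complex_of_real)
  also have "\<dots> \<le> norm (c *\<^sub>C x) * norm y"
    unfolding inner_eq_Re_cinner[symmetric] by (rule norm_cauchy_schwarz)
  also have "\<dots> \<le> norm x * norm y"
    unfolding norm_scaleC using \<open>cmod c \<le> 1\<close>
    by (intro mult_right_mono) (auto intro: mult_left_le_one_le)
  finally show ?thesis .
qed

section \<open>Algebra of bounded complex-linear operators\<close>

lemma bounded_clinear_add_eq: "bounded_clinear A \<Longrightarrow> A (x + y) = A x + A y"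
  by (simp add: bounded_clinear_def linear_simps)

lemma bounded_clinear_diff_eq: "bounded_clinear A \<Longrightarrow> A (x - y) = A x - A y"
  by (simp add: bounded_clinear_def linear_simps)

lemma bounded_clinear_minus_eq: "bounded_clinear A \<Longrightarrow> A (- x) = - A x"
  by (simp add: bounded_clinear_def linear_simps)

lemma bounded_clinear_zero_eq: "bounded_clinear A \<Longrightarrow> A 0 = 0"
  by (simp add: bounded_clinear_def linear_simps)

lemma bounded_clinear_scaleC_eq: "bounded_clinear A \<Longrightarrow> A (c *\<^sub>C x) = c *\<^sub>C A x"
  by (simp add: bounded_clinear_def)

lemma bounded_clinear_scaleR_eq: "bounded_clinear A \<Longrightarrow> A (r *\<^sub>R x) = r *\<^sub>R A x"
  by (simp add: bounded_clinear_def linear_simps)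

lemma bounded_clinear_sum_eq: "bounded_clinear A \<Longrightarrow> A (\<Sum>i\<in>I. f i) = (\<Sum>i\<in>I. A (f i))"
  by (induction I rule: infinite_finite_induct)
    (auto simp: bounded_clinear_zero_eq bounded_clinear_add_eq)

lemmas bounded_clinear_simps = bounded_clinear_add_eq bounded_clinear_diff_eq
  bounded_clinear_minus_eq bounded_clinear_zero_eq bounded_clinear_scaleC_eq
  bounded_clinear_scaleR_eq

lemma bounded_clinear_bound:
  assumes "bounded_clinear A"
  obtains M where "M > 0" "\<And>x. norm (A x) \<le> M * norm x"
  using bounded_linear.pos_bounded[of A] assms unfolding bounded_clinear_def
  by (metis mult.commute)

lemma bounded_clinearI:
  assumes "\<And>x y. A (x + y) = A x + A y" "\<And>c x. A (c *\<^sub>C x) = c *\<^sub>C A x"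
    "\<And>x. norm (A x) \<le> M * norm x"
  shows "bounded_clinear A"
  unfolding bounded_clinear_def
proof (intro conjI bounded_linear_intro allI)
  show "A (r *\<^sub>R x) = r *\<^sub>R A x" for r x
    using assms(2)[of "complex_of_real r"] by (simp add: scaleC_of_real)
  show "norm (A x) \<le> norm x * M" for x
    using assms(3)[of x] by (simp add: mult.commute)
qed (use assms in auto)

lemma scaleC_scaleR_commute: "c *\<^sub>C (r *\<^sub>R x) = r *\<^sub>R (c *\<^sub>C x)"
  by (simp flip: scaleC_of_real add: scaleC_scaleC mult.commute)

lemma scaleC_sum_right: "c *\<^sub>C (\<Sum>i\<in>I. f i) = (\<Sum>i\<in>I. c *\<^sub>C f i)"
  by (rule complex_vector.scale_sum_right)

lemma scaleC_minus_right: "c *\<^sub>C (- x) = - (c *\<^sub>C x)"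
  by (rule complex_vector.scale_minus_right)

lemma scaleC_diff_right: "c *\<^sub>C (x - y) = c *\<^sub>C x - c *\<^sub>C y"
  by (rule complex_vector.scale_right_diff_distrib)

named_theorems bclin_intro

lemma bounded_clinear_ident [bclin_intro]: "bounded_clinear (\<lambda>x. x)"
  by (simp add: bounded_clinear_def)

lemma bounded_clinear_zero [bclin_intro]: "bounded_clinear (\<lambda>x. 0)"
  by (simp add: bounded_clinear_def)

lemma bounded_clinear_add [bclin_intro]:
  "bounded_clinear A \<Longrightarrow> bounded_clinear B \<Longrightarrow> bounded_clinear (\<lambda>x. A x + B x)"
  by (simp add: bounded_clinear_def bounded_linear_add scaleC_add_right)

lemma bounded_clinear_minus [bclin_intro]:
  "bounded_clinear A \<Longrightarrow> bounded_clinear (\<lambda>x. - A x)"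
  by (simp add: bounded_clinear_def bounded_linear_minus scaleC_minus_right)

lemma bounded_clinear_diff [bclin_intro]:
  "bounded_clinear A \<Longrightarrow> bounded_clinear B \<Longrightarrow> bounded_clinear (\<lambda>x. A x - B x)"
  by (simp add: bounded_clinear_def bounded_linear_sub scaleC_diff_right)

lemma bounded_clinear_scaleR [bclin_intro]:
  "bounded_clinear A \<Longrightarrow> bounded_clinear (\<lambda>x. r *\<^sub>R A x)"
  by (simp add: bounded_clinear_def bounded_linear_const_scaleR scaleC_scaleR_commute)

lemma bounded_clinear_sum [bclin_intro]:
  "(\<And>i. i \<in> I \<Longrightarrow> bounded_clinear (A i)) \<Longrightarrow> bounded_clinear (\<lambda>x. \<Sum>i\<in>I. A i x)"
  by (simp add: bounded_clinear_def bounded_linear_sum scaleC_sum_right)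

text \<open>Kept out of \<open>bclin_intro\<close>: the pattern \<open>A (B x)\<close> unifies with
  every body, so as an automatic introduction rule it could apply forever. Compositions are supplied
  by hand.\<close>

lemma bounded_clinear_compose:
  "bounded_clinear A \<Longrightarrow> bounded_clinear B \<Longrightarrow> bounded_clinear (\<lambda>x. A (B x))"
  by (simp add: bounded_clinear_def bounded_linear_compose)

lemma bounded_clinear_rank_one [bclin_intro]:
  assumes "bounded_clinear A"
  shows "bounded_clinear (\<lambda>x. cinner (A x) y *\<^sub>C z)"
proof -
  obtain M where M: "\<And>x. norm (A x) \<le> M * norm x"
    using bounded_clinear_bound[OF assms] by metis
  show ?thesis
  proof (rule bounded_clinearI)
    show "norm (cinner (A x) y *\<^sub>C z) \<le> (M * norm y * norm z) * norm x" for x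
    proof -
      have "cmod (cinner (A x) y) \<le> M * norm x * norm y"
        using cmod_cinner_le[of "A x" y] M[of x]
        by (meson mult_right_mono norm_ge_zero order_trans)
      then have "cmod (cinner (A x) y) * norm z \<le> M * norm x * norm y * norm z"
        by (rule mult_right_mono) simp
      then show ?thesis
        by (simp add: norm_scaleC algebra_simps)
    qed
  qed (use assms in \<open>auto simp: bounded_clinear_simps cinner_simps scaleC_add_left scaleC_scaleC\<close>)
qed

lemma bounded_clinear_Pair [bclin_intro]:
  "bounded_clinear A \<Longrightarrow> bounded_clinear B \<Longrightarrow> bounded_clinear (\<lambda>x. (A x, B x))"
  by (simp add: bounded_clinear_def bounded_linear_Pair scaleC_prod_def)

lemma bounded_clinear_fst [bclin_intro]: "bounded_clinear A \<Longrightarrow> bounded_clinear (\<lambda>x. fst (A x))"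
  by (auto simp: bounded_clinear_def scaleC_prod_def intro: bounded_linear_fst_comp)

lemma bounded_clinear_snd [bclin_intro]: "bounded_clinear A \<Longrightarrow> bounded_clinear (\<lambda>x. snd (A x))"
  by (auto simp: bounded_clinear_def scaleC_prod_def intro: bounded_linear_snd_comp)

lemma selfadjoint_bounded [bclin_intro]: "selfadjoint A \<Longrightarrow> bounded_clinear A"
  by (simp add: selfadjoint_def)

lemma selfadjoint_cinner: "selfadjoint A \<Longrightarrow> cinner (A x) y = cinner x (A y)"
  by (simp add: selfadjoint_def)

lemma selfadjoint_inner: "selfadjoint A \<Longrightarrow> inner (A x) y = inner x (A y)"
  by (simp add: selfadjoint_def inner_eq_Re_cinner)

lemma selfadjoint_uminus: "selfadjoint A \<Longrightarrow> selfadjoint (\<lambda>x. - A x)"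
  by (simp add: selfadjoint_def bclin_intro cinner_simps)

lemma selfadjoint_block_diag:
  assumes "selfadjoint E" "selfadjoint F"
  shows "selfadjoint (E \<oplus> F)"
proof -
  have "bounded_clinear (\<lambda>p. (E (fst p), F (snd p)))"
    by (intro bclin_intro bounded_clinear_compose[of E] bounded_clinear_compose[of F] assms)
  then have "bounded_clinear (E \<oplus> F)"
    by (simp add: map_prod_def case_prod_beta')
  with assms show ?thesis
    by (auto simp: selfadjoint_def cinner_prod_def)
qed

section \<open>Orthonormal families\<close>

text \<open>Values beyond the first \<open>k\<close> are unconstrained, so a family is extended by
  an update \<open>x(k := y)\<close> and cut down by lowering \<open>k\<close>.\<close>

definition orthonormal :: "nat \<Rightarrow> (nat \<Rightarrow> 'a::complex_inner) \<Rightarrow> bool" where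
  "orthonormal k x \<longleftrightarrow> (\<forall>i<k. \<forall>j<k. cinner (x i) (x j) = (if i = j then 1 else 0))"

lemma orthonormalD: "orthonormal k x \<Longrightarrow> i < k \<Longrightarrow> j < k \<Longrightarrow> cinner (x i) (x j) = (if i = j then 1 else 0)"
  by (simp add: orthonormal_def)

lemma orthonormal_norm: "orthonormal k x \<Longrightarrow> i < k \<Longrightarrow> norm (x i) = 1"
  using orthonormalD[of k x i i] cinner_self[of "x i"] norm_ge_zero[of "x i"]
  by (simp add: power2_eq_1_iff del: norm_ge_zero of_real_power)

lemma orthonormal_mono: "orthonormal k x \<Longrightarrow> j \<le> k \<Longrightarrow> orthonormal j x"
  by (auto simp: orthonormal_def)

lemma orthonormal_Suc:
  assumes "orthonormal k x" "norm y = 1" "\<And>i. i < k \<Longrightarrow> cinner y (x i) = 0"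
  shows "orthonormal (Suc k) (x(k := y))"
  unfolding orthonormal_def
proof (intro allI impI)
  fix i j assume ij: "i < Suc k" "j < Suc k"
  have "cinner (x i) y = 0" if "i < k" for i
    using assms(3)[OF that] cinner_commute[of "x i" y] by simp
  moreover have "cinner y y = 1"
    using assms(2) by (simp add: cinner_self)
  ultimately show "cinner ((x(k := y)) i) ((x(k := y)) j) = (if i = j then 1 else 0)"
    using ij assms by (auto simp: less_Suc_eq orthonormal_def)
qed

lemma cinner_sum_orthonormal:
  assumes "orthonormal k x" "j < k"
  shows "cinner (\<Sum>i<k. c i *\<^sub>C x i) (x j) = c j"
proof -
  have "cinner (\<Sum>i<k. c i *\<^sub>C x i) (x j) = (\<Sum>i<k. if i = j then c i else 0)"
    unfolding cinner_sum_left
    by (rule sum.cong) (use assms in \<open>auto simp: cinner_simps orthonormalD\<close>)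
  then show ?thesis
    using assms(2) by simp
qed

lemma norm_sum_orthonormal:
  assumes "orthonormal k x"
  shows "(norm (\<Sum>i<k. c i *\<^sub>C x i))\<^sup>2 = (\<Sum>i<k. (cmod (c i))\<^sup>2)"
proof -
  have "complex_of_real ((norm (\<Sum>i<k. c i *\<^sub>C x i))\<^sup>2) = (\<Sum>j<k. cnj (c j) * c j)"
    unfolding cinner_self[symmetric]
    by (subst cinner_sum_right)
      (auto simp: cinner_scaleC_right cinner_sum_orthonormal[OF assms] intro!: sum.cong)
  also have "\<dots> = complex_of_real (\<Sum>i<k. (cmod (c i))\<^sup>2)"
    unfolding of_real_sum by (simp only: complex_norm_square mult.commute)
  finally show ?thesis
    by (simp only: of_real_eq_iff)
qed

text \<open>The Gram-Schmidt residual of \<open>z\<close>; for orthonormal \<open>x\<close> it is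
  the component of \<open>z\<close> orthogonal to the span of \<open>x\<close>.\<close>

definition perp_part :: "nat \<Rightarrow> (nat \<Rightarrow> 'a::complex_inner) \<Rightarrow> 'a \<Rightarrow> 'a" where
  "perp_part k x z = z - (\<Sum>i<k. cinner z (x i) *\<^sub>C x i)"

lemma perp_part_orthogonal: "orthonormal k x \<Longrightarrow> j < k \<Longrightarrow> cinner (perp_part k x z) (x j) = 0"
  using cinner_sum_orthonormal[of k x j "\<lambda>i. cinner z (x i)"]
  by (simp add: perp_part_def cinner_diff_left)

lemma norm_perp_part:
  assumes "orthonormal k x"
  shows "(norm (perp_part k x z))\<^sup>2 = (norm z)\<^sup>2 - (\<Sum>i<k. (cmod (cinner z (x i)))\<^sup>2)"
proof -
  define p where "p = (\<Sum>i<k. cinner z (x i) *\<^sub>C x i)"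
  have "cinner (perp_part k x z) p = 0"
    unfolding p_def cinner_sum_right by (simp add: cinner_scaleC_right perp_part_orthogonal[OF assms])
  then have "inner (perp_part k x z) p = 0"
    by (simp add: inner_eq_Re_cinner)
  moreover have "z = perp_part k x z + p"
    by (simp add: perp_part_def p_def)
  ultimately have "(norm z)\<^sup>2 = (norm (perp_part k x z))\<^sup>2 + (norm p)\<^sup>2"
    by (metis norm_add_Pythagorean orthogonal_def)
  then show ?thesis
    using norm_sum_orthonormal[OF assms, of "\<lambda>i. cinner z (x i)"] by (simp add: p_def)
qed

lemma bessel_orthonormal:
  "orthonormal k x \<Longrightarrow> (\<Sum>i<k. (cmod (cinner z (x i)))\<^sup>2) \<le> (norm z)\<^sup>2"
  using norm_perp_part[of k x z] zero_le_power2[of "norm (perp_part k x z)"] by linarith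

lemma orthonormal_inj: "orthonormal k x \<Longrightarrow> inj_on x {..<k}"
  by (rule inj_onI) (metis lessThan_iff orthonormalD zero_neq_one)

lemma cinner_cspan_zero:
  assumes "y \<in> cspan B" "\<And>b. b \<in> B \<Longrightarrow> cinner z b = 0"
  shows "cinner z y = 0"
  using assms(1)
proof (induction rule: complex_vector.span_induct_alt)
  case (step c u v)
  then show ?case
    using assms(2)[of u] by (simp add: cinner_simps)
qed simp

lemma insert_independent_perp:
  assumes "\<not> cdependent B" "\<And>b. b \<in> B \<Longrightarrow> cinner y b = 0" "y \<noteq> 0"
  shows "y \<notin> cspan B" "\<not> cdependent (insert y B)"
proof -
  show "y \<notin> cspan B"
    using cinner_cspan_zero[of y B y] assms cinner_self[of y] by auto
  then show "\<not> cdependent (insert y B)"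
    using assms(1) by (simp add: complex_vector.independent_insert)
qed

lemma orthonormal_independent:
  assumes "orthonormal k x"
  shows "\<not> cdependent (x ` {..<k})"
  using assms
proof (induction k)
  case 0
  then show ?case
    by (simp add: complex_vector.independent_empty)
next
  case (Suc k)
  have "\<not> cdependent (x ` {..<k})"
    using Suc.IH orthonormal_mono[OF Suc.prems] by simp
  moreover have "cinner (x k) b = 0" if "b \<in> x ` {..<k}" for b
    using that Suc.prems by (auto simp: orthonormalD)
  moreover have "x k \<noteq> 0"
    using orthonormal_norm[OF Suc.prems, of k] by auto
  ultimately show ?case
    using insert_independent_perp[of "x ` {..<k}" "x k"] by (simp add: lessThan_Suc)
qed

section \<open>Dimension counting by orthogonal projection\<close>

lemma orthogonal_projection_exists:
  fixes z :: "'a::complex_inner"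
  assumes "finite B"
  shows "\<exists>p\<in>cspan B. \<forall>b\<in>B. cinner (z - p) b = 0"
  using assms
proof (induction B arbitrary: z rule: finite_induct)
  case (insert b B)
  obtain p q where p: "p \<in> cspan B" "\<forall>y\<in>B. cinner (z - p) y = 0"
    and q: "q \<in> cspan B" "\<forall>y\<in>B. cinner (b - q) y = 0"
    using insert.IH by meson
  define e where "e = b - q"
  \<comment> \<open>If \<open>b\<close> already lies in \<open>cspan B\<close>, then
    \<open>e = 0\<close>, and division by zero gives \<open>t = 0\<close>, which is a correct
    coefficient. So dependent sets \<open>B\<close> are covered.\<close>
  define t where "t = cinner (z - p) e / cinner e e"
  define w where "w = z - (p + t *\<^sub>C e)"
  have wB: "cinner w y = 0" if "y \<in> B" for y
  proof -
    have "w = (z - p) - t *\<^sub>C e"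
      by (simp add: w_def)
    then show ?thesis
      using p(2) q(2) that by (simp add: e_def cinner_diff_left[of "z - p"] cinner_scaleC_left)
  qed
  have "cinner w e = cinner (z - p) e - t * cinner e e"
    by (simp add: w_def cinner_simps)
  also have "\<dots> = 0"
    by (cases "e = 0") (simp_all add: t_def cinner_self)
  moreover have "cinner w q = 0"
    by (rule cinner_cspan_zero[OF q(1) wB])
  ultimately have "cinner w b = 0"
    by (simp add: e_def cinner_diff_right)
  moreover have "p + t *\<^sub>C e \<in> cspan (insert b B)"
    unfolding e_def using p(1) q(1) complex_vector.span_mono[of B "insert b B"]
    by (intro complex_vector.span_add complex_vector.span_scale complex_vector.span_diff)
      (auto intro: complex_vector.span_base)
  ultimately show ?case
    using wB by (intro bexI[of _ "p + t *\<^sub>C e"]) (auto simp: w_def)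
qed simp

text \<open>A dimension count: a space of dimension \<open>n + 1\<close> meets the orthogonal
  complement of any \<open>n\<close> vectors. The vectors of \<open>B\<close> are first projected
  into the span of \<open>x\<close>, where there are too few of them to span it.\<close>

lemma exists_unit_perp_in_span:
  fixes x :: "nat \<Rightarrow> 'a::complex_inner"
  assumes x: "orthonormal (Suc n) x" and B: "finite B" "card B \<le> n"
  obtains c where "(\<Sum>j<Suc n. (cmod (c j))\<^sup>2) = 1" "(\<Sum>j<Suc n. c j *\<^sub>C x j) \<in> unit_perp (cspan B)"
proof -
  \<comment> \<open>\<open>P\<close> is the orthogonal projection onto the span of \<open>x\<close>.
    Some \<open>x j\<close> lies outside the span of the image of \<open>B\<close>, and its residual
    \<open>w\<close> below is the vector sought, up to scaling.\<close>
  define P where "P y = (\<Sum>i<Suc n. cinner y (x i) *\<^sub>C x i)" for y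
  have P_lin: "P (y + z) = P y + P z" "P (y - z) = P y - P z" "P (c *\<^sub>C y) = c *\<^sub>C P y" for c y z
    unfolding P_def cinner_simps scaleC_add_left complex_vector.scale_left_diff_distrib
    by (simp_all only: sum.distrib sum_subtractf scaleC_sum_right scaleC_scaleC)
  have PP: "P (P y) = P y" for y
    unfolding P_def[of "P y"] unfolding P_def
    by (rule sum.cong) (simp_all add: cinner_sum_orthonormal[OF x] del: sum.lessThan_Suc)
  have swap: "cinner y (P z) = cinner (P y) z" for y z
    unfolding P_def cinner_sum_left cinner_sum_right cinner_simps
    by (rule sum.cong) (simp_all only: cinner_commute[of "x _" z] mult.commute)
  have "card (P ` B) \<le> n"
    using card_image_le[OF B(1), of P] B(2) by linarith
  then have "\<not> x ` {..<Suc n} \<subseteq> cspan (P ` B)"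
    using complex_vector.independent_span_bound[OF finite_imageI[OF B(1)] orthonormal_independent[OF x]]
      card_image[OF orthonormal_inj[OF x]] by fastforce
  then obtain j where j: "j < Suc n" "x j \<notin> cspan (P ` B)"
    by auto
  obtain p where p: "p \<in> cspan (P ` B)" "\<And>b. b \<in> P ` B \<Longrightarrow> cinner (x j - p) b = 0"
    using orthogonal_projection_exists[OF finite_imageI[OF B(1)], of P "x j"] by blast
  define w where "w = x j - p"
  have "w \<noteq> 0"
    using j(2) p(1) by (auto simp: w_def)
  have "P p = p"
    using p(1)
  proof (induction rule: complex_vector.span_induct_alt)
    case base
    then show ?case by (simp add: P_def)
  next
    case (step c u v)
    then show ?case
      using PP by (auto simp: P_lin)
  qed
  moreover have "P (x j) = (\<Sum>i<Suc n. if i = j then x i else 0)"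
    unfolding P_def by (rule sum.cong) (auto simp: orthonormalD[OF x j(1)])
  ultimately have "P w = w"
    using j(1) by (simp add: w_def P_lin del: sum.lessThan_Suc)
  define c where "c i = complex_of_real (1 / norm w) * cinner w (x i)" for i
  have sum_c: "(\<Sum>i<Suc n. c i *\<^sub>C x i) = (1 / norm w) *\<^sub>R w"
    by (subst (2) \<open>P w = w\<close>[symmetric]) (simp only: P_def c_def scaleC_of_real scaleC_scaleC[symmetric] scaleR_sum_right)
  \<comment> \<open>\<open>w\<close> is orthogonal to \<open>P y\<close> and fixed by
    \<open>P\<close>, and \<open>P\<close> can be moved across the inner product.\<close>
  have "cinner w y = 0" if "y \<in> B" for y
    using swap[of w y] p(2)[of "P y"] that \<open>P w = w\<close> by (simp add: w_def)
  then have "cinner w y = 0" if "y \<in> cspan B" for y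
    using cinner_cspan_zero[OF that] by blast
  then have "(\<Sum>i<Suc n. c i *\<^sub>C x i) \<in> unit_perp (cspan B)"
    unfolding sum_c using \<open>w \<noteq> 0\<close> by (simp add: unit_perp_def cinner_scaleR_left)
  moreover from this have "(\<Sum>i<Suc n. (cmod (c i))\<^sup>2) = 1"
    unfolding norm_sum_orthonormal[OF x, symmetric] by (simp add: unit_perp_def)
  ultimately show ?thesis
    using that by blast
qed

lemma cspan_orthonormal_in_cfindim:
  assumes "orthonormal k x"
  shows "cspan (x ` {..<k}) \<in> cfindim_subspaces k"
  using assms orthonormal_independent[OF assms] orthonormal_inj[OF assms]
  by (auto simp: cfindim_subspaces_def card_image intro!: exI[of _ "x ` {..<k}"])

lemma unit_perp_orthonormal:
  "\<psi> \<in> unit_perp (cspan (x ` {..<k})) \<longleftrightarrow> norm \<psi> = 1 \<and> (\<forall>i<k. cinner \<psi> (x i) = 0)"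
  using cinner_cspan_zero[of _ "x ` {..<k}" \<psi>]
  by (auto simp: unit_perp_def complex_vector.span_base)

text \<open>Infinite dimension in the form that the min-max arguments consume. It passes from a
  factor to a direct sum at once and is also available for \<open>nat ell2\<close>.\<close>

definition inf_dim :: "'a::complex_inner itself \<Rightarrow> bool" where
  "inf_dim _ \<longleftrightarrow> (\<forall>k. \<exists>x :: nat \<Rightarrow> 'a. orthonormal k x)"

lemma inf_dimI:
  assumes "\<not> (\<exists>B :: 'a::complex_inner set. finite B \<and> cspan B = UNIV)"
  shows "inf_dim TYPE('a)"
proof -
  have "\<exists>x :: nat \<Rightarrow> 'a. orthonormal k x" for k
  proof (induction k)
    case 0
    then show ?case by (simp add: orthonormal_def)
  next
    case (Suc k)
    then obtain x :: "nat \<Rightarrow> 'a" where x: "orthonormal k x" by blast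
    have "cspan (x ` {..<k}) \<noteq> UNIV"
      using assms by blast
    then obtain z where z: "z \<notin> cspan (x ` {..<k})"
      by blast
    let ?q = "perp_part k x z"
    have "?q \<noteq> 0"
    proof
      assume "?q = 0"
      then have "z = (\<Sum>i<k. cinner z (x i) *\<^sub>C x i)"
        by (simp add: perp_part_def)
      also have "\<dots> \<in> cspan (x ` {..<k})"
        by (intro complex_vector.span_sum complex_vector.span_scale complex_vector.span_base) auto
      finally show False
        using z by blast
    qed
    then have "orthonormal (Suc k) (x(k := (1 / norm ?q) *\<^sub>R ?q))"
      using perp_part_orthogonal[OF x] by (intro orthonormal_Suc[OF x]) (auto simp: cinner_scaleR_left)
    then show ?case by blast
  qed
  then show ?thesis
    by (simp add: inf_dim_def)
qed

lemma inf_dim_prod: "inf_dim TYPE('a::complex_inner) \<Longrightarrow> inf_dim TYPE('a \<times> 'b::complex_inner)"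
proof -
  assume a: "inf_dim TYPE('a)"
  have "\<exists>x :: nat \<Rightarrow> 'a \<times> 'b. orthonormal k x" for k
  proof -
    obtain x :: "nat \<Rightarrow> 'a" where "orthonormal k x"
      using a by (auto simp: inf_dim_def)
    then have "orthonormal k (\<lambda>i. (x i, 0 :: 'b))"
      by (simp add: orthonormal_def cinner_prod_def)
    then show ?thesis by blast
  qed
  then show ?thesis
    by (simp add: inf_dim_def)
qed

lemma inf_dim_unit_perp:
  assumes "inf_dim TYPE('a::complex_inner)" "finite B"
  shows "unit_perp (cspan B :: 'a set) \<noteq> {}"
proof -
  obtain x :: "nat \<Rightarrow> 'a" where "orthonormal (Suc (card B)) x"
    using assms(1) by (auto simp: inf_dim_def)
  from exists_unit_perp_in_span[OF this assms(2) order_refl] show ?thesis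
    by blast
qed

section \<open>The spectral scale\<close>

text \<open>The two halves of the spectral scale, both counted from zero: entry \<open>n\<close>
  here belongs to the index \<open>n + 1\<close>, and entry \<open>n\<close> of
  \<open>lower_scale\<close> to the index \<open>-(n + 1)\<close>.\<close>

definition upper_scale :: "('a::complex_inner \<Rightarrow> 'a) \<Rightarrow> nat \<Rightarrow> real" where
  "upper_scale A n = spectral_scale A (int n + 1)"

definition lower_scale :: "('a::complex_inner \<Rightarrow> 'a) \<Rightarrow> nat \<Rightarrow> real" where
  "lower_scale A n = spectral_scale A (- (int n + 1))"

lemma spectral_spread_eq: "spectral_spread A n = upper_scale A n - lower_scale A n"
  by (simp add: spectral_spread_def upper_scale_def lower_scale_def)

lemma upper_scale_alt:
  "upper_scale A n = (INF S\<in>cfindim_subspaces n. SUP \<psi>\<in>unit_perp S. inner (A \<psi>) \<psi>)"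
  by (simp add: upper_scale_def spectral_scale_def inner_eq_Re_cinner)

text \<open>Infima of a form are negated suprema of the negated form. Bounds at the lower end are
  thus obtained from bounds at the upper end.\<close>

lemma lower_scale_uminus: "lower_scale A n = - upper_scale (\<lambda>x. - A x) n"
proof -
  have "(INF \<psi>\<in>unit_perp S. inner (A \<psi>) \<psi>) = - (SUP \<psi>\<in>unit_perp S. inner (- A \<psi>) \<psi>)" for S
    by (simp add: Inf_real_def image_image)
  then have "lower_scale A n = (SUP S\<in>cfindim_subspaces n. - (SUP \<psi>\<in>unit_perp S. inner (- A \<psi>) \<psi>))"
    by (simp add: lower_scale_def spectral_scale_def inner_eq_Re_cinner)
  then show ?thesis
    unfolding upper_scale_alt by (simp add: Inf_real_def image_image)
qed

lemma upper_scale_uminus: "upper_scale (\<lambda>x. - A x) n = - lower_scale A n"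
  by (simp add: lower_scale_uminus)

lemma abs_form_le:
  assumes "\<And>x. norm (A x) \<le> M * norm x"
  shows "\<bar>inner (A x) x\<bar> \<le> M * (norm x)\<^sup>2"
proof -
  have "\<bar>inner (A x) x\<bar> \<le> norm (A x) * norm x"
    by (rule Cauchy_Schwarz_ineq2)
  also have "\<dots> \<le> M * norm x * norm x"
    using assms by (intro mult_right_mono) auto
  finally show ?thesis
    by (simp add: power2_eq_square mult.assoc)
qed

lemma unit_perp_form_bounded:
  assumes "bounded_clinear A"
  obtains M where "\<And>\<psi> S. \<psi> \<in> unit_perp S \<Longrightarrow> \<bar>inner (A \<psi>) \<psi>\<bar> \<le> M"
proof -
  obtain M where M: "\<And>x. norm (A x) \<le> M * norm x"
    using bounded_clinear_bound[OF assms] by metis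
  have "\<bar>inner (A \<psi>) \<psi>\<bar> \<le> M" if "\<psi> \<in> unit_perp S" for \<psi> S
    using abs_form_le[of A M \<psi>, OF M] that by (simp add: unit_perp_def)
  then show ?thesis
    by (rule that)
qed

lemma form_le_SUP:
  assumes "bounded_clinear A" "\<psi> \<in> unit_perp S"
  shows "inner (A \<psi>) \<psi> \<le> (SUP \<psi>\<in>unit_perp S. inner (A \<psi>) \<psi>)"
proof -
  obtain M where "\<And>\<psi> S. \<psi> \<in> unit_perp S \<Longrightarrow> \<bar>inner (A \<psi>) \<psi>\<bar> \<le> M"
    using unit_perp_form_bounded[OF assms(1)] by metis
  then have "bdd_above ((\<lambda>\<psi>. inner (A \<psi>) \<psi>) ` unit_perp S)"
    by (intro bdd_aboveI[of _ M]) force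
  with assms(2) show ?thesis
    by (rule cSUP_upper)
qed

lemma cfindim_unit_perp_nonempty:
  "inf_dim TYPE('a::complex_inner) \<Longrightarrow> S \<in> cfindim_subspaces n \<Longrightarrow> unit_perp (S :: 'a set) \<noteq> {}"
  unfolding cfindim_subspaces_def using inf_dim_unit_perp by blast

lemma upper_scale_le:
  fixes A :: "'a::complex_inner \<Rightarrow> 'a"
  assumes "bounded_clinear A" "inf_dim TYPE('a)" "S \<in> cfindim_subspaces n"
    and "\<And>\<psi>. \<psi> \<in> unit_perp S \<Longrightarrow> inner (A \<psi>) \<psi> \<le> a"
  shows "upper_scale A n \<le> a"
proof -
  obtain M where M: "\<And>\<psi> S. \<psi> \<in> unit_perp S \<Longrightarrow> \<bar>inner (A \<psi>) \<psi>\<bar> \<le> M"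
    using unit_perp_form_bounded[OF assms(1)] by metis
  \<comment> \<open>A real infimum is informative only over a set bounded below. Infinite dimension
    puts a unit vector into every \<open>unit_perp T\<close>, and its form value is at least
    \<open>- M\<close>.\<close>
  have "bdd_below ((\<lambda>S. SUP \<psi>\<in>unit_perp S. inner (A \<psi>) \<psi>) ` cfindim_subspaces n)"
  proof (rule bdd_belowI2)
    fix T :: "'a set" assume "T \<in> cfindim_subspaces n"
    then obtain \<psi> where "\<psi> \<in> unit_perp T"
      using cfindim_unit_perp_nonempty[OF assms(2)] by blast
    then show "- M \<le> (SUP \<psi>\<in>unit_perp T. inner (A \<psi>) \<psi>)"
      using M[of \<psi> T] form_le_SUP[OF assms(1), of \<psi> T] by linarith
  qed
  then show ?thesis
    unfolding upper_scale_alt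
    using assms(3) by (rule cINF_lower2)
      (rule cSUP_least[OF cfindim_unit_perp_nonempty[OF assms(2,3)] assms(4)])
qed

lemma cfindim_subspaces_nonempty:
  "inf_dim TYPE('a::complex_inner) \<Longrightarrow> (cfindim_subspaces n :: 'a set set) \<noteq> {}"
  unfolding inf_dim_def using cspan_orthonormal_in_cfindim by blast

lemma upper_scale_ge:
  fixes A :: "'a::complex_inner \<Rightarrow> 'a"
  assumes "bounded_clinear A" "inf_dim TYPE('a)"
    and "\<And>S. S \<in> cfindim_subspaces n \<Longrightarrow> \<exists>\<psi>\<in>unit_perp S. a \<le> inner (A \<psi>) \<psi>"
  shows "a \<le> upper_scale A n"
  unfolding upper_scale_alt
proof (rule cINF_greatest[OF cfindim_subspaces_nonempty[OF assms(2)]])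
  fix S :: "'a set" assume "S \<in> cfindim_subspaces n"
  then obtain \<psi> where "\<psi> \<in> unit_perp S" "a \<le> inner (A \<psi>) \<psi>"
    using assms(3) by blast
  then show "a \<le> (SUP \<psi>\<in>unit_perp S. inner (A \<psi>) \<psi>)"
    using form_le_SUP[OF assms(1), of \<psi> S] by linarith
qed

lemma unit_perp_cspan_mono: "B \<subseteq> C \<Longrightarrow> unit_perp (cspan C) \<subseteq> unit_perp (cspan B)"
  using complex_vector.span_mono[of B C] by (auto simp: unit_perp_def)

text \<open>Adding to \<open>S\<close> a unit vector orthogonal to it raises the dimension by one
  and shrinks \<open>unit_perp S\<close>, hence the supremum.\<close>

lemma upper_scale_Suc_le:
  fixes A :: "'a::complex_inner \<Rightarrow> 'a"
  assumes A: "bounded_clinear A" and inf: "inf_dim TYPE('a)"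
  shows "upper_scale A (Suc n) \<le> upper_scale A n"
  unfolding upper_scale_alt[of A n]
proof (rule cINF_greatest[OF cfindim_subspaces_nonempty[OF inf]])
  fix S :: "'a set" assume "S \<in> cfindim_subspaces n"
  then obtain B where B: "S = cspan B" "finite B" "\<not> cdependent B" "card B = n"
    by (auto simp: cfindim_subspaces_def)
  then obtain \<psi> where \<psi>: "\<psi> \<in> unit_perp (cspan B)"
    using inf_dim_unit_perp[OF inf B(2)] by blast
  then have "\<And>b. b \<in> B \<Longrightarrow> cinner \<psi> b = 0" "\<psi> \<noteq> 0"
    by (auto simp: unit_perp_def complex_vector.span_base)
  note ind = insert_independent_perp[OF B(3) this]
  then have "\<psi> \<notin> B"
    using complex_vector.span_base by blast
  with B ind have "cspan (insert \<psi> B) \<in> cfindim_subspaces (Suc n)"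
    by (auto simp: cfindim_subspaces_def intro!: exI[of _ "insert \<psi> B"])
  then show "upper_scale A (Suc n) \<le> (SUP \<psi>\<in>unit_perp S. inner (A \<psi>) \<psi>)"
    by (rule upper_scale_le[OF A inf])
      (use unit_perp_cspan_mono[of B "insert \<psi> B"] B(1) form_le_SUP[OF A] in blast)
qed

lemma upper_scale_antimono:
  fixes A :: "'a::complex_inner \<Rightarrow> 'a"
  assumes "bounded_clinear A" "inf_dim TYPE('a)" "i \<le> j"
  shows "upper_scale A j \<le> upper_scale A i"
  using assms(3) upper_scale_Suc_le[OF assms(1,2)] by (rule lift_Suc_antimono_le[rotated])

lemma lower_scale_mono:
  fixes A :: "'a::complex_inner \<Rightarrow> 'a"
  assumes "bounded_clinear A" "inf_dim TYPE('a)" "i \<le> j"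
  shows "lower_scale A i \<le> lower_scale A j"
  using upper_scale_antimono[OF bounded_clinear_minus[OF assms(1)] assms(2,3)]
  by (simp add: lower_scale_uminus)

text \<open>Two finite-dimensional subspaces leave a unit vector orthogonal to both, whatever their
  dimensions, and its form value lies between the corresponding infimum and supremum.\<close>

lemma lower_scale_le_upper_scale:
  fixes A :: "'a::complex_inner \<Rightarrow> 'a"
  assumes A: "bounded_clinear A" and inf: "inf_dim TYPE('a)"
  shows "lower_scale A m \<le> upper_scale A n"
  unfolding upper_scale_alt
proof (rule cINF_greatest[OF cfindim_subspaces_nonempty[OF inf]])
  fix S :: "'a set" assume "S \<in> cfindim_subspaces n"
  then obtain B where B: "S = cspan B" "finite B"
    by (auto simp: cfindim_subspaces_def)
  let ?c = "SUP \<psi>\<in>unit_perp S. inner (A \<psi>) \<psi>"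
  have "- ?c \<le> upper_scale (\<lambda>x. - A x) m"
  proof (rule upper_scale_ge[OF bounded_clinear_minus[OF A] inf])
    fix T :: "'a set" assume "T \<in> cfindim_subspaces m"
    then obtain C where C: "T = cspan C" "finite C"
      by (auto simp: cfindim_subspaces_def)
    obtain \<psi> where "\<psi> \<in> unit_perp (cspan (B \<union> C))"
      using inf_dim_unit_perp[OF inf, of "B \<union> C"] B C by blast
    then have "\<psi> \<in> unit_perp S" "\<psi> \<in> unit_perp T"
      using unit_perp_cspan_mono[of B "B \<union> C"] unit_perp_cspan_mono[of C "B \<union> C"] B C by auto
    then show "\<exists>\<psi>\<in>unit_perp T. - ?c \<le> inner (- A \<psi>) \<psi>"
      using form_le_SUP[OF A, of \<psi> S] by auto
  qed
  then show "lower_scale A m \<le> ?c"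
    by (simp add: lower_scale_uminus)
qed

text \<open>For every \<open>S\<close> of dimension \<open>n\<close>, some unit vector in the span
  of the \<open>n + 1\<close> vectors is orthogonal to \<open>S\<close>, so a lower bound of the
  form on that span is enough.\<close>

lemma upper_scale_ge_orthonormal:
  fixes A :: "'a::complex_inner \<Rightarrow> 'a"
  assumes "bounded_clinear A" "inf_dim TYPE('a)" "orthonormal (Suc n) x"
    and form: "\<And>c. a * (\<Sum>i<Suc n. (cmod (c i))\<^sup>2)
      \<le> inner (A (\<Sum>i<Suc n. c i *\<^sub>C x i)) (\<Sum>i<Suc n. c i *\<^sub>C x i)"
  shows "a \<le> upper_scale A n"
proof (rule upper_scale_ge[OF assms(1,2)])
  fix S :: "'a set" assume "S \<in> cfindim_subspaces n"
  then obtain B where B: "S = cspan B" "finite B" "card B \<le> n"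
    by (auto simp: cfindim_subspaces_def)
  obtain c where c: "(\<Sum>j<Suc n. (cmod (c j))\<^sup>2) = 1"
    "(\<Sum>j<Suc n. c j *\<^sub>C x j) \<in> unit_perp (cspan B)"
    using exists_unit_perp_in_span[OF assms(3) B(2,3)] by metis
  show "\<exists>\<psi>\<in>unit_perp S. a \<le> inner (A \<psi>) \<psi>"
    using form[of c] c(2) unfolding c(1) B(1) by auto
qed

lemma upper_scale_le_orthonormal:
  fixes A :: "'a::complex_inner \<Rightarrow> 'a"
  assumes "bounded_clinear A" "inf_dim TYPE('a)" "orthonormal n x"
    and "\<And>\<psi>. norm \<psi> = 1 \<Longrightarrow> (\<And>i. i < n \<Longrightarrow> cinner \<psi> (x i) = 0) \<Longrightarrow> inner (A \<psi>) \<psi> \<le> a"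
  shows "upper_scale A n \<le> a"
  by (rule upper_scale_le[OF assms(1,2) cspan_orthonormal_in_cfindim[OF assms(3)]])
    (use assms(4) in \<open>auto simp: unit_perp_orthonormal\<close>)

section \<open>Approximate eigenvectors\<close>

text \<open>The error matrix contributes at most \<open>\<delta>\<close> times the square of the sum
  of the \<open>cmod (c i)\<close>. Cauchy-Schwarz turns this into \<open>N * \<delta>\<close> times
  the sum of the squares.\<close>

lemma form_almost_diagonal:
  assumes "bounded_clinear A"
    and err: "\<And>i j. i < N \<Longrightarrow> j < N \<Longrightarrow>
      cmod (cinner (A (y i)) (y j) - (if i = j then complex_of_real (a i) else 0)) \<le> \<delta>"
    and a: "\<And>i. i < N \<Longrightarrow> b \<le> a i"
  shows "(b - real N * \<delta>) * (\<Sum>i<N. (cmod (c i))\<^sup>2)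
    \<le> inner (A (\<Sum>i<N. c i *\<^sub>C y i)) (\<Sum>i<N. c i *\<^sub>C y i)"
proof (cases "N = 0")
  case False
  define e where "e i j = cinner (A (y i)) (y j) - (if i = j then complex_of_real (a i) else 0)" for i j
  have "\<delta> \<ge> 0"
    using err[of 0 0] False by (meson gr0I norm_ge_zero order_trans)
  have "cinner (A (\<Sum>i<N. c i *\<^sub>C y i)) (\<Sum>j<N. c j *\<^sub>C y j)
      = (\<Sum>i<N. \<Sum>j<N. c i * cnj (c j) * cinner (A (y i)) (y j))"
    unfolding bounded_clinear_sum_eq[OF assms(1)] cinner_sum_left
    by (simp add: assms(1) bounded_clinear_simps cinner_sum_right cinner_simps sum_distrib_left mult_ac)
  also have "\<dots> = (\<Sum>i<N. \<Sum>j<N. c i * cnj (c j) * (if i = j then complex_of_real (a i) else 0))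
      + (\<Sum>i<N. \<Sum>j<N. c i * cnj (c j) * e i j)"
    by (simp add: e_def sum.distrib[symmetric] distrib_left[symmetric])
  also have "(\<Sum>i<N. \<Sum>j<N. c i * cnj (c j) * (if i = j then complex_of_real (a i) else 0))
      = complex_of_real (\<Sum>i<N. a i * (cmod (c i))\<^sup>2)"
    unfolding of_real_sum of_real_mult
    by (rule sum.cong) (simp_all add: if_distrib[of "\<lambda>x. _ * x"] sum.delta complex_norm_square[symmetric] cong: if_cong)
  finally have eq: "inner (A (\<Sum>i<N. c i *\<^sub>C y i)) (\<Sum>j<N. c j *\<^sub>C y j)
      = (\<Sum>i<N. a i * (cmod (c i))\<^sup>2) + Re (\<Sum>i<N. \<Sum>j<N. c i * cnj (c j) * e i j)"
    by (simp add: inner_eq_Re_cinner)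
  have "cmod (\<Sum>i<N. \<Sum>j<N. c i * cnj (c j) * e i j) \<le> (\<Sum>i<N. \<Sum>j<N. cmod (c i) * cmod (c j) * \<delta>)"
  proof (intro sum_norm_le)
    fix i j assume "i \<in> {..<N}" "j \<in> {..<N}"
    then show "cmod (c i * cnj (c j) * e i j) \<le> cmod (c i) * cmod (c j) * \<delta>"
      using err[of i j] by (auto simp: norm_mult e_def intro!: mult_left_mono)
  qed
  also have "\<dots> = \<delta> * (\<Sum>i<N. cmod (c i))\<^sup>2"
    by (simp add: power2_eq_square sum_product sum_distrib_left mult_ac)
  also have "\<dots> \<le> \<delta> * ((\<Sum>i<N. (cmod (c i))\<^sup>2) * real N)"
    using sum_squared_le_sum_of_squares[of "\<lambda>i. cmod (c i)" "{..<N}"] \<open>\<delta> \<ge> 0\<close>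
    by (intro mult_left_mono) (auto simp: mult.commute)
  finally have "- (\<delta> * ((\<Sum>i<N. (cmod (c i))\<^sup>2) * real N)) \<le> Re (\<Sum>i<N. \<Sum>j<N. c i * cnj (c j) * e i j)"
    using abs_Re_le_cmod[of "\<Sum>i<N. \<Sum>j<N. c i * cnj (c j) * e i j"] by linarith
  moreover have "b * (\<Sum>i<N. (cmod (c i))\<^sup>2) \<le> (\<Sum>i<N. a i * (cmod (c i))\<^sup>2)"
    unfolding sum_distrib_left using a by (intro sum_mono mult_right_mono) auto
  ultimately show ?thesis
    unfolding eq by (simp add: algebra_simps)
qed simp

lemma selfadjoint_form_real:
  "selfadjoint A \<Longrightarrow> cinner (A x) x = complex_of_real (inner (A x) x)"
  using selfadjoint_cinner[of A x x] cinner_commute[of "A x" x]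
  by (simp add: complex_eq_iff inner_eq_Re_cinner)

lemma form_le_of_unit:
  assumes "bounded_clinear A"
    and "norm x \<noteq> 0 \<Longrightarrow> inner (A ((1 / norm x) *\<^sub>R x)) ((1 / norm x) *\<^sub>R x) \<le> a"
  shows "inner (A x) x \<le> a * (norm x)\<^sup>2"
proof (cases "x = 0")
  case True
  then show ?thesis by simp
next
  case False
  have "inner (A ((1 / norm x) *\<^sub>R x)) ((1 / norm x) *\<^sub>R x) = inner (A x) x / (norm x)\<^sup>2"
    unfolding bounded_clinear_scaleR_eq[OF assms(1)] by (simp add: power2_eq_square)
  then have "inner (A x) x / (norm x)\<^sup>2 \<le> a"
    using assms(2) False by simp
  then show ?thesis
    using False by (simp add: pos_divide_le_eq)
qed

text \<open>On the orthogonal complement of the \<open>x i\<close> the form of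
  \<open>B = \<mu> - A\<close> is nonnegative, and at \<open>y\<close> it is almost zero. As in
  Cauchy-Schwarz for positive forms, the component of \<open>B y\<close> in the complement is then
  small. Its components along the \<open>x i\<close> are small because these are almost
  eigenvectors.\<close>

lemma approx_eigenvector_step:
  assumes A: "selfadjoint A" and M: "\<And>x. norm (A x) \<le> M * norm x" "M > 0"
    and x: "orthonormal k x"
    and \<delta>: "\<And>i. i < k \<Longrightarrow> norm (A (x i) - l i *\<^sub>R x i) \<le> \<delta>"
    and y: "norm y = 1" "\<And>i. i < k \<Longrightarrow> cinner y (x i) = 0"
    and \<mu>: "\<And>w. (\<And>i. i < k \<Longrightarrow> cinner w (x i) = 0) \<Longrightarrow> inner (A w) w \<le> \<mu> * (norm w)\<^sup>2"
    and near: "\<mu> - \<delta> \<le> inner (A y) y"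
    and "\<bar>\<mu>\<bar> \<le> M"
  shows "norm (\<mu> *\<^sub>R y - A y) \<le> real k * \<delta> + sqrt (2 * M * \<delta>)"
proof -
  have Ab: "bounded_clinear A" by (rule selfadjoint_bounded[OF A])
  define B where "B v = \<mu> *\<^sub>R v - A v" for v
  have Bb: "bounded_clinear B"
    unfolding B_def by (intro bclin_intro Ab)
  define z where "z = B y"
  define v where "v = perp_part k x z"
  have v_perp: "cinner v (x i) = 0" if "i < k" for i
    unfolding v_def using perp_part_orthogonal[OF x that] .
  have zv: "inner z v = (norm v)\<^sup>2"
  proof -
    have "z = v + (\<Sum>i<k. cinner z (x i) *\<^sub>C x i)"
      by (simp add: v_def perp_part_def)
    moreover have "cinner (\<Sum>i<k. cinner z (x i) *\<^sub>C x i) v = 0"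
      unfolding cinner_sum_left
      using v_perp cinner_commute[of "x _" v] by (intro sum.neutral) (auto simp: cinner_scaleC_left)
    ultimately have "cinner z v = cinner v v"
      by (metis add.right_neutral cinner_add_left)
    then show ?thesis
      by (simp add: inner_eq_Re_cinner cinner_self)
  qed
  \<comment> \<open>This \<open>t\<close> minimises the bound \<open>\<delta> - 2 * t * (norm
    v)\<^sup>2 + t\<^sup>2 * (2 * M * (norm v)\<^sup>2)\<close> reached below.\<close>
  define t where "t = 1 / (2 * M)"
  have "0 \<le> inner (B (y - t *\<^sub>R v)) (y - t *\<^sub>R v)"
  proof -
    have "cinner (y - t *\<^sub>R v) (x i) = 0" if "i < k" for i
      using y(2)[OF that] v_perp[OF that] by (simp add: cinner_simps)
    from \<mu>[OF this] show ?thesis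
      by (simp add: B_def inner_diff_left power2_norm_eq_inner)
  qed
  also have "\<dots> = inner (B y) y - 2 * t * inner (B y) v + t\<^sup>2 * inner (B v) v"
  proof -
    have "inner (B v) y = inner (B y) v"
      unfolding B_def using selfadjoint_inner[OF A, of v y]
      by (simp add: inner_diff_left inner_diff_right inner_commute)
    then show ?thesis
      using Bb by (simp add: bounded_clinear_simps inner_diff_left inner_diff_right power2_eq_square algebra_simps)
  qed
  also have "inner (B y) v = (norm v)\<^sup>2"
    using zv by (simp add: z_def)
  also have "inner (B y) y \<le> \<delta>"
    using near y(1) by (simp add: B_def inner_diff_left power2_norm_eq_inner[symmetric])
  also have "inner (B v) v \<le> 2 * M * (norm v)\<^sup>2"
  proof -
    have "\<mu> * (norm v)\<^sup>2 \<le> M * (norm v)\<^sup>2"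
      using \<open>\<bar>\<mu>\<bar> \<le> M\<close> by (intro mult_right_mono) auto
    moreover have "- inner (A v) v \<le> M * (norm v)\<^sup>2"
      using abs_form_le[OF M(1), of v] by linarith
    ultimately show ?thesis
      by (simp add: B_def inner_diff_left power2_norm_eq_inner)
  qed
  finally have "0 \<le> \<delta> - 2 * t * (norm v)\<^sup>2 + t\<^sup>2 * (2 * M * (norm v)\<^sup>2)"
    by (simp add: mult_left_mono)
  also have "\<dots> = \<delta> - (norm v)\<^sup>2 / (2 * M)"
    using M(2) by (simp add: t_def power2_eq_square field_simps)
  finally have "(norm v)\<^sup>2 \<le> 2 * M * \<delta>"
    using M(2) by (simp add: field_simps)
  then have nv: "norm v \<le> sqrt (2 * M * \<delta>)"
    by (rule real_le_rsqrt)
  have "cmod (cinner z (x i)) \<le> \<delta>" if "i < k" for i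
  proof -
    have "cinner z (x i) = - cinner y (A (x i))"
      using y(2)[OF that] selfadjoint_cinner[OF A, of y "x i"] by (simp add: z_def B_def cinner_simps)
    also have "\<dots> = - cinner y (A (x i) - l i *\<^sub>R x i)"
      using y(2)[OF that] by (simp add: cinner_simps)
    finally have "cmod (cinner z (x i)) \<le> norm y * norm (A (x i) - l i *\<^sub>R x i)"
      using cmod_cinner_le[of y "A (x i) - l i *\<^sub>R x i"] by simp
    then show ?thesis
      using \<delta>[OF that] y(1) by simp
  qed
  then have "norm (\<Sum>i<k. cinner z (x i) *\<^sub>C x i) \<le> (\<Sum>i<k. \<delta>)"
    by (intro sum_norm_le) (auto simp: norm_scaleC orthonormal_norm[OF x])
  moreover have "z = (\<Sum>i<k. cinner z (x i) *\<^sub>C x i) + v"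
    by (simp add: v_def perp_part_def)
  ultimately show ?thesis
    using nv norm_triangle_ineq[of "\<Sum>i<k. cinner z (x i) *\<^sub>C x i" v]
    by (simp add: z_def B_def)
qed

text \<open>With \<open>\<psi>\<close> the \<open>x i\<close> form an almost diagonal system of
  \<open>k + 2\<close> vectors, all of whose diagonal values are at least the form value at
  \<open>\<psi>\<close> minus \<open>\<eta>\<close>; this pushes
  \<open>upper_scale A (Suc k)\<close> up. The loss is \<open>\<eta>\<close> from
  \<open>near\<close> and \<open>(k + 2) * \<eta>\<close> from the error matrix.\<close>

lemma approx_eigenvectors_perp_bound:
  fixes A :: "'a::complex_inner \<Rightarrow> 'a"
  assumes A: "selfadjoint A" and inf: "inf_dim TYPE('a)"
    and x: "orthonormal (Suc k) x"
    and \<eta>: "\<And>i. i < Suc k \<Longrightarrow> norm (A (x i) - upper_scale A i *\<^sub>R x i) \<le> \<eta>"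
    and \<psi>: "norm \<psi> = 1" "\<And>i. i < Suc k \<Longrightarrow> cinner \<psi> (x i) = 0"
    and near: "inner (A \<psi>) \<psi> \<le> upper_scale A k + \<eta>"
  shows "inner (A \<psi>) \<psi> \<le> upper_scale A (Suc k) + (real k + 3) * \<eta>"
proof -
  have Ab: "bounded_clinear A" by (rule selfadjoint_bounded[OF A])
  have "\<eta> \<ge> 0"
    using \<eta>[of 0] by (meson norm_ge_zero order_trans zero_less_Suc)
  define y where "y = x(Suc k := \<psi>)"
  have y: "orthonormal (Suc (Suc k)) y"
    unfolding y_def by (rule orthonormal_Suc[OF x \<psi>])
  define a where "a i = (if i = Suc k then inner (A \<psi>) \<psi> else upper_scale A i)" for i
  have small: "cmod (cinner (A (x i) - upper_scale A i *\<^sub>R x i) (y j)) \<le> \<eta>" if "i < Suc k" "j < Suc (Suc k)" for i j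
    using cmod_cinner_le[of "A (x i) - upper_scale A i *\<^sub>R x i" "y j"] \<eta>[OF that(1)]
      orthonormal_norm[OF y that(2)] by simp
  have "cmod (cinner (A (y i)) (y j) - (if i = j then complex_of_real (a i) else 0)) \<le> \<eta>"
    if ij: "i < Suc (Suc k)" "j < Suc (Suc k)" for i j
  proof (cases "i = Suc k")
    case False
    then have "i < Suc k" "y i = x i" "a i = upper_scale A i"
      using ij by (auto simp: y_def a_def)
    moreover have "cinner (A (y i)) (y j) - (if i = j then complex_of_real (a i) else 0)
        = cinner (A (y i)) (y j) - a i * cinner (y i) (y j)"
      using orthonormalD[OF y ij] by simp
    ultimately show ?thesis
      using small[of i j] ij by (simp add: cinner_simps)
  next
    case i: True
    show ?thesis
    proof (cases "j = Suc k")
      case True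
      then show ?thesis
        using i \<open>\<eta> \<ge> 0\<close> by (simp add: y_def a_def selfadjoint_form_real[OF A])
    next
      case False
      then have j: "j < Suc k" "y j = x j"
        using ij by (auto simp: y_def)
      have "cinner (A (y i)) (y j) = cinner \<psi> (A (x j) - upper_scale A j *\<^sub>R x j)"
        using \<psi>(2)[OF j(1)] selfadjoint_cinner[OF A] i j by (simp add: y_def cinner_simps)
      then have "cmod (cinner (A (y i)) (y j)) \<le> norm \<psi> * norm (A (x j) - upper_scale A j *\<^sub>R x j)"
        using cmod_cinner_le by simp
      then show ?thesis
        using i False \<psi>(1) \<eta>[OF j(1)] by simp
    qed
  qed
  moreover have "inner (A \<psi>) \<psi> - \<eta> \<le> a i" if "i < Suc (Suc k)" for i
    using near upper_scale_antimono[OF Ab inf, of i k] that \<open>\<eta> \<ge> 0\<close> by (auto simp: a_def less_Suc_eq)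
  ultimately have "inner (A \<psi>) \<psi> - \<eta> - real (Suc (Suc k)) * \<eta> \<le> upper_scale A (Suc k)"
    by (intro upper_scale_ge_orthonormal[OF Ab inf y] form_almost_diagonal[OF Ab, where a = a]) auto
  then show ?thesis
    by (simp add: algebra_simps)
qed

text \<open>The last conjunct drives the induction: it keeps the supremum of the form over the
  complement within the tolerance of \<open>upper_scale A k\<close>, so that a near-maximiser there
  can serve as the next vector.\<close>

lemma approx_eigenvectors:
  fixes A :: "'a::complex_inner \<Rightarrow> 'a"
  assumes A: "selfadjoint A" and inf: "inf_dim TYPE('a)" and "\<epsilon> > 0"
  shows "\<exists>x. orthonormal k x \<and> (\<forall>i<k. norm (A (x i) - upper_scale A i *\<^sub>R x i) \<le> \<epsilon>) \<and>
    (\<forall>\<psi>. norm \<psi> = 1 \<longrightarrow> (\<forall>i<k. cinner \<psi> (x i) = 0) \<longrightarrow> inner (A \<psi>) \<psi> \<le> upper_scale A k + \<epsilon>)"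
  using \<open>\<epsilon> > 0\<close>
proof (induction k arbitrary: \<epsilon>)
  case 0
  have Ab: "bounded_clinear A" by (rule selfadjoint_bounded[OF A])
  \<comment> \<open>The only subspace of dimension zero is \<open>{0}\<close>, so entry zero bounds
    the form on the whole unit sphere.\<close>
  have "inner (A \<psi>) \<psi> \<le> upper_scale A 0" if "norm \<psi> = 1" for \<psi>
  proof (rule upper_scale_ge[OF Ab inf])
    fix S :: "'a set" assume "S \<in> cfindim_subspaces 0"
    then have "S = {0}"
      by (auto simp: cfindim_subspaces_def)
    with that show "\<exists>\<psi>'\<in>unit_perp S. inner (A \<psi>) \<psi> \<le> inner (A \<psi>') \<psi>'"
      by (intro bexI[of _ \<psi>]) (auto simp: unit_perp_def)
  qed
  with 0 show ?case
    by (force simp: orthonormal_def)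
next
  case (Suc k)
  have Ab: "bounded_clinear A" by (rule selfadjoint_bounded[OF A])
  obtain M where M: "M > 0" "\<And>x. norm (A x) \<le> M * norm x"
    using bounded_clinear_bound[OF Ab] by metis
  \<comment> \<open>The divisor absorbs the factor \<open>k + 3\<close> lost in
    \<open>approx_eigenvectors_perp_bound\<close>.\<close>
  define \<eta> where "\<eta> = \<epsilon> / (real k + 3)"
  have \<eta>: "\<eta> > 0" "\<eta> \<le> \<epsilon>"
    using Suc.prems by (auto simp: \<eta>_def field_simps)
  \<comment> \<open>The two parts make \<open>k * \<delta> + sqrt (2 * M * \<delta>)\<close> from
    \<open>approx_eigenvector_step\<close>, plus one more \<open>\<delta>\<close> for exchanging
    \<open>\<mu>\<close> with \<open>upper_scale A k\<close>, at most \<open>\<eta>\<close>.\<close>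
  define \<delta> where "\<delta> = min (\<eta> / (2 * (real k + 1))) (\<eta>\<^sup>2 / (8 * M))"
  have \<delta>: "\<delta> > 0" "(real k + 1) * \<delta> \<le> \<eta> / 2" "2 * M * \<delta> \<le> (\<eta> / 2)\<^sup>2"
  proof -
    show "\<delta> > 0"
      using \<eta> M by (simp add: \<delta>_def)
    have "(real k + 1) * \<delta> \<le> (real k + 1) * (\<eta> / (2 * (real k + 1)))"
      by (intro mult_left_mono) (auto simp: \<delta>_def)
    also have "\<dots> = \<eta> / 2"
      by (simp add: divide_simps)
    finally show "(real k + 1) * \<delta> \<le> \<eta> / 2" .
    have "2 * M * \<delta> \<le> 2 * M * (\<eta>\<^sup>2 / (8 * M))"
      using M by (intro mult_left_mono) (auto simp: \<delta>_def)
    then show "2 * M * \<delta> \<le> (\<eta> / 2)\<^sup>2"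
      using M by (simp add: field_simps power2_eq_square)
  qed
  have "\<delta> \<le> (real k + 1) * \<delta>"
    using \<delta>(1) by (simp add: algebra_simps)
  then have "\<delta> \<le> \<eta>"
    using \<delta>(2) \<eta>(1) by linarith
  obtain x where x: "orthonormal k x" "\<And>i. i < k \<Longrightarrow> norm (A (x i) - upper_scale A i *\<^sub>R x i) \<le> \<delta>"
    "\<And>\<psi>. norm \<psi> = 1 \<Longrightarrow> (\<And>i. i < k \<Longrightarrow> cinner \<psi> (x i) = 0) \<Longrightarrow> inner (A \<psi>) \<psi> \<le> upper_scale A k + \<delta>"
    using Suc.IH[OF \<delta>(1)] by metis
  define P where "P = unit_perp (cspan (x ` {..<k}))"
  have P: "\<psi> \<in> P \<longleftrightarrow> norm \<psi> = 1 \<and> (\<forall>i<k. cinner \<psi> (x i) = 0)" for \<psi>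
    unfolding P_def by (rule unit_perp_orthonormal)
  \<comment> \<open>The exact supremum makes the form of \<open>\<mu> - A\<close> nonnegative on the
    complement, as the variational step requires; only afterwards is it replaced by the nearby
    \<open>upper_scale A k\<close>.\<close>
  define \<mu> where "\<mu> = (SUP \<psi>\<in>P. inner (A \<psi>) \<psi>)"
  have P_ne: "P \<noteq> {}"
    unfolding P_def by (rule inf_dim_unit_perp[OF inf]) simp
  have \<mu>_ge: "inner (A \<psi>) \<psi> \<le> \<mu>" if "\<psi> \<in> P" for \<psi>
    using that unfolding P_def \<mu>_def by (rule form_le_SUP[OF Ab])
  have "upper_scale A k \<le> \<mu>"
    by (rule upper_scale_le_orthonormal[OF Ab inf x(1)]) (use \<mu>_ge P in auto)
  have "\<mu> \<le> upper_scale A k + \<delta>"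
    unfolding \<mu>_def by (rule cSUP_least[OF P_ne]) (use x(3) P in auto)
  have "\<exists>y\<in>P. \<mu> - \<delta> < inner (A y) y"
  proof (rule ccontr)
    assume "\<not> ?thesis"
    then have "\<mu> \<le> \<mu> - \<delta>"
      by (subst (1) \<mu>_def) (rule cSUP_least[OF P_ne], force)
    with \<delta>(1) show False by simp
  qed
  then obtain y where y: "y \<in> P" "\<mu> - \<delta> < inner (A y) y"
    by blast
  have form_abs: "\<bar>inner (A \<psi>) \<psi>\<bar> \<le> M" if "\<psi> \<in> P" for \<psi>
    using abs_form_le[OF M(2), of \<psi>] that P by simp
  have "\<mu> \<le> M"
    unfolding \<mu>_def by (rule cSUP_least[OF P_ne]) (use form_abs in force)
  moreover have "- M \<le> \<mu>"
    using form_abs[OF y(1)] \<mu>_ge[OF y(1)] by linarith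
  ultimately have "\<bar>\<mu>\<bar> \<le> M" by linarith
  have \<mu>_form: "inner (A w) w \<le> \<mu> * (norm w)\<^sup>2" if "\<And>i. i < k \<Longrightarrow> cinner w (x i) = 0" for w
    by (rule form_le_of_unit[OF Ab], rule \<mu>_ge) (use that in \<open>auto simp: P cinner_simps\<close>)
  have "norm (\<mu> *\<^sub>R y - A y) \<le> real k * \<delta> + sqrt (2 * M * \<delta>)"
    by (rule approx_eigenvector_step[OF A M(2,1) x(1,2) _ _ \<mu>_form _ \<open>\<bar>\<mu>\<bar> \<le> M\<close>])
      (use y P in auto)
  moreover have "sqrt (2 * M * \<delta>) \<le> \<eta> / 2"
    using real_sqrt_le_mono[OF \<delta>(3)] \<eta>(1) by simp
  moreover have "norm ((\<mu> - upper_scale A k) *\<^sub>R y) \<le> \<delta>"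
    using \<open>upper_scale A k \<le> \<mu>\<close> \<open>\<mu> \<le> upper_scale A k + \<delta>\<close> y(1) P by simp
  moreover have "A y - upper_scale A k *\<^sub>R y = (\<mu> - upper_scale A k) *\<^sub>R y - (\<mu> *\<^sub>R y - A y)"
    by (simp add: algebra_simps)
  ultimately have y_eig: "norm (A y - upper_scale A k *\<^sub>R y) \<le> \<eta>"
    using \<delta>(2) norm_triangle_ineq4[of "(\<mu> - upper_scale A k) *\<^sub>R y" "\<mu> *\<^sub>R y - A y"]
    by (simp add: algebra_simps)
  define x' where "x' = x(k := y)"
  have x': "orthonormal (Suc k) x'"
    unfolding x'_def using y(1) P by (intro orthonormal_Suc[OF x(1)]) auto
  have eig: "norm (A (x' i) - upper_scale A i *\<^sub>R x' i) \<le> \<eta>" if "i < Suc k" for i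
    using that x(2)[of i] y_eig \<open>\<delta> \<le> \<eta>\<close> by (cases "i = k") (auto simp: x'_def)
  have "inner (A \<psi>) \<psi> \<le> upper_scale A (Suc k) + \<epsilon>"
    if \<psi>: "norm \<psi> = 1" "\<And>i. i < Suc k \<Longrightarrow> cinner \<psi> (x' i) = 0" for \<psi>
  proof -
    have "cinner \<psi> (x i) = 0" if "i < k" for i
      using \<psi>(2)[of i] that by (simp add: x'_def)
    then have "inner (A \<psi>) \<psi> \<le> upper_scale A k + \<eta>"
      using x(3)[OF \<psi>(1)] \<open>\<delta> \<le> \<eta>\<close> by fastforce
    moreover have "(real k + 3) * \<eta> = \<epsilon>"
      by (simp add: \<eta>_def)
    ultimately show ?thesis
      using approx_eigenvectors_perp_bound[OF A inf x' eig \<psi>] by simp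
  qed
  with x' eig \<eta>(2) show ?case
    by (intro exI[of _ x']) (meson order_trans)
qed

section \<open>Decomposition along the spectral scale\<close>

lemma cmod_cinner_orthonormal_le: "orthonormal k x \<Longrightarrow> i < k \<Longrightarrow> cmod (cinner z (x i)) \<le> norm z"
  using cmod_cinner_le[of z "x i"] by (simp add: orthonormal_norm)

lemma norm_perp_part_le: "orthonormal k x \<Longrightarrow> norm (perp_part k x z) \<le> norm z"
  by (rule power2_le_imp_le) (simp_all add: norm_perp_part sum_nonneg)

text \<open>For exact eigenvectors the cross terms between \<open>p\<close> and \<open>q\<close>
  vanish. Here they come from the defect \<open>e\<close> of \<open>A p\<close> alone, which has
  norm at most \<open>m * \<delta> * norm \<psi>\<close> and is paired once with \<open>p\<close>
  and twice with \<open>q\<close>; hence the factor 3.\<close>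

lemma form_split_approx_eigenvectors:
  assumes A: "selfadjoint A" and x: "orthonormal m x"
    and eig: "\<And>i. i < m \<Longrightarrow> norm (A (x i) - l i *\<^sub>R x i) \<le> \<delta>"
  shows "\<bar>inner (A \<psi>) \<psi> - ((\<Sum>i<m. l i * (cmod (cinner \<psi> (x i)))\<^sup>2)
    + inner (A (perp_part m x \<psi>)) (perp_part m x \<psi>))\<bar> \<le> 3 * real m * \<delta> * (norm \<psi>)\<^sup>2"
proof -
  have Ab: "bounded_clinear A" by (rule selfadjoint_bounded[OF A])
  define q where "q = perp_part m x \<psi>"
  define c where "c i = cinner \<psi> (x i)" for i
  define p where "p = (\<Sum>i<m. c i *\<^sub>C x i)"
  define d where "d = (\<Sum>i<m. (complex_of_real (l i) * c i) *\<^sub>C x i)"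
  define e where "e = A p - d"
  have \<psi>: "\<psi> = p + q"
    by (simp add: p_def q_def c_def perp_part_def)
  have nq: "norm q \<le> norm \<psi>"
    unfolding q_def by (rule norm_perp_part_le[OF x])
  have "(norm p)\<^sup>2 \<le> (norm \<psi>)\<^sup>2"
    unfolding p_def norm_sum_orthonormal[OF x] unfolding c_def by (rule bessel_orthonormal[OF x])
  then have np: "norm p \<le> norm \<psi>"
    by (rule power2_le_imp_le) simp
  have e_sum: "e = (\<Sum>i<m. c i *\<^sub>C (A (x i) - l i *\<^sub>R x i))"
    unfolding e_def p_def d_def bounded_clinear_sum_eq[OF Ab] sum_subtractf[symmetric]
    by (rule sum.cong)
      (simp_all add: Ab bounded_clinear_simps scaleC_diff_right scaleC_scaleC mult.commute flip: scaleC_of_real)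
  have "norm e \<le> (\<Sum>i<m. norm \<psi> * \<delta>)"
    unfolding e_sum
  proof (rule sum_norm_le)
    fix i assume "i \<in> {..<m}"
    then show "norm (c i *\<^sub>C (A (x i) - l i *\<^sub>R x i)) \<le> norm \<psi> * \<delta>"
      using cmod_cinner_orthonormal_le[OF x, of i \<psi>] eig[of i]
      unfolding norm_scaleC c_def by (intro mult_mono) auto
  qed
  then have ne: "norm e \<le> real m * \<delta> * norm \<psi>"
    by (simp add: mult_ac)
  have dq: "inner d q = 0"
  proof -
    have "cinner d q = 0"
      unfolding d_def cinner_sum_left
    proof (intro sum.neutral ballI)
      fix i assume "i \<in> {..<m}"
      then have "cinner (x i) q = 0"
        using perp_part_orthogonal[OF x, of i \<psi>] cinner_commute[of "x i" q] by (simp add: q_def)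
      then show "cinner ((complex_of_real (l i) * c i) *\<^sub>C x i) q = 0"
        by (simp add: cinner_scaleC_left)
    qed
    then show ?thesis by (simp add: inner_eq_Re_cinner)
  qed
  have dp: "inner d p = (\<Sum>i<m. l i * (cmod (c i))\<^sup>2)"
  proof -
    have "cinner d p = (\<Sum>j<m. cnj (c j) * (complex_of_real (l j) * c j))"
      unfolding p_def cinner_sum_right d_def
      using cinner_sum_orthonormal[OF x, of _ "\<lambda>i. complex_of_real (l i) * c i"]
      by (intro sum.cong) (auto simp: cinner_scaleC_right)
    also have "\<dots> = complex_of_real (\<Sum>i<m. l i * (cmod (c i))\<^sup>2)"
      unfolding of_real_sum of_real_mult complex_norm_square by (simp only: mult_ac)
    finally show ?thesis
      by (simp only: inner_eq_Re_cinner Re_complex_of_real)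
  qed
  have "inner (A \<psi>) \<psi> = inner (A p) p + 2 * inner (A p) q + inner (A q) q"
    using selfadjoint_inner[OF A, of q p]
    by (simp add: \<psi> bounded_clinear_add_eq[OF Ab] inner_add_left inner_add_right inner_commute)
  also have "A p = d + e"
    by (simp add: e_def)
  finally have "inner (A \<psi>) \<psi> - ((\<Sum>i<m. l i * (cmod (c i))\<^sup>2) + inner (A q) q) = inner e p + 2 * inner e q"
    by (simp add: inner_add_left dq dp)
  moreover have "\<bar>inner e v\<bar> \<le> real m * \<delta> * (norm \<psi>)\<^sup>2" if "norm v \<le> norm \<psi>" for v
  proof -
    have "\<bar>inner e v\<bar> \<le> norm e * norm v"
      by (rule Cauchy_Schwarz_ineq2)
    also have "\<dots> \<le> (real m * \<delta> * norm \<psi>) * norm \<psi>"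
      using ne that by (intro mult_mono) (auto intro: order_trans[OF norm_ge_zero])
    finally show ?thesis by (simp add: power2_eq_square mult_ac)
  qed
  from this[OF np] this[OF nq]
  have "\<bar>inner e p + 2 * inner e q\<bar> \<le> 3 * real m * \<delta> * (norm \<psi>)\<^sup>2"
    by (simp add: abs_le_iff)
  ultimately show ?thesis
    unfolding c_def q_def by simp
qed

text \<open>Charging the level \<open>l n\<close> to the whole vector leaves the weights
  \<open>l i - l n\<close> on the \<open>x i\<close>. In the error, \<open>3 * real (Suc n)\<close>
  comes from the splitting and \<open>1\<close> from \<open>perp\<close>.\<close>

lemma form_le_perp_bound:
  assumes A: "selfadjoint A" and x: "orthonormal (Suc n) x"
    and eig: "\<And>i. i < Suc n \<Longrightarrow> norm (A (x i) - l i *\<^sub>R x i) \<le> \<delta>"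
    and perp: "\<And>\<psi>. norm \<psi> = 1 \<Longrightarrow> (\<And>i. i < Suc n \<Longrightarrow> cinner \<psi> (x i) = 0) \<Longrightarrow> inner (A \<psi>) \<psi> \<le> l n + \<delta>"
  shows "inner (A \<psi>) \<psi> \<le> (\<Sum>i<Suc n. (l i - l n) * (cmod (cinner \<psi> (x i)))\<^sup>2)
    + (l n + (3 * real (Suc n) + 1) * \<delta>) * (norm \<psi>)\<^sup>2"
proof -
  have Ab: "bounded_clinear A" by (rule selfadjoint_bounded[OF A])
  define q where "q = perp_part (Suc n) x \<psi>"
  define s where "s = (\<Sum>i<Suc n. (cmod (cinner \<psi> (x i)))\<^sup>2)"
  have "\<delta> \<ge> 0"
    using eig[of 0] by (meson norm_ge_zero order_trans zero_less_Suc)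
  have "inner (A q) q \<le> (l n + \<delta>) * (norm q)\<^sup>2"
  proof (rule form_le_of_unit[OF Ab], rule perp)
    show "cinner ((1 / norm q) *\<^sub>R q) (x i) = 0" if "i < Suc n" for i
      using perp_part_orthogonal[OF x that] by (simp add: q_def cinner_scaleR_left)
  qed auto
  moreover have "\<delta> * (norm q)\<^sup>2 \<le> \<delta> * (norm \<psi>)\<^sup>2"
    using norm_perp_part_le[OF x, of \<psi>] \<open>\<delta> \<ge> 0\<close> by (intro mult_left_mono power_mono) (auto simp: q_def)
  moreover have "(norm q)\<^sup>2 = (norm \<psi>)\<^sup>2 - s"
    unfolding q_def s_def by (rule norm_perp_part[OF x])
  ultimately have "inner (A q) q \<le> l n * ((norm \<psi>)\<^sup>2 - s) + \<delta> * (norm \<psi>)\<^sup>2"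
    by (simp add: algebra_simps)
  moreover have "(\<Sum>i<Suc n. (l i - l n) * (cmod (cinner \<psi> (x i)))\<^sup>2)
      = (\<Sum>i<Suc n. l i * (cmod (cinner \<psi> (x i)))\<^sup>2) - l n * s"
    by (simp only: s_def left_diff_distrib sum_subtractf sum_distrib_left)
  ultimately show ?thesis
    using form_split_approx_eigenvectors[OF A x eig, of \<psi>]
    unfolding q_def[symmetric] by (simp add: algebra_simps abs_le_iff del: sum.lessThan_Suc)
qed

text \<open>
  Approximate eigenvectors for different approximate eigenvalues are nearly orthogonal, and the
  weights \<open>l i - l n\<close> are dominated by the eigenvalue gaps. Hence the corrections at the two ends of the
  spectrum do not interfere.
\<close>

lemma form_le_two_sided:
  assumes A: "selfadjoint A" and x: "orthonormal (Suc n) x" and y: "orthonormal (Suc m) y"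
    and eigx: "\<And>i. i < Suc n \<Longrightarrow> norm (A (x i) - l i *\<^sub>R x i) \<le> \<delta>"
    and perp: "\<And>\<psi>. norm \<psi> = 1 \<Longrightarrow> (\<And>i. i < Suc n \<Longrightarrow> cinner \<psi> (x i) = 0) \<Longrightarrow> inner (A \<psi>) \<psi> \<le> l n + \<delta>"
    and eigy: "\<And>j. j < Suc m \<Longrightarrow> norm (A (y j) - r j *\<^sub>R y j) \<le> \<delta>"
    and l: "\<And>i. i \<le> n \<Longrightarrow> l n \<le> l i" and r: "\<And>j. j \<le> m \<Longrightarrow> r j \<le> r m" and "r m \<le> l n"
  shows "inner (A \<psi>) \<psi> - (\<Sum>i<Suc n. (l i - l n) * (cmod (cinner \<psi> (x i)))\<^sup>2)
      + (\<Sum>j<Suc m. (r m - r j) * (cmod (cinner \<psi> (y j)))\<^sup>2)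
    \<le> (l n + (3 * real (Suc n) + 1 + 3 * real (Suc m) + 4 * real (Suc n) * real (Suc m)) * \<delta>) * (norm \<psi>)\<^sup>2"
proof -
  have "\<delta> \<ge> 0"
    using eigx[of 0] by (meson norm_ge_zero order_trans zero_less_Suc)
  define q where "q = perp_part (Suc m) y \<psi>"
  define d where "d j = cinner \<psi> (y j)" for j
  define s where "s = (\<Sum>j<Suc m. (cmod (d j))\<^sup>2)"
  have nq: "norm q \<le> norm \<psi>"
    unfolding q_def by (rule norm_perp_part_le[OF y])
  have q2: "(norm q)\<^sup>2 = (norm \<psi>)\<^sup>2 - s"
    unfolding q_def s_def d_def by (rule norm_perp_part[OF y])
  have cross: "(l i - l n) * cmod (cinner (y j) (x i)) \<le> 2 * \<delta>" if "i < Suc n" "j < Suc m" for i j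
  proof -
    have "(l i - r j) * cinner (y j) (x i)
        = cinner (A (y j) - r j *\<^sub>R y j) (x i) - cinner (y j) (A (x i) - l i *\<^sub>R x i)"
      using selfadjoint_cinner[OF A, of "y j" "x i"] by (simp add: cinner_simps algebra_simps)
    then have "cmod ((l i - r j) * cinner (y j) (x i))
        \<le> cmod (cinner (A (y j) - r j *\<^sub>R y j) (x i)) + cmod (cinner (y j) (A (x i) - l i *\<^sub>R x i))"
      by (metis norm_triangle_ineq4)
    also have "\<dots> \<le> \<delta> + \<delta>"
      using cmod_cinner_le[of "A (y j) - r j *\<^sub>R y j" "x i"] cmod_cinner_le[of "y j" "A (x i) - l i *\<^sub>R x i"]
        orthonormal_norm[OF x that(1)] orthonormal_norm[OF y that(2)] eigx[OF that(1)] eigy[OF that(2)]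
      by (intro add_mono) auto
    finally have "\<bar>l i - r j\<bar> * cmod (cinner (y j) (x i)) \<le> 2 * \<delta>"
      by (simp add: norm_mult flip: of_real_diff)
    moreover have "(l i - l n) * cmod (cinner (y j) (x i)) \<le> \<bar>l i - r j\<bar> * cmod (cinner (y j) (x i))"
      using l[of i] r[of j] that \<open>r m \<le> l n\<close> by (intro mult_right_mono) auto
    ultimately show ?thesis by linarith
  qed
  \<comment> \<open>The part of \<open>\<psi>\<close> along the \<open>y j\<close> is almost
    invisible to the weighted \<open>x i\<close>, so coefficients of \<open>q\<close> may be traded
    for those of \<open>\<psi>\<close>. Summed over \<open>i\<close>, the price is the term with
    \<open>4 * real (Suc n) * real (Suc m)\<close>.\<close>
  have swap: "(l i - l n) * (cmod (cinner q (x i)))\<^sup>2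
      \<le> (l i - l n) * (cmod (cinner \<psi> (x i)))\<^sup>2 + 4 * real (Suc m) * \<delta> * (norm \<psi>)\<^sup>2"
    if "i < Suc n" for i
  proof -
    define u where "u = cinner q (x i)"
    define v where "v = cinner \<psi> (x i)"
    have "l i - l n \<ge> 0"
      using l that by auto
    have uv: "u - v = - (\<Sum>j<Suc m. d j * cinner (y j) (x i))"
      by (simp add: u_def v_def q_def perp_part_def d_def cinner_simps cinner_sum_left del: sum.lessThan_Suc)
    have "(l i - l n) * cmod (u - v) \<le> (l i - l n) * (\<Sum>j<Suc m. cmod (d j * cinner (y j) (x i)))"
      unfolding uv norm_minus_cancel using \<open>l i - l n \<ge> 0\<close> by (intro mult_left_mono norm_sum)
    also have "\<dots> = (\<Sum>j<Suc m. cmod (d j) * ((l i - l n) * cmod (cinner (y j) (x i))))"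
      by (simp only: sum_distrib_left norm_mult mult_ac)
    also have "\<dots> \<le> (\<Sum>j<Suc m. norm \<psi> * (2 * \<delta>))"
    proof (intro sum_mono)
      fix j assume "j \<in> {..<Suc m}"
      then show "cmod (d j) * ((l i - l n) * cmod (cinner (y j) (x i))) \<le> norm \<psi> * (2 * \<delta>)"
        using cross[OF that, of j] cmod_cinner_orthonormal_le[OF y, of j \<psi>] \<open>l i - l n \<ge> 0\<close>
        unfolding d_def by (intro mult_mono[of _ _ "(l i - l n) * _"]) auto
    qed
    finally have 1: "(l i - l n) * cmod (u - v) \<le> real (Suc m) * (norm \<psi> * (2 * \<delta>))"
      by simp
    have 2: "cmod u + cmod v \<le> 2 * norm \<psi>"
      using cmod_cinner_orthonormal_le[OF x that, of q] cmod_cinner_orthonormal_le[OF x that, of \<psi>] nq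
      by (simp add: u_def v_def)
    have "(l i - l n) * ((cmod u)\<^sup>2 - (cmod v)\<^sup>2) = ((l i - l n) * (cmod u - cmod v)) * (cmod u + cmod v)"
      by (simp add: power2_eq_square algebra_simps)
    also have "\<dots> \<le> ((l i - l n) * cmod (u - v)) * (cmod u + cmod v)"
      using \<open>l i - l n \<ge> 0\<close> norm_triangle_ineq2[of u v] by (intro mult_right_mono mult_left_mono) auto
    also have "\<dots> \<le> (real (Suc m) * (norm \<psi> * (2 * \<delta>))) * (2 * norm \<psi>)"
      using 1 2 \<open>\<delta> \<ge> 0\<close> by (intro mult_mono[OF 1 2]) auto
    also have "\<dots> = 4 * real (Suc m) * \<delta> * (norm \<psi>)\<^sup>2"
      by (simp add: power2_eq_square)
    finally show ?thesis
      by (simp add: u_def v_def right_diff_distrib)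
  qed
  have "(\<Sum>i<Suc n. (l i - l n) * (cmod (cinner q (x i)))\<^sup>2)
      \<le> (\<Sum>i<Suc n. (l i - l n) * (cmod (cinner \<psi> (x i)))\<^sup>2 + 4 * real (Suc m) * \<delta> * (norm \<psi>)\<^sup>2)"
    using swap by (intro sum_mono) auto
  also have "\<dots> = (\<Sum>i<Suc n. (l i - l n) * (cmod (cinner \<psi> (x i)))\<^sup>2)
      + 4 * real (Suc n) * real (Suc m) * \<delta> * (norm \<psi>)\<^sup>2"
    unfolding sum.distrib by (simp add: algebra_simps del: sum.lessThan_Suc)
  finally have S: "(\<Sum>i<Suc n. (l i - l n) * (cmod (cinner q (x i)))\<^sup>2)
      \<le> (\<Sum>i<Suc n. (l i - l n) * (cmod (cinner \<psi> (x i)))\<^sup>2)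
      + 4 * real (Suc n) * real (Suc m) * \<delta> * (norm \<psi>)\<^sup>2" .
  have "(3 * real (Suc n) + 1) * \<delta> * (norm q)\<^sup>2 \<le> (3 * real (Suc n) + 1) * \<delta> * (norm \<psi>)\<^sup>2"
    using nq \<open>\<delta> \<ge> 0\<close> by (intro mult_left_mono power_mono) auto
  moreover have "inner (A q) q \<le> (\<Sum>i<Suc n. (l i - l n) * (cmod (cinner q (x i)))\<^sup>2)
      + (l n + (3 * real (Suc n) + 1) * \<delta>) * (norm q)\<^sup>2"
    by (rule form_le_perp_bound[OF A x eigx perp])
  ultimately have Q: "inner (A q) q \<le> (\<Sum>i<Suc n. (l i - l n) * (cmod (cinner q (x i)))\<^sup>2)
      + l n * (norm q)\<^sup>2 + (3 * real (Suc n) + 1) * \<delta> * (norm \<psi>)\<^sup>2"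
    by (simp add: distrib_right)
  have "s \<ge> 0"
    by (simp add: s_def sum_nonneg)
  \<comment> \<open>Passing from \<open>\<psi>\<close> to \<open>q\<close> frees
    \<open>l n * s\<close>, which pays for the \<open>r m * s\<close> contributed by the weights at
    the lower end.\<close>
  then have "r m * s \<le> l n * s"
    using \<open>r m \<le> l n\<close> by (rule mult_right_mono[rotated])
  moreover have "l n * (norm q)\<^sup>2 = l n * (norm \<psi>)\<^sup>2 - l n * s"
    by (simp add: q2 right_diff_distrib)
  moreover have "(\<Sum>j<Suc m. (r m - r j) * (cmod (d j))\<^sup>2)
      = r m * s - (\<Sum>j<Suc m. r j * (cmod (d j))\<^sup>2)"
    by (simp only: s_def left_diff_distrib sum_subtractf sum_distrib_left)
  moreover have "inner (A \<psi>) \<psi> \<le> (\<Sum>j<Suc m. r j * (cmod (d j))\<^sup>2) + inner (A q) q + 3 * real (Suc m) * \<delta> * (norm \<psi>)\<^sup>2"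
    using form_split_approx_eigenvectors[OF A y eigy, of \<psi>]
    unfolding q_def[symmetric] d_def[symmetric] by linarith
  moreover have "(l n + (3 * real (Suc n) + 1 + 3 * real (Suc m) + 4 * real (Suc n) * real (Suc m)) * \<delta>) * (norm \<psi>)\<^sup>2
    = l n * (norm \<psi>)\<^sup>2 + (3 * real (Suc n) + 1) * \<delta> * (norm \<psi>)\<^sup>2 + 3 * real (Suc m) * \<delta> * (norm \<psi>)\<^sup>2
      + 4 * real (Suc n) * real (Suc m) * \<delta> * (norm \<psi>)\<^sup>2"
    by (simp only: distrib_right distrib_left add.assoc)
  ultimately show ?thesis
    using S Q unfolding d_def by linarith
qed

text \<open>The form of \<open>A\<close> with its upper levels cut down to
  \<open>upper_scale A n\<close> and its lower levels raised to \<open>lower_scale A m\<close>. The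
  weights at \<open>i = n\<close> and \<open>j = m\<close> vanish, so \<open>m = 0\<close> leaves
  the lower end untouched, and \<open>n = 0\<close> the upper end.\<close>

definition scale_remainder :: "('a::complex_inner \<Rightarrow> 'a) \<Rightarrow> nat \<Rightarrow> nat \<Rightarrow> (nat \<Rightarrow> 'a) \<Rightarrow> (nat \<Rightarrow> 'a) \<Rightarrow> 'a \<Rightarrow> real" where
  "scale_remainder A n m x y \<psi> = inner (A \<psi>) \<psi>
    - (\<Sum>i<Suc n. (upper_scale A i - upper_scale A n) * (cmod (cinner \<psi> (x i)))\<^sup>2)
    + (\<Sum>j<Suc m. (lower_scale A m - lower_scale A j) * (cmod (cinner \<psi> (y j)))\<^sup>2)"

lemma scale_decomposition:
  fixes A :: "'a::complex_inner \<Rightarrow> 'a"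
  assumes A: "selfadjoint A" and inf: "inf_dim TYPE('a)" and "\<epsilon> > 0"
  obtains x y where "orthonormal (Suc n) x" "orthonormal (Suc m) y"
    "\<And>\<psi>. scale_remainder A n m x y \<psi> \<le> (upper_scale A n + \<epsilon>) * (norm \<psi>)\<^sup>2"
    "\<And>\<psi>. (lower_scale A m - \<epsilon>) * (norm \<psi>)\<^sup>2 \<le> scale_remainder A n m x y \<psi>"
proof -
  have Ab: "bounded_clinear A" by (rule selfadjoint_bounded[OF A])
  define K where "K = 3 * real (Suc n) + 1 + 3 * real (Suc m) + 4 * real (Suc n) * real (Suc m)"
  \<comment> \<open>\<open>K\<close> is symmetric in \<open>n\<close> and \<open>m\<close>, so one
    \<open>\<delta>\<close> serves for \<open>A\<close> and, with the two ends exchanged, for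
    \<open>- A\<close>.\<close>
  have K': "K = 3 * real (Suc m) + 1 + 3 * real (Suc n) + 4 * real (Suc m) * real (Suc n)"
    by (simp add: K_def algebra_simps)
  have "K > 0"
    unfolding K_def by (intro add_pos_nonneg) auto
  define \<delta> where "\<delta> = \<epsilon> / K"
  have "\<delta> > 0" "K * \<delta> = \<epsilon>"
    using \<open>K > 0\<close> \<open>\<epsilon> > 0\<close> by (auto simp: \<delta>_def)
  obtain x where x: "orthonormal (Suc n) x"
    "\<And>i. i < Suc n \<Longrightarrow> norm (A (x i) - upper_scale A i *\<^sub>R x i) \<le> \<delta>"
    "\<And>\<psi>. norm \<psi> = 1 \<Longrightarrow> (\<And>i. i < Suc n \<Longrightarrow> cinner \<psi> (x i) = 0) \<Longrightarrow> inner (A \<psi>) \<psi> \<le> upper_scale A (Suc n) + \<delta>"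
    using approx_eigenvectors[OF A inf \<open>\<delta> > 0\<close>, of "Suc n"] by metis
  obtain y where y: "orthonormal (Suc m) y"
    "\<And>j. j < Suc m \<Longrightarrow> norm (- A (y j) - (- lower_scale A j) *\<^sub>R y j) \<le> \<delta>"
    "\<And>\<psi>. norm \<psi> = 1 \<Longrightarrow> (\<And>i. i < Suc m \<Longrightarrow> cinner \<psi> (y i) = 0) \<Longrightarrow> inner (- A \<psi>) \<psi> \<le> - lower_scale A (Suc m) + \<delta>"
    using approx_eigenvectors[OF selfadjoint_uminus[OF A] inf \<open>\<delta> > 0\<close>, of "Suc m"]
    unfolding upper_scale_uminus by metis
  have y2: "norm (A (y j) - lower_scale A j *\<^sub>R y j) \<le> \<delta>" if "j < Suc m" for j
    using y(2)[OF that] norm_minus_commute[of "A (y j)" "lower_scale A j *\<^sub>R y j"] by simp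
  have x2: "norm (- A (x i) - (- upper_scale A i) *\<^sub>R x i) \<le> \<delta>" if "i < Suc n" for i
    using x(2)[OF that] norm_minus_commute[of "A (x i)" "upper_scale A i *\<^sub>R x i"] by simp
  \<comment> \<open>The bound at index \<open>Suc n\<close> is relaxed to index \<open>n\<close>,
    the level at which the remainder is cut.\<close>
  have xperp: "inner (A \<psi>) \<psi> \<le> upper_scale A n + \<delta>"
    if "norm \<psi> = 1" "\<And>i. i < Suc n \<Longrightarrow> cinner \<psi> (x i) = 0" for \<psi>
    using x(3)[OF that] upper_scale_Suc_le[OF Ab inf, of n] by linarith
  have yperp: "inner (- A \<psi>) \<psi> \<le> - lower_scale A m + \<delta>"
    if "norm \<psi> = 1" "\<And>i. i < Suc m \<Longrightarrow> cinner \<psi> (y i) = 0" for \<psi>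
    using y(3)[OF that] lower_scale_mono[OF Ab inf, of m "Suc m"] by simp
  note up = upper_scale_antimono[OF Ab inf] and lo = lower_scale_mono[OF Ab inf]
    and lu = lower_scale_le_upper_scale[OF Ab inf, of m n]
  show ?thesis
  proof (rule that[OF x(1) y(1)])
    fix \<psi>
    show "scale_remainder A n m x y \<psi> \<le> (upper_scale A n + \<epsilon>) * (norm \<psi>)\<^sup>2"
      using form_le_two_sided[OF A x(1) y(1) x(2) xperp y2 up lo lu, of \<psi>]
      unfolding K_def[symmetric] \<open>K * \<delta> = \<epsilon>\<close> scale_remainder_def .
    have "inner (- A \<psi>) \<psi> - (\<Sum>j<Suc m. (- lower_scale A j - - lower_scale A m) * (cmod (cinner \<psi> (y j)))\<^sup>2)
      + (\<Sum>i<Suc n. (- upper_scale A n - - upper_scale A i) * (cmod (cinner \<psi> (x i)))\<^sup>2)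
      \<le> (- lower_scale A m + K * \<delta>) * (norm \<psi>)\<^sup>2"
      unfolding K'
    proof (rule form_le_two_sided[OF selfadjoint_uminus[OF A] y(1) x(1) y(2) yperp x2])
      show "- lower_scale A m \<le> - lower_scale A i" if "i \<le> m" for i
        using lo[OF that] by simp
      show "- upper_scale A j \<le> - upper_scale A n" if "j \<le> n" for j
        using up[OF that] by simp
      show "- upper_scale A n \<le> - lower_scale A m"
        using lu by simp
    qed
    then show "(lower_scale A m - \<epsilon>) * (norm \<psi>)\<^sup>2 \<le> scale_remainder A n m x y \<psi>"
      unfolding \<open>K * \<delta> = \<epsilon>\<close> scale_remainder_def by (simp add: algebra_simps del: sum.lessThan_Suc)
  qed
qed

section \<open>Ky Fan inequalities\<close>

text \<open>Bessel families with bound 1: the property of images of orthonormal families under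
  contractions that the Ky Fan estimate uses.\<close>

definition bessel :: "nat \<Rightarrow> (nat \<Rightarrow> 'a::complex_inner) \<Rightarrow> bool" where
  "bessel k u \<longleftrightarrow> (\<forall>z. (\<Sum>j<k. (cmod (cinner z (u j)))\<^sup>2) \<le> (norm z)\<^sup>2)"

text \<open>The hypothesis says that the synthesis map from coefficients to vectors is a
  contraction; its adjoint, the analysis map, is then one too. Synthesising the coefficients of
  \<open>z\<close> itself shows this without forming adjoints.\<close>

lemma besselI:
  assumes "\<And>c. (norm (\<Sum>j<k. c j *\<^sub>C u j))\<^sup>2 \<le> (\<Sum>j<k. (cmod (c j))\<^sup>2)"
  shows "bessel k u"
  unfolding bessel_def
proof
  fix z
  define c where "c j = cinner z (u j)" for j
  define s where "s = (\<Sum>j<k. (cmod (c j))\<^sup>2)"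
  define w where "w = (\<Sum>j<k. c j *\<^sub>C u j)"
  have "s \<ge> 0"
    by (simp add: s_def sum_nonneg)
  have "cinner z w = complex_of_real s"
    unfolding w_def s_def cinner_sum_right of_real_sum complex_norm_square
    by (simp add: cinner_scaleC_right c_def mult.commute)
  then have "s \<le> norm z * norm w"
    using cmod_cinner_le[of z w] \<open>s \<ge> 0\<close> by simp
  also have "\<dots> \<le> norm z * sqrt s"
    using real_le_rsqrt[OF assms[of c]] by (intro mult_left_mono) (auto simp: w_def s_def)
  finally have "s \<le> norm z * sqrt s" .
  then have "sqrt s * sqrt s \<le> norm z * sqrt s"
    using \<open>s \<ge> 0\<close> by simp
  then have "sqrt s \<le> norm z"
    by (cases "s = 0") (use \<open>s \<ge> 0\<close> in \<open>auto simp del: real_sqrt_mult_self\<close>)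
  then have "s \<le> (norm z)\<^sup>2"
    by (rule sqrt_le_D)
  then show "(\<Sum>j<k. (cmod (cinner z (u j)))\<^sup>2) \<le> (norm z)\<^sup>2"
    by (simp add: s_def c_def)
qed

lemma bessel_norm_le:
  assumes "bessel k u" "i < k"
  shows "norm (u i) \<le> 1"
proof -
  have "(cmod (cinner (u i) (u i)))\<^sup>2 \<le> (\<Sum>j<k. (cmod (cinner (u i) (u j)))\<^sup>2)"
    using assms(2) by (intro member_le_sum) auto
  also have "\<dots> \<le> (norm (u i))\<^sup>2"
    using assms(1) by (simp add: bessel_def)
  finally have "(norm (u i))\<^sup>2 * (norm (u i))\<^sup>2 \<le> (norm (u i))\<^sup>2"
    by (simp add: cinner_self norm_mult power2_eq_square)
  then have "(norm (u i))\<^sup>2 \<le> 1"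
    by (cases "u i = 0") (use mult_left_le_imp_le[of "(norm (u i))\<^sup>2" "(norm (u i))\<^sup>2" 1] in auto)
  then show ?thesis
    by (simp add: power_le_one_iff)
qed

text \<open>After flattening, each \<open>x i\<close> carries a nonnegative weight and meets the
  \<open>u j\<close> with total mass at most one. The last term keeps the actual norms of the
  \<open>u j\<close>, because the level \<open>upper_scale A n\<close> may be negative.\<close>

lemma ky_fan_upper:
  fixes A :: "'a::complex_inner \<Rightarrow> 'a"
  assumes A: "selfadjoint A" and inf: "inf_dim TYPE('a)" and u: "bessel (Suc n) u"
  shows "(\<Sum>j<Suc n. inner (A (u j)) (u j))
    \<le> (\<Sum>i<Suc n. upper_scale A i - upper_scale A n) + upper_scale A n * (\<Sum>j<Suc n. (norm (u j))\<^sup>2)"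
proof (rule field_le_epsilon)
  fix \<epsilon> :: real assume "\<epsilon> > 0"
  have Ab: "bounded_clinear A" by (rule selfadjoint_bounded[OF A])
  define \<delta> where "\<delta> = \<epsilon> / real (Suc n)"
  have "\<delta> > 0"
    using \<open>\<epsilon> > 0\<close> by (simp add: \<delta>_def)
  define \<alpha> where "\<alpha> i = upper_scale A i - upper_scale A n" for i
  have \<alpha>: "\<alpha> i \<ge> 0" if "i < Suc n" for i
    using upper_scale_antimono[OF Ab inf, of i n] that by (simp add: \<alpha>_def)
  \<comment> \<open>With \<open>m = 0\<close> the sum at the lower end is a single term of weight
    zero.\<close>
  obtain x y where x: "orthonormal (Suc n) x" "orthonormal (Suc 0) y" and
    form: "\<And>\<psi>. scale_remainder A n 0 x y \<psi> \<le> (upper_scale A n + \<delta>) * (norm \<psi>)\<^sup>2"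
    using scale_decomposition[OF A inf \<open>\<delta> > 0\<close>, of n 0] by metis
  have form': "inner (A \<psi>) \<psi> \<le> (\<Sum>i<Suc n. \<alpha> i * (cmod (cinner \<psi> (x i)))\<^sup>2) + (upper_scale A n + \<delta>) * (norm \<psi>)\<^sup>2" for \<psi>
    using form[of \<psi>] by (simp add: scale_remainder_def \<alpha>_def del: sum.lessThan_Suc)
  have "(\<Sum>j<Suc n. inner (A (u j)) (u j))
      \<le> (\<Sum>j<Suc n. (\<Sum>i<Suc n. \<alpha> i * (cmod (cinner (u j) (x i)))\<^sup>2) + (upper_scale A n + \<delta>) * (norm (u j))\<^sup>2)"
    by (intro sum_mono form')
  also have "\<dots> = (\<Sum>i<Suc n. \<alpha> i * (\<Sum>j<Suc n. (cmod (cinner (x i) (u j)))\<^sup>2))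
      + upper_scale A n * (\<Sum>j<Suc n. (norm (u j))\<^sup>2) + (\<Sum>j<Suc n. \<delta> * (norm (u j))\<^sup>2)"
  proof -
    have "cmod (cinner (u j) (x i)) = cmod (cinner (x i) (u j))" for i j
      by (subst cinner_commute) (simp only: complex_mod_cnj)
    then show ?thesis
      by (simp only: sum.distrib distrib_right sum_distrib_left add.assoc)
        (subst sum.swap, rule refl)
  qed
  also have "(\<Sum>i<Suc n. \<alpha> i * (\<Sum>j<Suc n. (cmod (cinner (x i) (u j)))\<^sup>2)) \<le> (\<Sum>i<Suc n. \<alpha> i)"
  proof (rule sum_mono)
    fix i assume "i \<in> {..<Suc n}"
    then have i: "i < Suc n" by simp
    have "(\<Sum>j<Suc n. (cmod (cinner (x i) (u j)))\<^sup>2) \<le> 1"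
      using u orthonormal_norm[OF x(1) i] unfolding bessel_def by (metis one_power2)
    then have "\<alpha> i * (\<Sum>j<Suc n. (cmod (cinner (x i) (u j)))\<^sup>2) \<le> \<alpha> i * 1"
      using \<alpha>[OF i] by (intro mult_left_mono)
    then show "\<alpha> i * (\<Sum>j<Suc n. (cmod (cinner (x i) (u j)))\<^sup>2) \<le> \<alpha> i"
      by simp
  qed
  also have "(\<Sum>j<Suc n. \<delta> * (norm (u j))\<^sup>2) \<le> (\<Sum>j<Suc n. \<delta>)"
    using bessel_norm_le[OF u] \<open>\<delta> > 0\<close> by (intro sum_mono) (auto simp: power_le_one mult_left_le)
  also have "(\<Sum>j<Suc n. \<delta>) = \<epsilon>"
    by (simp add: \<delta>_def)
  finally show "(\<Sum>j<Suc n. inner (A (u j)) (u j))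
    \<le> (\<Sum>i<Suc n. upper_scale A i - upper_scale A n) + upper_scale A n * (\<Sum>j<Suc n. (norm (u j))\<^sup>2) + \<epsilon>"
    by (simp add: \<alpha>_def)
qed

section \<open>Contractions and the spread\<close>

definition contraction :: "('a::complex_inner \<Rightarrow> 'b::complex_inner) \<Rightarrow> bool" where
  "contraction W \<longleftrightarrow> bounded_clinear W \<and> (\<forall>x. norm (W x) \<le> norm x)"

lemma contraction_bounded: "contraction W \<Longrightarrow> bounded_clinear W"
  by (simp add: contraction_def)

lemma contraction_norm_le: "contraction W \<Longrightarrow> norm (W x) \<le> norm x"
  by (simp add: contraction_def)

lemma bessel_contraction:
  assumes W: "contraction W" and x: "orthonormal k x"
  shows "bessel k (\<lambda>j. W (x j))"
proof (rule besselI)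
  fix c
  have "(\<Sum>j<k. c j *\<^sub>C W (x j)) = W (\<Sum>j<k. c j *\<^sub>C x j)"
    using contraction_bounded[OF W] by (simp add: bounded_clinear_sum_eq bounded_clinear_simps)
  then have "(norm (\<Sum>j<k. c j *\<^sub>C W (x j)))\<^sup>2 \<le> (norm (\<Sum>j<k. c j *\<^sub>C x j))\<^sup>2"
    using contraction_norm_le[OF W] by (simp add: power_mono)
  then show "(norm (\<Sum>j<k. c j *\<^sub>C W (x j)))\<^sup>2 \<le> (\<Sum>j<k. (cmod (c j))\<^sup>2)"
    by (simp add: norm_sum_orthonormal[OF x])
qed

text \<open>The upper bound is applied to \<open>A\<close> along \<open>W\<close> and to
  \<open>- A\<close> along \<open>V\<close>, which leaves \<open>a * p - b * q\<close> with the
  total masses \<open>p\<close> and \<open>q\<close>. The spread ignores scalars added to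
  \<open>A\<close>, and so does the left side when the masses agree. In the other alternative the
  signs \<open>b \<le> 0 \<le> a\<close> allow the two terms to be bounded separately.\<close>

lemma ky_fan_spread:
  fixes A :: "'a::complex_inner \<Rightarrow> 'a" and x :: "nat \<Rightarrow> 'b::complex_inner"
  assumes A: "selfadjoint A" and inf: "inf_dim TYPE('a)" and x: "orthonormal k x"
    and W: "contraction W" and V: "contraction V"
    and balanced: "(\<forall>x. norm (W x) = norm (V x)) \<or> (\<forall>n. lower_scale A n \<le> 0 \<and> 0 \<le> upper_scale A n)"
  shows "(\<Sum>j<k. inner (A (W (x j))) (W (x j)) - inner (A (V (x j))) (V (x j)))
    \<le> (\<Sum>j<k. spectral_spread A j)"
proof (cases k)
  case (Suc n)
  have Ab: "bounded_clinear A" by (rule selfadjoint_bounded[OF A])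
  define p where "p = (\<Sum>j<Suc n. (norm (W (x j)))\<^sup>2)"
  define q where "q = (\<Sum>j<Suc n. (norm (V (x j)))\<^sup>2)"
  define a where "a = upper_scale A n"
  define b where "b = lower_scale A n"
  have x: "orthonormal (Suc n) x"
    using x Suc by simp
  have "p \<le> (\<Sum>j<Suc n. 1)" "q \<le> (\<Sum>j<Suc n. 1)"
    unfolding p_def q_def
    using contraction_norm_le[OF W, of "x _"] contraction_norm_le[OF V, of "x _"] orthonormal_norm[OF x]
    by (intro sum_mono power_le_one; auto; metis)+
  then have pq: "p \<le> real (Suc n)" "q \<le> real (Suc n)"
    by simp_all
  have "(\<Sum>j<Suc n. inner (A (W (x j))) (W (x j))) \<le> (\<Sum>i<Suc n. upper_scale A i - a) + a * p"
    unfolding a_def p_def by (rule ky_fan_upper[OF A inf bessel_contraction[OF W x]])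
  moreover have "(\<Sum>j<Suc n. inner (- A (V (x j))) (V (x j))) \<le> (\<Sum>i<Suc n. - lower_scale A i - - b) + - b * q"
    unfolding b_def q_def upper_scale_uminus[symmetric]
    by (rule ky_fan_upper[OF selfadjoint_uminus[OF A] inf bessel_contraction[OF V x]])
  moreover have "a * p - b * q \<le> real (Suc n) * (a - b)"
    using balanced
  proof
    assume "\<forall>x. norm (W x) = norm (V x)"
    then have "p = q"
      by (simp add: p_def q_def)
    moreover have "p * (a - b) \<le> real (Suc n) * (a - b)"
      using pq lower_scale_le_upper_scale[OF Ab inf, of n n]
      by (intro mult_right_mono) (auto simp: a_def b_def)
    ultimately show ?thesis
      by (simp add: algebra_simps)
  next
    assume "\<forall>n. lower_scale A n \<le> 0 \<and> 0 \<le> upper_scale A n"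
    then have "b \<le> 0" "0 \<le> a"
      by (auto simp: a_def b_def)
    then have "a * p \<le> a * real (Suc n)" "- b * q \<le> - b * real (Suc n)"
      using mult_left_mono[OF pq(1), of a] mult_left_mono[OF pq(2), of "- b"] by linarith+
    then show ?thesis
      by (simp add: algebra_simps)
  qed
  ultimately show ?thesis
    unfolding Suc spectral_spread_eq sum_subtractf
    by (simp add: sum_subtractf sum_negf algebra_simps del: sum.lessThan_Suc)
qed simp

section \<open>Adjoints\<close>

text \<open>The representing vector minimises \<open>\<phi>\<close>. Completeness enters through a
  minimising sequence, which the parallelogram law in \<open>gap\<close> makes Cauchy.\<close>

lemma riesz_representation_real:
  fixes f :: "'a::{real_inner, complete_space} \<Rightarrow> real"
  assumes "bounded_linear f"
  obtains z where "\<And>y. f y = inner z y"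
proof -
  interpret f: bounded_linear f by fact
  obtain K where K: "\<And>x. norm (f x) \<le> norm x * K"
    using f.bounded by blast
  define \<phi> where "\<phi> x = (norm x)\<^sup>2 - 2 * f x" for x
  have "- K\<^sup>2 \<le> \<phi> x" for x
  proof -
    have "f x \<le> norm x * K"
      using K[of x] by simp
    moreover have "0 \<le> (norm x - K)\<^sup>2"
      by simp
    ultimately show ?thesis
      unfolding \<phi>_def power2_diff by linarith
  qed
  then have bdd: "bdd_below (range \<phi>)"
    by (intro bdd_belowI[of _ "- K\<^sup>2"]) auto
  define m where "m = (INF x. \<phi> x)"
  have m: "m \<le> \<phi> x" for x
    unfolding m_def by (rule cINF_lower[OF bdd]) simp
  have "\<exists>x. \<phi> x < m + 1 / real (Suc n)" for n
    using cINF_less_iff[OF _ bdd, of "m + 1 / real (Suc n)"] by (simp add: m_def)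
  then obtain x where x: "\<And>n. \<phi> (x n) < m + 1 / real (Suc n)"
    by metis
  have gap: "(norm (a - b))\<^sup>2 \<le> 2 * (\<phi> a - m) + 2 * (\<phi> b - m)" for a b
  proof -
    have "\<phi> ((1/2) *\<^sub>R (a + b)) = (norm (a + b))\<^sup>2 / 4 - f a - f b"
      by (simp add: \<phi>_def f.scaleR f.add power_divide add_divide_distrib)
    moreover have "(norm (a - b))\<^sup>2 + (norm (a + b))\<^sup>2 = 2 * (norm a)\<^sup>2 + 2 * (norm b)\<^sup>2"
      by (simp add: power2_norm_eq_inner inner_diff_left inner_diff_right inner_add_left inner_add_right)
    ultimately show ?thesis
      using m[of "(1/2) *\<^sub>R (a + b)"] by (simp add: \<phi>_def)
  qed
  have "Cauchy x"
  proof (rule CauchyI)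
    fix e :: real assume "0 < e"
    then obtain N where N: "inverse (real (Suc N)) < e\<^sup>2 / 4"
      using reals_Archimedean[of "e\<^sup>2 / 4"] by auto
    have close: "\<phi> (x n) - m < e\<^sup>2 / 4" if "n \<ge> N" for n
    proof -
      have "1 / real (Suc n) \<le> inverse (real (Suc N))"
        using that by (simp add: inverse_eq_divide frac_le)
      then show ?thesis
        using x[of n] N by linarith
    qed
    have "(norm (x a - x b))\<^sup>2 < e\<^sup>2" if "a \<ge> N" "b \<ge> N" for a b
      using le_less_trans[OF gap[of "x a" "x b"], of "e\<^sup>2"] close[OF that(1)] close[OF that(2)]
      by (simp add: field_simps)
    then have "norm (x a - x b) < e" if "a \<ge> N" "b \<ge> N" for a b
      using that \<open>0 < e\<close> by (meson less_imp_le power_less_imp_less_base)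
    then show "\<exists>M. \<forall>m\<ge>M. \<forall>n\<ge>M. norm (x m - x n) < e"
      by blast
  qed
  then obtain z where z: "x \<longlonglongrightarrow> z"
    by (auto simp: Cauchy_convergent_iff convergent_def)
  have "(\<lambda>n. \<phi> (x n)) \<longlonglongrightarrow> \<phi> z"
    unfolding \<phi>_def by (intro tendsto_intros z f.tendsto)
  moreover have "(\<lambda>n. m + 1 / real (Suc n)) \<longlonglongrightarrow> m + 0"
    by (intro tendsto_add tendsto_const) (use LIMSEQ_inverse_real_of_nat in \<open>simp add: inverse_eq_divide\<close>)
  ultimately have "\<phi> z \<le> m + 0"
    by (rule LIMSEQ_le) (use x less_imp_le in blast)
  then have min: "\<phi> z \<le> \<phi> y" for y
    using m[of y] by linarith
  have "f y = inner z y" for y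
  proof -
    define a where "a = inner z y - f y"
    \<comment> \<open>The minimiser of
      \<open>2 * t * a + t\<^sup>2 * ((norm y)\<^sup>2 + 1)\<close>; the added \<open>1\<close>
      keeps the denominator positive at \<open>y = 0\<close>.\<close>
    define t where "t = - a / ((norm y)\<^sup>2 + 1)"
    have pos: "(norm y)\<^sup>2 + 1 > 0"
      by (simp add: add_nonneg_pos)
    have "(norm (z + t *\<^sub>R y))\<^sup>2 = (norm z)\<^sup>2 + 2 * t * inner z y + t\<^sup>2 * (norm y)\<^sup>2"
      unfolding power2_norm_eq_inner
      by (simp add: inner_add_left inner_add_right inner_commute power2_eq_square)
    then have "0 \<le> 2 * t * a + t\<^sup>2 * (norm y)\<^sup>2"
      using min[of "z + t *\<^sub>R y"] by (simp add: \<phi>_def a_def f.add f.scaleR algebra_simps)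
    also have "t\<^sup>2 * (norm y)\<^sup>2 \<le> t\<^sup>2 * ((norm y)\<^sup>2 + 1)"
      by (intro mult_left_mono) auto
    also have "2 * t * a + t\<^sup>2 * ((norm y)\<^sup>2 + 1) = - (a\<^sup>2 / ((norm y)\<^sup>2 + 1))"
      using pos by (simp add: t_def power2_eq_square divide_simps)
    finally have "a\<^sup>2 \<le> 0"
      using pos by (simp add: divide_le_0_iff)
    then show ?thesis
      by (simp add: a_def)
  qed
  then show ?thesis
    by (rule that)
qed

lemma cinner_eqI:
  assumes "\<And>x. cinner x y = cinner x z"
  shows "y = z"
proof -
  have "cinner (y - z) (y - z) = 0"
    by (simp only: cinner_diff_right assms diff_self)
  then show ?thesis
    by (simp add: cinner_self)
qed

lemma cadjoint_cinner:
  fixes A :: "'a::chilbert_space \<Rightarrow> 'b::complex_inner"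
  assumes A: "bounded_clinear A"
  shows "cinner (A x) y = cinner x (cadjoint A y)"
proof -
  have "\<exists>z. \<forall>x. cinner (A x) y = cinner x z" for y
  proof -
    have "bounded_linear (\<lambda>x. inner (A x) y)"
      using A unfolding bounded_clinear_def
      by (intro bounded_linear_compose[OF bounded_linear_inner_left]) auto
    then obtain z where z: "\<And>x. inner (A x) y = inner z x"
      using riesz_representation_real by blast
    have "cinner (A x) y = cinner x z" for x
    proof (rule complex_eqI)
      show "Re (cinner (A x) y) = Re (cinner x z)"
        using z[of x] by (simp add: inner_eq_Re_cinner[symmetric] inner_commute)
      \<comment> \<open>The real Riesz theorem controls real parts only; an imaginary part is the
        real part at \<open>- \<i> *\<^sub>C x\<close>.\<close>
      have "Re (cinner (A (- \<i> *\<^sub>C x)) y) = Re (cinner (- \<i> *\<^sub>C x) z)"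
        using z[of "- \<i> *\<^sub>C x"] by (simp only: inner_eq_Re_cinner[symmetric] inner_commute)
      then show "Im (cinner (A x) y) = Im (cinner x z)"
        unfolding bounded_clinear_scaleC_eq[OF A] cinner_scaleC_left by simp
    qed
    then show ?thesis by blast
  qed
  then obtain B where B: "\<And>x y. cinner (A x) y = cinner x (B y)"
    by metis
  have "cadjoint A = B"
    unfolding cadjoint_def
  proof (rule the_equality)
    fix C assume "\<forall>x y. cinner (A x) y = cinner x (C y)"
    then show "C = B"
      by (intro ext cinner_eqI) (metis B)
  qed (use B in simp)
  with B show ?thesis by simp
qed

lemma cadjoint_cinner_right:
  fixes A :: "'a::chilbert_space \<Rightarrow> 'b::complex_inner"
  assumes A: "bounded_clinear A"
  shows "cinner y (A x) = cinner (cadjoint A y) x"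
  using cadjoint_cinner[OF A, of x y] cinner_commute[of y "A x"] cinner_commute[of "cadjoint A y" x]
  by simp

lemma cadjoint_inner:
  fixes A :: "'a::chilbert_space \<Rightarrow> 'b::complex_inner"
  shows "bounded_clinear A \<Longrightarrow> inner (A x) y = inner x (cadjoint A y)"
  by (simp add: inner_eq_Re_cinner cadjoint_cinner)

lemma norm_cadjoint_le:
  fixes A :: "'a::chilbert_space \<Rightarrow> 'b::complex_inner"
  assumes A: "bounded_clinear A" and M: "\<And>x. norm (A x) \<le> M * norm x" "M \<ge> 0"
  shows "norm (cadjoint A y) \<le> M * norm y"
proof (cases "cadjoint A y = 0")
  case True
  then show ?thesis
    using M(2) by simp
next
  case False
  have "(norm (cadjoint A y))\<^sup>2 = inner (A (cadjoint A y)) y"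
    using cadjoint_inner[OF A, of "cadjoint A y" y] by (simp add: power2_norm_eq_inner)
  also have "\<dots> \<le> norm (A (cadjoint A y)) * norm y"
    by (rule norm_cauchy_schwarz)
  also have "\<dots> \<le> M * norm (cadjoint A y) * norm y"
    using M(1) by (intro mult_right_mono) auto
  finally have "norm (cadjoint A y) * norm (cadjoint A y) \<le> norm (cadjoint A y) * (M * norm y)"
    by (simp add: power2_eq_square mult_ac)
  with False show ?thesis
    by (simp add: mult_le_cancel_left_pos)
qed

lemma bounded_clinear_cadjoint:
  fixes A :: "'a::chilbert_space \<Rightarrow> 'b::complex_inner"
  assumes A: "bounded_clinear A"
  shows "bounded_clinear (cadjoint A)"
proof -
  obtain M where M: "M > 0" "\<And>x. norm (A x) \<le> M * norm x"
    using bounded_clinear_bound[OF A] by metis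
  show ?thesis
  proof (rule bounded_clinearI)
    show "norm (cadjoint A y) \<le> M * norm y" for y
      using norm_cadjoint_le[OF A M(2)] M(1) by simp
    show "cadjoint A (x + y) = cadjoint A x + cadjoint A y" for x y
      by (rule cinner_eqI) (simp add: cinner_simps cadjoint_cinner[OF A, symmetric])
    show "cadjoint A (c *\<^sub>C x) = c *\<^sub>C cadjoint A x" for c x
      by (rule cinner_eqI) (simp add: cinner_simps cadjoint_cinner[OF A, symmetric])
  qed
qed

lemma contraction_cadjoint:
  fixes A :: "'a::chilbert_space \<Rightarrow> 'b::complex_inner"
  assumes "contraction A"
  shows "contraction (cadjoint A)"
  using assms norm_cadjoint_le[of A 1] bounded_clinear_cadjoint[of A]
  by (simp add: contraction_def)

text \<open>The numerical radius of a self-adjoint operator bounds its norm, by polarisation and the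
  parallelogram law.\<close>

lemma norm_le_of_form_bound:
  assumes A: "selfadjoint A" and M: "\<And>x. \<bar>inner (A x) x\<bar> \<le> M * (norm x)\<^sup>2"
  shows "norm (A x) \<le> M * norm x"
proof (cases "x = 0")
  case True
  then show ?thesis
    using A by (simp add: bclin_intro bounded_clinear_zero_eq)
next
  case False
  have Ab: "bounded_clinear A" by (rule selfadjoint_bounded[OF A])
  show ?thesis
  proof (cases "A x = 0")
    case True
    have "0 \<le> M * (norm x)\<^sup>2"
      using M[of x] by (meson abs_ge_zero order_trans)
    with False True show ?thesis
      by (simp add: zero_le_mult_iff)
  next
    case A0: False
    \<comment> \<open>With the direction of \<open>A x\<close> and the length of \<open>x\<close>,
      the pairing equals \<open>norm x * norm (A x)\<close> and the parallelogram sum becomes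
      \<open>4 * M * (norm x)\<^sup>2\<close>.\<close>
    define y where "y = (norm x / norm (A x)) *\<^sub>R A x"
    have ny: "norm y = norm x"
      using A0 by (simp add: y_def)
    have Axy: "inner (A x) y = norm x * norm (A x)"
      using A0 by (simp add: y_def power2_norm_eq_inner[symmetric] power2_eq_square)
    have "4 * inner (A x) y = inner (A (x + y)) (x + y) - inner (A (x - y)) (x - y)"
      using selfadjoint_inner[OF A, of y x]
      by (simp add: bounded_clinear_simps Ab inner_add_left inner_add_right inner_diff_left
        inner_diff_right inner_commute)
    also have "\<dots> \<le> M * (norm (x + y))\<^sup>2 + M * (norm (x - y))\<^sup>2"
      using M[of "x + y"] M[of "x - y"] by (simp add: abs_le_iff)
    also have "\<dots> = 2 * M * ((norm x)\<^sup>2 + (norm y)\<^sup>2)"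
      by (simp add: power2_norm_eq_inner inner_diff_left inner_diff_right inner_add_left
        inner_add_right algebra_simps)
    finally have "norm x * norm (A x) \<le> norm x * (M * norm x)"
      by (simp add: Axy ny power2_eq_square mult_ac)
    with False show ?thesis
      by (simp add: mult_le_cancel_left_pos)
  qed
qed

section \<open>Square roots\<close>

lemma bounded_linear_cinner_left: "bounded_linear (\<lambda>x. cinner x y)"
  by (rule bounded_linear_intro[of _ "norm y"])
    (auto simp: cinner_simps scaleR_conv_of_real cmod_cinner_le)

lemma tendsto_cinner_left: "(f \<longlongrightarrow> l) F \<Longrightarrow> ((\<lambda>n. cinner (f n) y) \<longlongrightarrow> cinner l y) F"
  by (rule bounded_linear.tendsto[OF bounded_linear_cinner_left])

lemma tendsto_cinner_right:
  assumes "(f \<longlongrightarrow> l) F"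
  shows "((\<lambda>n. cinner y (f n)) \<longlongrightarrow> cinner y l) F"
  using tendsto_cnj[OF tendsto_cinner_left[OF assms, of y]] cinner_commute[of y] by simp

lemma tendsto_bounded_clinear:
  "bounded_clinear A \<Longrightarrow> (f \<longlongrightarrow> l) F \<Longrightarrow> ((\<lambda>n. A (f n)) \<longlongrightarrow> A l) F"
  unfolding bounded_clinear_def using bounded_linear.tendsto by blast

lemma bounded_clinear_const_scaleC: "bounded_clinear (\<lambda>x. c *\<^sub>C x)"
  by (rule bounded_clinearI[of _ "cmod c"])
    (auto simp: scaleC_add_right scaleC_scaleC mult.commute norm_scaleC)

text \<open>
  If \<open>A = 1 - B\<close> is positive with \<open>A \<le> 1\<close>, then \<open>1 - Y\<close> is a square root of \<open>A\<close> exactly when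
  \<open>Y = (B + Y\<^sup>2) / 2\<close>. The iterates of this equation are compared with those of the scalar
  equation \<open>t = (1 + t\<^sup>2) / 2\<close>.
\<close>

primrec sqrt_iter :: "('a::complex_inner \<Rightarrow> 'a) \<Rightarrow> nat \<Rightarrow> 'a \<Rightarrow> 'a" where
  "sqrt_iter B 0 = (\<lambda>x. 0)"
| "sqrt_iter B (Suc n) = (\<lambda>x. (1/2) *\<^sub>R (B x + sqrt_iter B n (sqrt_iter B n x)))"

primrec sqrt_iter_bound :: "nat \<Rightarrow> real" where
  "sqrt_iter_bound 0 = 0"
| "sqrt_iter_bound (Suc n) = (1 + (sqrt_iter_bound n)\<^sup>2) / 2"

lemma sqrt_iter_bound_range: "0 \<le> sqrt_iter_bound n" "sqrt_iter_bound n \<le> 1"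
  by (induction n) (auto simp: power_le_one)

lemma sqrt_iter_bound_Suc_ge: "sqrt_iter_bound n \<le> sqrt_iter_bound (Suc n)"
proof -
  have "0 \<le> (sqrt_iter_bound n - 1)\<^sup>2"
    by simp
  then show ?thesis
    by (simp add: power2_diff)
qed

lemma bounded_clinear_sqrt_iter: "bounded_clinear B \<Longrightarrow> bounded_clinear (sqrt_iter B n)"
  by (induction n)
    (simp_all add: bounded_clinear_zero bounded_clinear_scaleR bounded_clinear_add bounded_clinear_compose)

lemma sqrt_iter_commute:
  assumes C: "bounded_clinear C" and "\<And>x. C (B x) = B (C x)"
  shows "C (sqrt_iter B n x) = sqrt_iter B n (C x)"
  by (induction n arbitrary: x) (simp_all add: assms bounded_clinear_simps)

lemma selfadjoint_sqrt_iter: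
  assumes B: "selfadjoint B"
  shows "cinner (sqrt_iter B n x) y = cinner x (sqrt_iter B n y)"
  by (induction n arbitrary: x y) (simp_all add: cinner_simps selfadjoint_cinner[OF B])

lemma norm_sqrt_iter_le:
  assumes B: "contraction B"
  shows "norm (sqrt_iter B n x) \<le> sqrt_iter_bound n * norm x"
proof (induction n arbitrary: x)
  case (Suc n)
  have "norm (sqrt_iter B n (sqrt_iter B n x)) \<le> sqrt_iter_bound n * norm (sqrt_iter B n x)"
    by (rule Suc)
  also have "\<dots> \<le> sqrt_iter_bound n * (sqrt_iter_bound n * norm x)"
    using Suc sqrt_iter_bound_range by (intro mult_left_mono) auto
  finally have "norm (B x + sqrt_iter B n (sqrt_iter B n x)) \<le> norm x + (sqrt_iter_bound n)\<^sup>2 * norm x"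
    using contraction_norm_le[OF B, of x]
    by (intro norm_triangle_le) (simp add: power2_eq_square mult.assoc)
  also have "\<dots> = 2 * (sqrt_iter_bound (Suc n) * norm x)"
    by (simp add: algebra_simps)
  finally show ?case
    by simp
qed simp

text \<open>Writing the difference of squares as \<open>Z (Z - Y) + (Z - Y) Y\<close> mirrors
  \<open>t\<^sup>2 - s\<^sup>2\<close>, so each increment is dominated by that of the scalar
  iteration. The scalar sequence is increasing and bounded, which makes the iterates Cauchy.\<close>

lemma norm_sqrt_iter_diff_Suc_le:
  assumes B: "contraction B"
  shows "norm (sqrt_iter B (Suc n) x - sqrt_iter B n x) \<le> (sqrt_iter_bound (Suc n) - sqrt_iter_bound n) * norm x"
proof (induction n arbitrary: x)
  case 0
  then show ?case
    using contraction_norm_le[OF B, of x] by simp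
next
  case (Suc n)
  define Y where "Y = sqrt_iter B n"
  define Z where "Z = sqrt_iter B (Suc n)"
  define s where "s = sqrt_iter_bound n"
  define t where "t = sqrt_iter_bound (Suc n)"
  have Zb: "bounded_clinear Z"
    unfolding Z_def by (rule bounded_clinear_sqrt_iter[OF contraction_bounded[OF B]])
  have IH: "norm (Z x - Y x) \<le> (t - s) * norm x" for x
    unfolding Z_def Y_def s_def t_def by (rule Suc)
  have "s \<ge> 0" "t \<ge> 0" "s \<le> t"
    unfolding s_def t_def by (rule sqrt_iter_bound_range sqrt_iter_bound_Suc_ge)+
  have "norm (Z (Z x - Y x)) \<le> t * norm (Z x - Y x)"
    unfolding Z_def t_def by (rule norm_sqrt_iter_le[OF B])
  also have "\<dots> \<le> t * ((t - s) * norm x)"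
    using \<open>t \<ge> 0\<close> IH by (intro mult_left_mono)
  finally have 1: "norm (Z (Z x - Y x)) \<le> t * ((t - s) * norm x)" .
  have "norm (Z (Y x) - Y (Y x)) \<le> (t - s) * norm (Y x)"
    by (rule IH)
  also have "\<dots> \<le> (t - s) * (s * norm x)"
    unfolding Y_def using norm_sqrt_iter_le[OF B, of n x] \<open>s \<le> t\<close> by (intro mult_left_mono) (auto simp: s_def)
  finally have 2: "norm (Z (Y x) - Y (Y x)) \<le> (t - s) * (s * norm x)" .
  have "sqrt_iter B (Suc (Suc n)) x - Z x = (1/2) *\<^sub>R (Z (Z x) - Y (Y x))"
    by (simp add: Z_def Y_def algebra_simps)
  also have "Z (Z x) - Y (Y x) = Z (Z x - Y x) + (Z (Y x) - Y (Y x))"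
    using Zb by (simp add: bounded_clinear_simps)
  finally have "norm (sqrt_iter B (Suc (Suc n)) x - Z x) = (1/2) * norm (Z (Z x - Y x) + (Z (Y x) - Y (Y x)))"
    by simp
  also have "\<dots> \<le> (1/2) * (t * ((t - s) * norm x) + (t - s) * (s * norm x))"
    using 1 2 by (intro mult_left_mono norm_triangle_mono) auto
  also have "\<dots> = ((1 + t\<^sup>2) / 2 - (1 + s\<^sup>2) / 2) * norm x"
    by (simp add: power2_eq_square algebra_simps)
  finally show ?case
    by (simp add: Z_def s_def t_def)
qed

lemma norm_sqrt_iter_diff_le:
  assumes B: "contraction B" and "n \<le> m"
  shows "norm (sqrt_iter B m x - sqrt_iter B n x) \<le> (sqrt_iter_bound m - sqrt_iter_bound n) * norm x"
  using assms(2)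
proof (induction m rule: dec_induct)
  case (step m)
  then show ?case
    using norm_sqrt_iter_diff_Suc_le[OF B, of m x]
      norm_triangle_ineq[of "sqrt_iter B (Suc m) x - sqrt_iter B m x" "sqrt_iter B m x - sqrt_iter B n x"]
    by (simp add: algebra_simps del: sqrt_iter.simps sqrt_iter_bound.simps)
qed simp

lemma sqrt_iter_converges:
  fixes B :: "'a::chilbert_space \<Rightarrow> 'a"
  assumes B: "contraction B"
  shows "convergent (\<lambda>n. sqrt_iter B n x)"
proof -
  have inc: "incseq sqrt_iter_bound"
    by (rule incseq_SucI) (rule sqrt_iter_bound_Suc_ge)
  have "convergent sqrt_iter_bound"
    using incseq_convergent[OF inc, of 1] sqrt_iter_bound_range by (metis convergentI)
  then have C: "Cauchy (\<lambda>n. sqrt_iter_bound n * norm x)"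
    by (intro convergent_Cauchy) (rule convergent_mult[OF _ convergent_const])
  have d: "dist (sqrt_iter B m x) (sqrt_iter B n x) \<le> dist (sqrt_iter_bound m * norm x) (sqrt_iter_bound n * norm x)" for m n
  proof (induction m n rule: linorder_wlog)
    case (le a b)
    have "norm (sqrt_iter B b x - sqrt_iter B a x) \<le> sqrt_iter_bound b * norm x - sqrt_iter_bound a * norm x"
      using norm_sqrt_iter_diff_le[OF B le, of x] by (simp add: left_diff_distrib)
    then show ?case
      unfolding dist_real_def by (subst dist_commute) (simp add: dist_norm)
  next
    case (sym a b)
    then show ?case by (simp add: dist_commute)
  qed
  have "Cauchy (\<lambda>n. sqrt_iter B n x)"
    unfolding Cauchy_def
  proof (intro allI impI)
    fix e :: real assume "0 < e"
    then obtain M where "\<forall>m\<ge>M. \<forall>n\<ge>M. dist (sqrt_iter_bound m * norm x) (sqrt_iter_bound n * norm x) < e"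
      using C unfolding Cauchy_def by blast
    then show "\<exists>M. \<forall>m\<ge>M. \<forall>n\<ge>M. dist (sqrt_iter B m x) (sqrt_iter B n x) < e"
      using d by (meson le_less_trans)
  qed
  then show ?thesis
    by (simp add: Cauchy_convergent_iff)
qed

lemma positive_op_selfadjoint: "positive_op A \<Longrightarrow> selfadjoint A"
  by (simp add: positive_op_def)

lemma positive_op_form: "positive_op A \<Longrightarrow> 0 \<le> inner (A x) x"
  by (simp add: positive_op_def inner_eq_Re_cinner)

text \<open>The clause on \<open>C\<close> prepares uniqueness: any other root \<open>S\<close>
  commutes with \<open>A = S \<circ> S\<close>, hence with \<open>R\<close>.\<close>

lemma positive_sqrt_exists:
  fixes A :: "'a::chilbert_space \<Rightarrow> 'a"
  assumes A: "positive_op A"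
  obtains R where "positive_op R" "\<And>x. R (R x) = A x"
    "\<And>C x. bounded_clinear C \<Longrightarrow> (\<And>x. C (A x) = A (C x)) \<Longrightarrow> C (R x) = R (C x)"
proof -
  have As: "selfadjoint A" and Ab: "bounded_clinear A"
    using A by (auto simp: positive_op_def bclin_intro)
  obtain M where M: "M > 0" "\<And>x. norm (A x) \<le> M * norm x"
    using bounded_clinear_bound[OF Ab] by metis
  \<comment> \<open>Dividing by a norm bound places the form of \<open>A / M\<close> between zero
    and the square of the norm, so \<open>B\<close> is a contraction. The factor
    \<open>sqrt M\<close> in \<open>R\<close> undoes the scaling.\<close>
  define B where "B x = x - (1 / M) *\<^sub>R A x" for x
  have Bb: "bounded_clinear B"
    unfolding B_def by (intro bclin_intro Ab)
  have Bs: "selfadjoint B"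
    using Bb by (simp add: selfadjoint_def B_def cinner_simps selfadjoint_cinner[OF As])
  have "norm (B x) \<le> 1 * norm x" for x
  proof (rule norm_le_of_form_bound[OF Bs])
    fix x
    have "inner (B x) x = (norm x)\<^sup>2 - inner (A x) x / M"
      by (simp add: B_def inner_diff_left power2_norm_eq_inner)
    moreover have "0 \<le> inner (A x) x / M"
      using positive_op_form[OF A, of x] M(1) by simp
    moreover have "inner (A x) x / M \<le> (norm x)\<^sup>2"
      using abs_form_le[of A M, OF M(2), of x] M(1) by (simp add: divide_le_eq mult.commute)
    ultimately show "\<bar>inner (B x) x\<bar> \<le> 1 * (norm x)\<^sup>2"
      by (simp add: abs_le_iff)
  qed
  then have B: "contraction B"
    using Bb by (simp add: contraction_def)
  define Y where "Y x = lim (\<lambda>n. sqrt_iter B n x)" for x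
  have lim: "(\<lambda>n. sqrt_iter B n x) \<longlonglongrightarrow> Y x" for x
    using sqrt_iter_converges[OF B] unfolding Y_def by (simp add: convergent_LIMSEQ_iff)
  note it = bounded_clinear_sqrt_iter[OF Bb]
  have Y_norm: "norm (Y x) \<le> norm x" for x
  proof (rule LIMSEQ_le_const2)
    show "(\<lambda>n. norm (sqrt_iter B n x)) \<longlonglongrightarrow> norm (Y x)"
      by (intro tendsto_norm lim)
    show "\<exists>N. \<forall>n\<ge>N. norm (sqrt_iter B n x) \<le> norm x"
      using order_trans[OF norm_sqrt_iter_le[OF B] mult_left_le_one_le[OF norm_ge_zero sqrt_iter_bound_range]]
      by blast
  qed
  have Yb: "bounded_clinear Y"
  proof (rule bounded_clinearI[of _ 1])
    show "Y (x + y) = Y x + Y y" for x y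
    proof (rule LIMSEQ_unique[OF lim])
      show "(\<lambda>n. sqrt_iter B n (x + y)) \<longlonglongrightarrow> Y x + Y y"
        unfolding bounded_clinear_add_eq[OF it] by (intro tendsto_add lim)
    qed
    show "Y (c *\<^sub>C x) = c *\<^sub>C Y x" for c x
    proof (rule LIMSEQ_unique[OF lim])
      show "(\<lambda>n. sqrt_iter B n (c *\<^sub>C x)) \<longlonglongrightarrow> c *\<^sub>C Y x"
        unfolding bounded_clinear_scaleC_eq[OF it]
        by (intro tendsto_bounded_clinear[OF bounded_clinear_const_scaleC] lim)
    qed
  qed (use Y_norm in simp)
  have Ysa: "cinner (Y x) y = cinner x (Y y)" for x y
  proof (rule LIMSEQ_unique)
    show "(\<lambda>n. cinner (sqrt_iter B n x) y) \<longlonglongrightarrow> cinner (Y x) y"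
      by (intro tendsto_cinner_left lim)
    show "(\<lambda>n. cinner (sqrt_iter B n x) y) \<longlonglongrightarrow> cinner x (Y y)"
      unfolding selfadjoint_sqrt_iter[OF Bs] by (intro tendsto_cinner_right lim)
  qed
  have YY: "Y (Y x) = 2 *\<^sub>R Y x - B x" for x
  proof -
    \<comment> \<open>Convergence is only pointwise. The uniform norm bound first replaces the inner
      iterate by its limit, and convergence at the fixed point \<open>Y x\<close> does the
      rest.\<close>
    have "(\<lambda>n. sqrt_iter B n (sqrt_iter B n x) - sqrt_iter B n (Y x)) \<longlonglongrightarrow> 0"
    proof (rule tendsto_0_le[of "\<lambda>n. sqrt_iter B n x - Y x" _ _ 1])
      show "(\<lambda>n. sqrt_iter B n x - Y x) \<longlonglongrightarrow> 0"
        using lim by (simp add: LIM_zero_iff)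
      have "norm (sqrt_iter B n (sqrt_iter B n x - Y x)) \<le> norm (sqrt_iter B n x - Y x)" for n
        using order_trans[OF norm_sqrt_iter_le[OF B] mult_left_le_one_le[OF norm_ge_zero sqrt_iter_bound_range]] .
      then show "\<forall>\<^sub>F n in sequentially. norm (sqrt_iter B n (sqrt_iter B n x) - sqrt_iter B n (Y x))
          \<le> norm (sqrt_iter B n x - Y x) * 1"
        by (simp add: bounded_clinear_diff_eq[OF it])
    qed
    from tendsto_add[OF this lim[of "Y x"]]
    have "(\<lambda>n. (1/2) *\<^sub>R (B x + sqrt_iter B n (sqrt_iter B n x))) \<longlonglongrightarrow> (1/2) *\<^sub>R (B x + Y (Y x))"
      by (intro tendsto_intros) simp
    moreover have "(\<lambda>n. sqrt_iter B (Suc n) x) \<longlonglongrightarrow> Y x"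
      by (rule LIMSEQ_Suc[OF lim])
    ultimately have "Y x = (1/2) *\<^sub>R (B x + Y (Y x))"
      by (simp add: LIMSEQ_unique)
    then have "2 *\<^sub>R Y x = B x + Y (Y x)"
      by (metis scaleR_half_double scaleR_2 scaleR_scaleR scaleR_one mult.commute nonzero_eq_divide_eq zero_neq_numeral)
    then show ?thesis
      by (simp add: algebra_simps)
  qed
  define R where "R x = sqrt M *\<^sub>R (x - Y x)" for x
  have Rb: "bounded_clinear R"
    unfolding R_def by (intro bclin_intro Yb)
  show ?thesis
  proof
    have "0 \<le> inner (R x) x" for x
    proof -
      have "inner (Y x) x \<le> norm (Y x) * norm x"
        by (rule norm_cauchy_schwarz)
      also have "\<dots> \<le> norm x * norm x"
        using Y_norm by (intro mult_right_mono) auto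
      finally have "inner (Y x) x \<le> inner x x"
        by (simp add: power2_norm_eq_inner[symmetric] power2_eq_square)
      then show ?thesis
        using M(1) by (simp add: R_def inner_diff_left)
    qed
    then show "positive_op R"
      using Rb by (simp add: positive_op_def selfadjoint_def inner_eq_Re_cinner R_def cinner_simps Ysa)
    show "R (R x) = A x" for x
    proof -
      have "R (R x) = M *\<^sub>R ((x - Y x) - (Y x - Y (Y x)))"
        using M(1) by (simp add: R_def bounded_clinear_simps Yb flip: scaleR_diff_right)
      also have "\<dots> = M *\<^sub>R (x - B x)"
        by (simp add: YY scaleR_2 algebra_simps)
      also have "\<dots> = A x"
        using M(1) by (simp add: B_def)
      finally show ?thesis .
    qed
    fix C x assume C: "bounded_clinear C" "\<And>x. C (A x) = A (C x)"
    have "C (B x) = B (C x)" for x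
      by (simp add: B_def bounded_clinear_simps C)
    then have "C (sqrt_iter B n x) = sqrt_iter B n (C x)" for n
      by (intro sqrt_iter_commute C(1))
    then have "C (Y x) = Y (C x)"
      using LIMSEQ_unique[OF tendsto_bounded_clinear[OF C(1) lim[of x]]] lim[of "C x"] by simp
    then show "C (R x) = R (C x)"
      by (simp add: R_def bounded_clinear_simps C(1))
  qed
qed

lemma positive_op_form_zero:
  fixes A :: "'a::chilbert_space \<Rightarrow> 'a"
  assumes A: "positive_op A" and "inner (A x) x = 0"
  shows "A x = 0"
proof -
  obtain R where R: "positive_op R" "\<And>x. R (R x) = A x"
    using positive_sqrt_exists[OF A] by metis
  have "inner (R x) (R x) = 0"
    using selfadjoint_inner[OF positive_op_selfadjoint[OF R(1)], of "R x" x] R(2) assms(2) by simp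
  then have "A x = R 0"
    by (simp flip: R(2))
  then show ?thesis
    using R(1) by (simp add: positive_op_def bclin_intro bounded_clinear_zero_eq)
qed

text \<open>Commuting roots satisfy \<open>(R + S) (R - S) = 0\<close>. At
  \<open>y = R x - S x\<close> both nonnegative forms therefore vanish, which gives
  \<open>R y = S y = 0\<close> and, moving the roots across the inner product,
  \<open>inner y y = 0\<close>.\<close>

lemma positive_sqrt_unique:
  fixes A :: "'a::chilbert_space \<Rightarrow> 'a"
  assumes A: "positive_op A"
  shows "\<exists>!R. positive_op R \<and> R \<circ> R = A"
proof -
  obtain R where R: "positive_op R" "\<And>x. R (R x) = A x"
    and comm: "\<And>C x. bounded_clinear C \<Longrightarrow> (\<And>x. C (A x) = A (C x)) \<Longrightarrow> C (R x) = R (C x)"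
    using positive_sqrt_exists[OF A] by blast
  show ?thesis
  proof (rule ex1I)
    show "positive_op R \<and> R \<circ> R = A"
      using R by auto
    fix S assume "positive_op S \<and> S \<circ> S = A"
    then have S: "positive_op S" "\<And>x. S (S x) = A x"
      by auto
    have Rb: "bounded_clinear R" and Sb: "bounded_clinear S"
      using R S by (auto simp: positive_op_def bclin_intro)
    have SR: "S (R x) = R (S x)" for x
      by (rule comm[OF Sb]) (simp flip: S(2))
    show "S = R"
    proof
      fix x
      define y where "y = R x - S x"
      have "R y + S y = 0"
        by (simp add: y_def bounded_clinear_simps Rb Sb R(2) S(2) SR)
      then have "inner (R y) y + inner (S y) y = 0"
        by (metis inner_add_left inner_zero_left)
      then have "inner (R y) y = 0" "inner (S y) y = 0"
        using positive_op_form[OF R(1), of y] positive_op_form[OF S(1), of y] by linarith+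
      then have "R y = 0" "S y = 0"
        using positive_op_form_zero R(1) S(1) by blast+
      then have "inner y y = 0"
        unfolding y_def inner_diff_left
        using selfadjoint_inner[OF positive_op_selfadjoint[OF R(1)], of x y]
          selfadjoint_inner[OF positive_op_selfadjoint[OF S(1)], of x y]
        by (simp add: y_def)
      then show "S x = R x"
        by (simp add: y_def)
    qed
  qed
qed

lemma op_abs:
  fixes T :: "'a::chilbert_space \<Rightarrow> 'a"
  assumes T: "bounded_clinear T"
  shows "positive_op (op_abs T)" "op_abs T (op_abs T x) = cadjoint T (T x)"
proof -
  have b: "bounded_clinear (cadjoint T \<circ> T)"
    using bounded_clinear_compose[OF bounded_clinear_cadjoint[OF T] T] by (simp add: comp_def)
  have "positive_op (cadjoint T \<circ> T)"
    unfolding positive_op_def selfadjoint_def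
    using b by (simp add: cadjoint_cinner[OF T, symmetric] cadjoint_cinner_right[OF T, symmetric] cinner_self
      flip: of_real_power)
  from theI'[OF positive_sqrt_unique[OF this]]
  have *: "positive_op (op_abs T) \<and> op_abs T \<circ> op_abs T = cadjoint T \<circ> T"
    unfolding op_abs_def op_sqrt_def .
  then show "positive_op (op_abs T)" by simp
  show "op_abs T (op_abs T x) = cadjoint T (T x)"
    using * by (metis comp_apply)
qed

lemma norm_op_abs:
  fixes T :: "'a::chilbert_space \<Rightarrow> 'a"
  assumes T: "bounded_clinear T"
  shows "norm (op_abs T x) = norm (T x)"
proof -
  have "inner (op_abs T x) (op_abs T x) = inner (T x) (T x)"
    using selfadjoint_inner[OF positive_op_selfadjoint[OF op_abs(1)[OF T]], of "op_abs T x" x]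
      op_abs(2)[OF T, of x] cadjoint_inner[OF T, of x "T x"] by (simp add: inner_commute)
  then show ?thesis
    by (simp add: norm_eq_sqrt_inner)
qed

section \<open>Singular values\<close>

text \<open>\<open>S\<close> is the inverse of \<open>R + \<epsilon>\<close>. The form of
  \<open>G\<close> lies between \<open>\<epsilon>\<close> and \<open>M = K + \<epsilon>\<close>
  times the square of the norm, so \<open>y - G y / M\<close> has norm at most
  \<open>1 - \<epsilon> / M\<close> times that of \<open>y\<close>, and Banach's fixed point theorem
  solves \<open>G y = x\<close>.\<close>

lemma positive_resolvent:
  fixes R :: "'a::chilbert_space \<Rightarrow> 'a"
  assumes R: "positive_op R" and "\<epsilon> > 0"
  obtains S where "bounded_clinear S" "\<And>x. R (S x) + \<epsilon> *\<^sub>R S x = x" "\<And>x. S (R x + \<epsilon> *\<^sub>R x) = x"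
    "\<And>x. norm (R (S x)) \<le> norm x"
proof -
  have Rs: "selfadjoint R" and Rb: "bounded_clinear R"
    using R by (auto simp: positive_op_def bclin_intro)
  obtain K where K: "K > 0" "\<And>x. norm (R x) \<le> K * norm x"
    using bounded_clinear_bound[OF Rb] by metis
  define G where "G x = R x + \<epsilon> *\<^sub>R x" for x
  have Gb: "bounded_clinear G"
    unfolding G_def by (intro bclin_intro Rb)
  \<comment> \<open>Positivity of \<open>R\<close> makes the cross term nonnegative. This inequality
    yields injectivity of \<open>G\<close>, boundedness of \<open>S\<close> and the contraction
    bound for \<open>R (S x)\<close>.\<close>
  have norm_G: "(norm (R x))\<^sup>2 + (\<epsilon> * norm x)\<^sup>2 \<le> (norm (G x))\<^sup>2" for x
  proof -
    have "(norm (G x))\<^sup>2 = (norm (R x))\<^sup>2 + 2 * \<epsilon> * inner (R x) x + (\<epsilon> * norm x)\<^sup>2"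
      unfolding G_def power_mult_distrib power2_norm_eq_inner
      by (simp add: inner_add_left inner_add_right inner_commute power2_eq_square algebra_simps)
    then show ?thesis
      using positive_op_form[OF R, of x] \<open>\<epsilon> > 0\<close> by simp
  qed
  have inj: "x = y" if "G x = G y" for x y
  proof -
    have "G (x - y) = 0"
      using that by (simp add: bounded_clinear_simps Gb)
    then have "(\<epsilon> * norm (x - y))\<^sup>2 \<le> 0"
      using norm_G[of "x - y"] by (smt (verit) norm_zero power_zero_numeral zero_le_power2)
    then show ?thesis
      using \<open>\<epsilon> > 0\<close> by simp
  qed
  define M where "M = K + \<epsilon>"
  define c where "c = 1 - \<epsilon> / M"
  have M: "M > 0" and c: "0 \<le> c" "c < 1"
    using K(1) \<open>\<epsilon> > 0\<close> by (auto simp: M_def c_def field_simps)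
  have contr: "norm (y - (1 / M) *\<^sub>R G y) \<le> c * norm y" for y
  proof (rule norm_le_of_form_bound)
    have "bounded_clinear (\<lambda>y. y - (1 / M) *\<^sub>R G y)"
      by (intro bclin_intro Gb)
    moreover have "cinner (y - (1 / M) *\<^sub>R G y) z = cinner y (z - (1 / M) *\<^sub>R G z)" for y z
      by (simp add: cinner_simps G_def selfadjoint_cinner[OF Rs])
    ultimately show "selfadjoint (\<lambda>y. y - (1 / M) *\<^sub>R G y)"
      by (simp add: selfadjoint_def)
    fix y
    have eq: "inner (y - (1 / M) *\<^sub>R G y) y = (norm y)\<^sup>2 - (inner (R y) y + \<epsilon> * (norm y)\<^sup>2) / M"
      by (simp add: G_def inner_diff_left inner_add_left power2_norm_eq_inner)
    have "0 \<le> inner (R y) y" "inner (R y) y \<le> K * (norm y)\<^sup>2"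
      using positive_op_form[OF R, of y] abs_form_le[of R K, OF K(2), of y] by auto
    then have "\<epsilon> * (norm y)\<^sup>2 / M \<le> (inner (R y) y + \<epsilon> * (norm y)\<^sup>2) / M"
      "(inner (R y) y + \<epsilon> * (norm y)\<^sup>2) / M \<le> (norm y)\<^sup>2"
      using M divide_right_mono[of "\<epsilon> * (norm y)\<^sup>2" "inner (R y) y + \<epsilon> * (norm y)\<^sup>2" M]
      by (simp_all add: pos_divide_le_eq) (simp add: M_def algebra_simps)
    then show "\<bar>inner (y - (1 / M) *\<^sub>R G y) y\<bar> \<le> c * (norm y)\<^sup>2"
      unfolding eq c_def using c by (simp add: abs_le_iff left_diff_distrib c_def)
  qed
  have "\<exists>y. G y = x" for x
  proof -
    have "\<exists>!y. y - (1 / M) *\<^sub>R (G y - x) = y"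
    proof (rule banach_fix_type[OF c])
      show "\<forall>y z. dist (y - (1 / M) *\<^sub>R (G y - x)) (z - (1 / M) *\<^sub>R (G z - x)) \<le> c * dist y z"
      proof (intro allI)
        fix y z
        have "(y - (1 / M) *\<^sub>R (G y - x)) - (z - (1 / M) *\<^sub>R (G z - x)) = (y - z) - (1 / M) *\<^sub>R G (y - z)"
          by (simp add: bounded_clinear_simps Gb algebra_simps)
        then show "dist (y - (1 / M) *\<^sub>R (G y - x)) (z - (1 / M) *\<^sub>R (G z - x)) \<le> c * dist y z"
          unfolding dist_norm using contr[of "y - z"] by (simp only:)
      qed
    qed
    then obtain y where "y - (1 / M) *\<^sub>R (G y - x) = y"
      by blast
    then show ?thesis
      using M by (intro exI[of _ y]) simp
  qed
  then obtain S where S: "\<And>x. G (S x) = x"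
    by metis
  show ?thesis
  proof
    show "R (S x) + \<epsilon> *\<^sub>R S x = x" for x
      using S[of x] by (simp add: G_def)
    show "S (R x + \<epsilon> *\<^sub>R x) = x" for x
      by (rule inj) (simp add: S, simp add: G_def)
    have "(norm (R (S x)))\<^sup>2 \<le> (norm x)\<^sup>2" for x
      using norm_G[of "S x"] zero_le_power2[of "\<epsilon> * norm (S x)"] unfolding S by linarith
    then show "norm (R (S x)) \<le> norm x" for x
      by (rule power2_le_imp_le) simp
    show "bounded_clinear S"
    proof (rule bounded_clinearI)
      show "S (x + y) = S x + S y" for x y
        by (rule inj) (simp add: bounded_clinear_simps Gb S)
      show "S (c *\<^sub>C x) = c *\<^sub>C S x" for c x
        by (rule inj) (simp add: bounded_clinear_simps Gb S)
      have "(\<epsilon> * norm (S x))\<^sup>2 \<le> (norm x)\<^sup>2" for x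
        using norm_G[of "S x"] zero_le_power2[of "norm (R (S x))"] unfolding S by linarith
      then have "\<epsilon> * norm (S x) \<le> norm x" for x
        by (rule power2_le_imp_le) simp
      then show "norm (S x) \<le> (1 / \<epsilon>) * norm x" for x
        using \<open>\<epsilon> > 0\<close> by (simp add: field_simps)
    qed
  qed
qed

text \<open>\<open>U\<close> is \<open>T\<close> after the inverse of
  \<open>op_abs T + \<epsilon>\<close>. It stands in for the partial isometry, which would have to
  be extended from the range of \<open>op_abs T\<close>; it is a contraction because
  \<open>op_abs T\<close> and \<open>T\<close> have equal norms at every vector.\<close>

lemma approximate_polar_decomposition:
  fixes T :: "'a::chilbert_space \<Rightarrow> 'a"
  assumes T: "bounded_clinear T" and "\<epsilon> > 0"
  obtains U :: "'a \<Rightarrow> 'a" where "contraction U" "\<And>x. norm (T x - U (op_abs T x)) \<le> \<epsilon> * norm x"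
    "\<And>x. \<bar>inner (T x) (U x) - inner (op_abs T x) x\<bar> \<le> \<epsilon> * (norm x)\<^sup>2"
proof -
  define R where "R = op_abs T"
  have R: "positive_op R" and RR: "\<And>x. R (R x) = cadjoint T (T x)" and nR: "\<And>x. norm (R x) = norm (T x)"
    unfolding R_def using op_abs[OF T] norm_op_abs[OF T] by auto
  have Rs: "selfadjoint R" and Rb: "bounded_clinear R"
    using R by (auto simp: positive_op_def bclin_intro)
  obtain S where S: "bounded_clinear S" "\<And>x. R (S x) + \<epsilon> *\<^sub>R S x = x" "\<And>x. S (R x + \<epsilon> *\<^sub>R x) = x"
    "\<And>x. norm (R (S x)) \<le> norm x"
    using positive_resolvent[OF R \<open>\<epsilon> > 0\<close>] by blast
  define U where "U x = T (S x)" for x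
  have Ub: "bounded_clinear U"
    unfolding U_def by (rule bounded_clinear_compose[OF T S(1)])
  have U: "contraction U"
    using Ub S(4) by (simp add: contraction_def U_def nR[symmetric])
  show ?thesis
  proof
    show "contraction U" by (rule U)
    fix x
    have "T x = U (R x + \<epsilon> *\<^sub>R x)"
      by (simp add: U_def S(3))
    then have "T x - U (R x) = \<epsilon> *\<^sub>R U x"
      by (simp add: bounded_clinear_simps Ub)
    then show "norm (T x - U (op_abs T x)) \<le> \<epsilon> * norm x"
      using contraction_norm_le[OF U, of x] \<open>\<epsilon> > 0\<close> by (simp add: R_def)
    have "inner (T x) (U x) = inner (R (R x)) (S x)"
      using cadjoint_inner[OF T, of "S x" "T x"] by (simp add: U_def RR inner_commute)
    also have "\<dots> = inner (R x) (x - \<epsilon> *\<^sub>R S x)"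
      using S(2)[of x] selfadjoint_inner[OF Rs, of "R x" "S x"] by (metis add_diff_cancel_right')
    also have "\<dots> = inner (R x) x - \<epsilon> * inner x (R (S x))"
      using selfadjoint_inner[OF Rs, of x "S x"] by (simp add: inner_diff_right)
    finally have "\<bar>inner (T x) (U x) - inner (R x) x\<bar> = \<epsilon> * \<bar>inner x (R (S x))\<bar>"
      using \<open>\<epsilon> > 0\<close> by (simp add: abs_mult)
    also have "\<dots> \<le> \<epsilon> * (norm x * norm x)"
      using \<open>\<epsilon> > 0\<close> order_trans[OF Cauchy_Schwarz_ineq2[of x "R (S x)"] mult_left_mono[OF S(4)[of x] norm_ge_zero]]
      by (intro mult_left_mono) auto
    finally show "\<bar>inner (T x) (U x) - inner (op_abs T x) x\<bar> \<le> \<epsilon> * (norm x)\<^sup>2"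
      by (simp add: R_def power2_eq_square)
  qed
qed

section \<open>Order and partial sums of singular values\<close>

lemma singular_values_eq: "singular_values T n = upper_scale (op_abs T) n"
  by (simp add: singular_values_def upper_scale_def)

lemma lower_scale_0_le_form:
  fixes A :: "'a::complex_inner \<Rightarrow> 'a"
  assumes A: "bounded_clinear A" and inf: "inf_dim TYPE('a)" and "\<And>x. 0 \<le> inner (A x) x"
  shows "0 \<le> lower_scale A n"
proof -
  have "upper_scale (\<lambda>x. - A x) 0 \<le> 0"
    by (rule upper_scale_le_orthonormal[OF bounded_clinear_minus[OF A] inf, of 0 "\<lambda>_. 0"])
      (use assms(3) in \<open>auto simp: orthonormal_def\<close>)
  then show ?thesis
    using lower_scale_mono[OF A inf, of 0 n] by (simp add: upper_scale_uminus)
qed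

lemma singular_values_nonneg:
  fixes T :: "'a::chilbert_space \<Rightarrow> 'a"
  assumes T: "bounded_clinear T" and inf: "inf_dim TYPE('a)"
  shows "0 \<le> singular_values T n"
proof -
  have b: "bounded_clinear (op_abs T)"
    using op_abs(1)[OF T] by (simp add: positive_op_def bclin_intro)
  show ?thesis
    using lower_scale_0_le_form[OF b inf positive_op_form[OF op_abs(1)[OF T]], of n]
      lower_scale_le_upper_scale[OF b inf, of n n] by (simp add: singular_values_eq)
qed

lemma singular_values_antimono:
  fixes T :: "'a::chilbert_space \<Rightarrow> 'a"
  assumes T: "bounded_clinear T" and inf: "inf_dim TYPE('a)" and "i \<le> j"
  shows "singular_values T j \<le> singular_values T i"
  using upper_scale_antimono[OF _ inf \<open>i \<le> j\<close>, of "op_abs T"] op_abs(1)[OF T]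
  by (simp add: singular_values_eq positive_op_def bclin_intro)

lemma sum_singular_values_le:
  fixes T :: "'a::chilbert_space \<Rightarrow> 'a"
  assumes T: "bounded_clinear T" and inf: "inf_dim TYPE('a)" and "\<epsilon> > 0"
  obtains U :: "'a \<Rightarrow> 'a" and x where "contraction U" "orthonormal k x"
    "(\<Sum>n<k. singular_values T n) \<le> (\<Sum>i<k. inner (T (x i)) (U (x i))) + \<epsilon>"
proof -
  define R where "R = op_abs T"
  \<comment> \<open>Each of the \<open>k\<close> indices costs \<open>2 * \<delta>\<close>: once for
    the approximate eigenvalue and once for the approximate polar factor.\<close>
  define \<delta> where "\<delta> = \<epsilon> / (2 * (real k + 1))"
  have "\<delta> > 0"
    using \<open>\<epsilon> > 0\<close> by (simp add: \<delta>_def)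
  obtain U :: "'a \<Rightarrow> 'a" where U: "contraction U"
    "\<And>x. \<bar>inner (T x) (U x) - inner (R x) x\<bar> \<le> \<delta> * (norm x)\<^sup>2"
    using approximate_polar_decomposition[OF T \<open>\<delta> > 0\<close>] unfolding R_def by metis
  obtain x where x: "orthonormal k x" "\<And>i. i < k \<Longrightarrow> norm (R (x i) - upper_scale R i *\<^sub>R x i) \<le> \<delta>"
    using approx_eigenvectors[OF positive_op_selfadjoint[OF op_abs(1)[OF T]] inf \<open>\<delta> > 0\<close>, of k]
    unfolding R_def by blast
  have "upper_scale R i \<le> inner (T (x i)) (U (x i)) + 2 * \<delta>" if "i < k" for i
  proof -
    have n1: "norm (x i) = 1"
      by (rule orthonormal_norm[OF x(1) that])
    have "\<bar>inner (R (x i) - upper_scale R i *\<^sub>R x i) (x i)\<bar> \<le> \<delta>"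
      using Cauchy_Schwarz_ineq2[of "R (x i) - upper_scale R i *\<^sub>R x i" "x i"] x(2)[OF that] n1 by simp
    moreover have "inner (x i) (x i) = 1"
      using n1 by (simp add: power2_norm_eq_inner[symmetric])
    ultimately have "upper_scale R i \<le> inner (R (x i)) (x i) + \<delta>"
      by (simp add: inner_diff_left abs_le_iff)
    then show ?thesis
      using U(2)[of "x i"] n1 by (simp add: abs_le_iff)
  qed
  then have "(\<Sum>i<k. singular_values T i) \<le> (\<Sum>i<k. inner (T (x i)) (U (x i)) + 2 * \<delta>)"
    unfolding singular_values_eq R_def by (intro sum_mono) auto
  also have "\<dots> = (\<Sum>i<k. inner (T (x i)) (U (x i))) + real k * (2 * \<delta>)"
    by (simp add: sum.distrib)
  also have "real k * (2 * \<delta>) \<le> \<epsilon>"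
    using \<open>\<epsilon> > 0\<close> by (simp add: \<delta>_def field_simps)
  finally show ?thesis
    using that[OF U(1) x(1)] by simp
qed

section \<open>Finite-rank layers and summation by parts\<close>

definition rank_one_sum :: "nat \<Rightarrow> (nat \<Rightarrow> real) \<Rightarrow> (nat \<Rightarrow> 'a::complex_inner) \<Rightarrow> (nat \<Rightarrow> 'b::complex_inner) \<Rightarrow> 'a \<Rightarrow> 'b"
  where "rank_one_sum k a f g x = (\<Sum>j<k. a j *\<^sub>R (cinner x (f j) *\<^sub>C g j))"

lemma bounded_clinear_rank_one_sum: "bounded_clinear (rank_one_sum k a f g)"
  unfolding rank_one_sum_def by (intro bclin_intro)

lemma selfadjoint_rank_one_sum: "selfadjoint (rank_one_sum k a f f)"
proof -
  have "cinner (rank_one_sum k a f f x) y = cinner x (rank_one_sum k a f f y)" for x y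
    unfolding rank_one_sum_def cinner_sum_left cinner_sum_right
    by (intro sum.cong refl) (simp add: cinner_simps cinner_commute[of _ y] mult_ac)
  then show ?thesis
    by (simp add: selfadjoint_def bounded_clinear_rank_one_sum)
qed

lemma rank_one_sum_form: "inner (rank_one_sum k a f f x) x = (\<Sum>j<k. a j * (cmod (cinner x (f j)))\<^sup>2)"
proof -
  have "inner (cinner x (f j) *\<^sub>C f j) x = (cmod (cinner x (f j)))\<^sup>2" for j
  proof -
    have "cinner (cinner x (f j) *\<^sub>C f j) x = cinner x (f j) * cnj (cinner x (f j))"
      by (simp add: cinner_simps cinner_commute[of "f j" x])
    then show ?thesis
      by (simp only: inner_eq_Re_cinner complex_norm_square[symmetric] Re_complex_of_real)
  qed
  then show ?thesis
    by (simp add: rank_one_sum_def inner_sum_left)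
qed

lemma selfadjoint_diff: "selfadjoint A \<Longrightarrow> selfadjoint B \<Longrightarrow> selfadjoint (\<lambda>x. A x - B x)"
  by (simp add: selfadjoint_def bounded_clinear_diff cinner_simps)

lemma selfadjoint_add: "selfadjoint A \<Longrightarrow> selfadjoint B \<Longrightarrow> selfadjoint (\<lambda>x. A x + B x)"
  by (simp add: selfadjoint_def bounded_clinear_add cinner_simps)

text \<open>A Schmidt expansion truncated at level \<open>n\<close>, available even without singular
  vectors: \<open>op_abs X\<close> is flattened and the result is carried over by the approximate
  polar factor \<open>U\<close>. Positivity keeps the flattened form above \<open>- \<delta>\<close>
  times the square of the norm, so its norm is governed by the upper level.\<close>

lemma singular_value_remainder:
  fixes X :: "'a::chilbert_space \<Rightarrow> 'a"
  assumes X: "bounded_clinear X" and inf: "inf_dim TYPE('a)" and "\<epsilon> > 0"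
  obtains f and U :: "'a \<Rightarrow> 'a" where "orthonormal (Suc n) f" "contraction U"
    "\<And>x. norm (X x - rank_one_sum (Suc n) (\<lambda>j. singular_values X j - singular_values X n) f (\<lambda>j. U (f j)) x)
      \<le> (singular_values X n + \<epsilon>) * norm x"
proof -
  define R where "R = op_abs X"
  define s where "s = upper_scale R"
  have R: "positive_op R"
    unfolding R_def by (rule op_abs(1)[OF X])
  have Rs: "selfadjoint R" and Rb: "bounded_clinear R"
    using R by (auto simp: positive_op_def bclin_intro)
  define \<delta> where "\<delta> = \<epsilon> / 2"
  have "\<delta> > 0"
    using \<open>\<epsilon> > 0\<close> by (simp add: \<delta>_def)
  obtain U :: "'a \<Rightarrow> 'a" where U: "contraction U" "\<And>x. norm (X x - U (R x)) \<le> \<delta> * norm x"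
    using approximate_polar_decomposition[OF X \<open>\<delta> > 0\<close>] unfolding R_def by metis
  have Ub: "bounded_clinear U"
    by (rule contraction_bounded[OF U(1)])
  obtain f y where f: "orthonormal (Suc n) f" "orthonormal (Suc 0) y" and
    up: "\<And>\<psi>. scale_remainder R n 0 f y \<psi> \<le> (s n + \<delta>) * (norm \<psi>)\<^sup>2" and
    lo: "\<And>\<psi>. (lower_scale R 0 - \<delta>) * (norm \<psi>)\<^sup>2 \<le> scale_remainder R n 0 f y \<psi>"
    using scale_decomposition[OF Rs inf \<open>\<delta> > 0\<close>, of n 0] unfolding s_def by metis
  define L where "L = rank_one_sum (Suc n) (\<lambda>j. s j - s n) f f"
  define R' where "R' x = R x - L x" for x
  have Lb: "bounded_clinear L"
    unfolding L_def by (rule bounded_clinear_rank_one_sum)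
  have form: "inner (R' \<psi>) \<psi> = scale_remainder R n 0 f y \<psi>" for \<psi>
    unfolding R'_def L_def inner_diff_left rank_one_sum_form scale_remainder_def s_def by simp
  have R'n: "norm (R' x) \<le> (s n + \<delta>) * norm x" for x
  proof (rule norm_le_of_form_bound)
    show "selfadjoint R'"
      unfolding R'_def L_def by (intro selfadjoint_diff Rs selfadjoint_rank_one_sum)
    fix \<psi> :: 'a
    have l0: "0 \<le> lower_scale R 0" "0 \<le> s n"
      using lower_scale_0_le_form[OF Rb inf positive_op_form[OF R], of 0] lower_scale_le_upper_scale[OF Rb inf, of 0 n]
      by (auto simp: s_def)
    have "- ((s n + \<delta>) * (norm \<psi>)\<^sup>2) \<le> (lower_scale R 0 - \<delta>) * (norm \<psi>)\<^sup>2"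
      unfolding mult_minus_left[symmetric] using l0 by (intro mult_right_mono) auto
    then show "\<bar>inner (R' \<psi>) \<psi>\<bar> \<le> (s n + \<delta>) * (norm \<psi>)\<^sup>2"
      using up[of \<psi>] lo[of \<psi>] unfolding form abs_le_iff by linarith
  qed
  have UL: "U (L x) = rank_one_sum (Suc n) (\<lambda>j. s j - s n) f (\<lambda>j. U (f j)) x" for x
    unfolding L_def rank_one_sum_def bounded_clinear_sum_eq[OF Ub]
    by (simp only: bounded_clinear_scaleR_eq[OF Ub] bounded_clinear_scaleC_eq[OF Ub])
  show ?thesis
  proof (rule that[OF f(1) U(1)])
    fix x
    have "X x - U (L x) = (X x - U (R x)) + U (R' x)"
      by (simp add: R'_def bounded_clinear_simps Ub)
    then have "norm (X x - U (L x)) \<le> \<delta> * norm x + (s n + \<delta>) * norm x"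
      using U(2)[of x] R'n[of x] contraction_norm_le[OF U(1), of "R' x"]
      by (smt (verit) norm_triangle_ineq)
    also have "\<dots> = (s n + \<epsilon>) * norm x"
      by (simp add: \<delta>_def algebra_simps)
    finally show "norm (X x - rank_one_sum (Suc n) (\<lambda>j. singular_values X j - singular_values X n) f (\<lambda>j. U (f j)) x)
      \<le> (singular_values X n + \<epsilon>) * norm x"
      unfolding UL by (simp add: s_def R_def singular_values_eq)
  qed
qed

text \<open>Nonnegative nonincreasing weights are nonnegative combinations of indicators of initial
  segments; \<open>abel\<close> is this decomposition.\<close>

lemma weighted_sum_mono_of_partial_sums:
  fixes a b c :: "nat \<Rightarrow> real"
  assumes "\<And>j. j \<le> m \<Longrightarrow> (\<Sum>i<j. a i) \<le> (\<Sum>i<j. b i)"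
    and "\<And>i. i < m \<Longrightarrow> 0 \<le> c i" "\<And>i j. i \<le> j \<Longrightarrow> j < m \<Longrightarrow> c j \<le> c i"
  shows "(\<Sum>i<m. c i * a i) \<le> (\<Sum>i<m. c i * b i)"
proof (cases m)
  case (Suc n)
  have abel: "(\<Sum>i<Suc n. c i * d i) = c n * (\<Sum>i<Suc n. d i) + (\<Sum>i<n. (c i - c (Suc i)) * (\<Sum>j<Suc i. d j))"
    for n and d :: "nat \<Rightarrow> real"
    by (induction n) (simp_all add: algebra_simps)
  have "c n * (\<Sum>i<Suc n. a i) \<le> c n * (\<Sum>i<Suc n. b i)"
    using assms(1)[of "Suc n"] assms(2)[of n] Suc by (intro mult_left_mono) auto
  moreover have "(\<Sum>i<n. (c i - c (Suc i)) * (\<Sum>j<Suc i. a j)) \<le> (\<Sum>i<n. (c i - c (Suc i)) * (\<Sum>j<Suc i. b j))"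
  proof (rule sum_mono, rule mult_left_mono)
    fix i assume "i \<in> {..<n}"
    then show "(\<Sum>j<Suc i. a j) \<le> (\<Sum>j<Suc i. b j)" "0 \<le> c i - c (Suc i)"
      using assms(1)[of "Suc i"] assms(3)[of i "Suc i"] Suc by auto
  qed
  ultimately show ?thesis
    unfolding Suc abel by linarith
qed simp

section \<open>Rearrangements\<close>

lift_definition basis_ell2 :: "'i \<Rightarrow> 'i ell2" is "\<lambda>i j. if j = i then 1 else 0"
proof -
  fix i :: 'i
  have "(\<lambda>j. (cmod (if j = i then 1 else 0))\<^sup>2) summable_on {i}"
    by simp
  then show "(\<lambda>j. (cmod (if j = i then 1 else 0))\<^sup>2) summable_on UNIV"
    by (rule summable_on_cong_neutral[THEN iffD1, rotated -1]) auto
qed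

lemma cinner_basis_ell2: "cinner f (basis_ell2 i) = Rep_ell2 f i"
proof -
  have "cinner f (basis_ell2 i) = (\<Sum>\<^sub>\<infinity>j. Rep_ell2 f j * cnj (if j = i then 1 else 0))"
    by transfer simp
  also have "\<dots> = (\<Sum>\<^sub>\<infinity>j\<in>{i}. Rep_ell2 f j)"
    by (rule infsum_cong_neutral) auto
  finally show ?thesis by simp
qed

lemma orthonormal_basis_ell2: "orthonormal k (basis_ell2 :: nat \<Rightarrow> nat ell2)"
  unfolding orthonormal_def cinner_basis_ell2 by (auto simp: basis_ell2.rep_eq)

lemma inf_dim_ell2: "inf_dim TYPE(nat ell2)"
  unfolding inf_dim_def using orthonormal_basis_ell2 by blast

lemma Rep_diag_op:
  "bounded (range a) \<Longrightarrow> Rep_ell2 (diag_op a f) i = complex_of_real (a i) * Rep_ell2 f i"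
  by transfer simp

lemma bounded_clinear_diag_op:
  assumes "bounded (range a)"
  shows "bounded_clinear (diag_op a)"
proof -
  obtain B where B: "\<And>i. \<bar>a i\<bar> \<le> B"
    using assms by (auto simp: bounded_iff)
  then have "B \<ge> 0"
    by (meson abs_ge_zero order_trans)
  note rep = Rep_diag_op[OF assms]
  show ?thesis
  proof (rule bounded_clinearI)
    show "diag_op a (f + g) = diag_op a f + diag_op a g" for f g
      by (intro Rep_ell2_inject[THEN iffD1] ext) (simp add: rep plus_ell2.rep_eq distrib_left)
    show "diag_op a (c *\<^sub>C f) = c *\<^sub>C diag_op a f" for c f
      by (intro Rep_ell2_inject[THEN iffD1] ext) (simp add: rep scaleC_ell2.rep_eq)
    show "norm (diag_op a f) \<le> B * norm f" for f
    proof (rule power2_le_imp_le)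
      have "(norm (diag_op a f))\<^sup>2 \<le> (\<Sum>\<^sub>\<infinity>i. B\<^sup>2 * (cmod (Rep_ell2 f i))\<^sup>2)"
        unfolding norm_ell2_square
      proof (rule infsum_mono)
        show "(cmod (Rep_ell2 (diag_op a f) i))\<^sup>2 \<le> B\<^sup>2 * (cmod (Rep_ell2 f i))\<^sup>2" for i
          unfolding rep norm_mult power_mult_distrib
          using power_mono[OF B[of i], of 2] by (intro mult_right_mono) auto
        show "(\<lambda>i. (cmod (Rep_ell2 (diag_op a f) i))\<^sup>2) summable_on UNIV"
          using Rep_ell2[of "diag_op a f"] by simp
        show "(\<lambda>i. B\<^sup>2 * (cmod (Rep_ell2 f i))\<^sup>2) summable_on UNIV"
          using Rep_ell2[of f] by (intro summable_on_cmult_right) simp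
      qed
      also have "\<dots> = (B * norm f)\<^sup>2"
        unfolding power_mult_distrib norm_ell2_square by (rule infsum_cmult_right')
      finally show "(norm (diag_op a f))\<^sup>2 \<le> (B * norm f)\<^sup>2" .
    qed (use \<open>B \<ge> 0\<close> in simp)
  qed
qed

lemma diag_op_form:
  assumes "bounded (range a)"
  shows "inner (diag_op a f) f = (\<Sum>\<^sub>\<infinity>i. a i * (cmod (Rep_ell2 f i))\<^sup>2)"
    and "(\<lambda>i. a i * (cmod (Rep_ell2 f i))\<^sup>2) summable_on UNIV"
proof -
  have eq: "Rep_ell2 (diag_op a f) i * cnj (Rep_ell2 f i) = complex_of_real (a i * (cmod (Rep_ell2 f i))\<^sup>2)" for i
    unfolding Rep_diag_op[OF assms] of_real_mult complex_norm_square by (simp only: mult.assoc)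
  have "(\<lambda>i. Rep_ell2 (diag_op a f) i * cnj (Rep_ell2 f i)) summable_on UNIV"
    using Rep_ell2 by (intro square_summable_mult) auto
  then have "(\<lambda>i. Re (complex_of_real (a i * (cmod (Rep_ell2 f i))\<^sup>2))) summable_on UNIV"
    unfolding eq by (rule summable_on_Re)
  then show s: "(\<lambda>i. a i * (cmod (Rep_ell2 f i))\<^sup>2) summable_on UNIV"
    by (simp only: Re_complex_of_real)
  have "cinner (diag_op a f) f = (\<Sum>\<^sub>\<infinity>i. complex_of_real (a i * (cmod (Rep_ell2 f i))\<^sup>2))"
    unfolding cinner_ell2.rep_eq eq ..
  also have "\<dots> = complex_of_real (\<Sum>\<^sub>\<infinity>i. a i * (cmod (Rep_ell2 f i))\<^sup>2)"
    using s by (intro infsumI has_sum_of_real) auto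
  finally show "inner (diag_op a f) f = (\<Sum>\<^sub>\<infinity>i. a i * (cmod (Rep_ell2 f i))\<^sup>2)"
    by (simp only: inner_eq_Re_cinner Re_complex_of_real)
qed

text \<open>The sequences compared in the five statements are nonnegative and nonincreasing, so this
  reduces submajorization to ordinary partial sums. Min-max is tested on the standard basis.\<close>

lemma decreasing_rearrangement_antimono:
  fixes a :: "nat \<Rightarrow> real"
  assumes anti: "\<And>i j. i \<le> j \<Longrightarrow> a j \<le> a i" and nonneg: "\<And>i. 0 \<le> a i"
  shows "decreasing_rearrangement a n = a n"
proof -
  have "\<bar>a i\<bar> \<le> a 0" for i
    using anti[of 0 i] nonneg[of i] by simp
  then have bdd: "bounded (range a)"
    by (auto simp: bounded_iff)
  note b = bounded_clinear_diag_op[OF bdd] and form = diag_op_form[OF bdd]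
  have sq: "(\<lambda>i. (cmod (Rep_ell2 \<psi> i))\<^sup>2) summable_on UNIV" for \<psi> :: "nat ell2"
    using Rep_ell2[of \<psi>] by simp
  have "upper_scale (diag_op a) n \<le> a n"
  proof (rule upper_scale_le_orthonormal[OF b inf_dim_ell2 orthonormal_basis_ell2])
    fix \<psi> :: "nat ell2" assume \<psi>: "norm \<psi> = 1" "\<And>i. i < n \<Longrightarrow> cinner \<psi> (basis_ell2 i) = 0"
    have "inner (diag_op a \<psi>) \<psi> \<le> (\<Sum>\<^sub>\<infinity>i. a n * (cmod (Rep_ell2 \<psi> i))\<^sup>2)"
      unfolding form(1)
    proof (rule infsum_mono[OF form(2) summable_on_cmult_right[OF sq]])
      fix i
      show "a i * (cmod (Rep_ell2 \<psi> i))\<^sup>2 \<le> a n * (cmod (Rep_ell2 \<psi> i))\<^sup>2"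
        using \<psi>(2)[of i] anti[of n i] by (cases "i < n") (auto simp: cinner_basis_ell2 intro!: mult_right_mono)
    qed
    also have "\<dots> = a n * (norm \<psi>)\<^sup>2"
      unfolding norm_ell2_square by (rule infsum_cmult_right')
    finally show "inner (diag_op a \<psi>) \<psi> \<le> a n"
      using \<psi>(1) by simp
  qed
  moreover have "a n \<le> upper_scale (diag_op a) n"
  proof (rule upper_scale_ge_orthonormal[OF b inf_dim_ell2 orthonormal_basis_ell2])
    fix c
    define \<psi> :: "nat ell2" where "\<psi> = (\<Sum>i<Suc n. c i *\<^sub>C basis_ell2 i)"
    have "Rep_ell2 \<psi> i = 0" if "\<not> i < Suc n" for i
      unfolding cinner_basis_ell2[symmetric] \<psi>_def cinner_sum_left cinner_scaleC_left
      using that by (intro sum.neutral) (auto simp: cinner_basis_ell2 basis_ell2.rep_eq)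
    then have "(\<Sum>\<^sub>\<infinity>i. a n * (cmod (Rep_ell2 \<psi> i))\<^sup>2) \<le> inner (diag_op a \<psi>) \<psi>"
      unfolding form(1)
    proof (intro infsum_mono[OF summable_on_cmult_right[OF sq] form(2)])
      fix i
      show "a n * (cmod (Rep_ell2 \<psi> i))\<^sup>2 \<le> a i * (cmod (Rep_ell2 \<psi> i))\<^sup>2"
        if "\<And>i. \<not> i < Suc n \<Longrightarrow> Rep_ell2 \<psi> i = 0"
        using that[of i] anti[of i n] by (cases "i < Suc n") (auto intro!: mult_right_mono)
    qed
    moreover have "(\<Sum>\<^sub>\<infinity>i. a n * (cmod (Rep_ell2 \<psi> i))\<^sup>2) = a n * (norm \<psi>)\<^sup>2"
      unfolding norm_ell2_square by (rule infsum_cmult_right')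
    ultimately show "a n * (\<Sum>i<Suc n. (cmod (c i))\<^sup>2)
      \<le> inner (diag_op a (\<Sum>i<Suc n. c i *\<^sub>C basis_ell2 i)) (\<Sum>i<Suc n. c i *\<^sub>C basis_ell2 i)"
      unfolding \<psi>_def norm_sum_orthonormal[OF orthonormal_basis_ell2] by simp
  qed
  ultimately show ?thesis
    by (simp add: decreasing_rearrangement_def upper_scale_def)
qed

text \<open>The common frame of the five estimates, used with \<open>c = 1\<close> or
  \<open>c = 2\<close>: only sums paired with an arbitrary contraction \<open>U\<close> remain to be
  bounded.\<close>

lemma singular_values_submajorizedI:
  fixes T :: "'a::chilbert_space \<Rightarrow> 'a" and b :: "nat \<Rightarrow> real"
  assumes T: "bounded_clinear T" and inf: "inf_dim TYPE('a)" and "c \<ge> 0"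
    and b: "\<And>i j. i \<le> j \<Longrightarrow> b j \<le> b i" "\<And>i. 0 \<le> b i"
    and le: "\<And>k x (U :: 'a \<Rightarrow> 'a). contraction U \<Longrightarrow> orthonormal k x \<Longrightarrow>
      c * (\<Sum>i<k. inner (T (x i)) (U (x i))) \<le> (\<Sum>n<k. b n)"
  shows "(\<lambda>n. c * singular_values T n) \<prec>\<^sub>w b"
proof -
  have "decreasing_rearrangement b n = b n" for n
    using b by (rule decreasing_rearrangement_antimono)
  moreover have "decreasing_rearrangement (\<lambda>n. c * singular_values T n) n = c * singular_values T n" for n
    by (rule decreasing_rearrangement_antimono)
      (use singular_values_nonneg[OF T inf] singular_values_antimono[OF T inf] \<open>c \<ge> 0\<close> in \<open>auto intro: mult_left_mono\<close>)
  moreover have "c * (\<Sum>n<k. singular_values T n) \<le> (\<Sum>n<k. b n)" for k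
  proof (rule field_le_epsilon)
    fix \<epsilon> :: real assume "\<epsilon> > 0"
    define \<delta> where "\<delta> = \<epsilon> / (c + 1)"
    have \<delta>: "\<delta> > 0" "c * \<delta> \<le> \<epsilon>"
      using \<open>c \<ge> 0\<close> \<open>\<epsilon> > 0\<close> by (auto simp: \<delta>_def field_simps)
    obtain U :: "'a \<Rightarrow> 'a" and x where U: "contraction U" and x: "orthonormal k x" and
      s: "(\<Sum>n<k. singular_values T n) \<le> (\<Sum>i<k. inner (T (x i)) (U (x i))) + \<delta>"
      by (rule sum_singular_values_le[OF T inf \<delta>(1)])
    have "c * (\<Sum>n<k. singular_values T n) \<le> c * (\<Sum>i<k. inner (T (x i)) (U (x i))) + c * \<delta>"
      using mult_left_mono[OF s \<open>c \<ge> 0\<close>] by (simp add: distrib_left)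
    then show "c * (\<Sum>n<k. singular_values T n) \<le> (\<Sum>n<k. b n) + \<epsilon>"
      using le[OF U x] \<delta>(2) by linarith
  qed
  ultimately show ?thesis
    by (simp add: submajorized_def sum_distrib_left)
qed

lemma le_of_le_add_small_multiple:
  fixes a b d :: real
  assumes "\<And>\<delta>. \<delta> > 0 \<Longrightarrow> a \<le> b + \<delta> * d" "d \<ge> 0"
  shows "a \<le> b"
proof (rule field_le_epsilon)
  fix \<epsilon> :: real assume "\<epsilon> > 0"
  have "\<epsilon> / (d + 1) > 0" "\<epsilon> / (d + 1) * d \<le> \<epsilon>"
    using \<open>d \<ge> 0\<close> \<open>\<epsilon> > 0\<close> by (auto simp: field_simps)
  then show "a \<le> b + \<epsilon>"
    using assms(1)[of "\<epsilon> / (d + 1)"] by linarith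
qed

lemma spectral_spread_nonneg:
  fixes A :: "'a::complex_inner \<Rightarrow> 'a"
  assumes "bounded_clinear A" "inf_dim TYPE('a)"
  shows "0 \<le> spectral_spread A n"
  using lower_scale_le_upper_scale[OF assms, of n n] by (simp add: spectral_spread_eq)

lemma spectral_spread_antimono:
  fixes A :: "'a::complex_inner \<Rightarrow> 'a"
  assumes "bounded_clinear A" "inf_dim TYPE('a)" "i \<le> j"
  shows "spectral_spread A j \<le> spectral_spread A i"
  using upper_scale_antimono[OF assms] lower_scale_mono[OF assms] by (simp add: spectral_spread_eq diff_mono)

section \<open>Spread inequalities\<close>

lemma norm_add_diff_orthogonal:
  fixes a b :: "'a::real_inner"
  assumes "inner a b = 0"
  shows "(norm (a + b))\<^sup>2 = (norm a)\<^sup>2 + (norm b)\<^sup>2" "(norm (a - b))\<^sup>2 = (norm a)\<^sup>2 + (norm b)\<^sup>2"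
  using assms by (simp_all add: power2_norm_eq_inner inner_add_left inner_add_right inner_diff_left
      inner_diff_right inner_commute)

text \<open>\<open>plus\<close> and \<open>minus\<close> say that \<open>W\<close> and
  \<open>V\<close> are contractions. In the first alternative of \<open>balanced\<close>, Pythagoras
  makes their norms equal at each vector; only the real inner product has to vanish, which admits
  skew pairs.\<close>

lemma sum_form_le_spread:
  fixes E :: "'a::complex_inner \<Rightarrow> 'a" and A B :: "'b::complex_inner \<Rightarrow> 'a"
  assumes E: "selfadjoint E" and inf: "inf_dim TYPE('a)" and x: "orthonormal k x"
    and A: "bounded_clinear A" and B: "bounded_clinear B"
    and plus: "\<And>x. (norm (A x + B x))\<^sup>2 \<le> 2 * (norm x)\<^sup>2"
    and minus: "\<And>x. (norm (A x - B x))\<^sup>2 \<le> 2 * (norm x)\<^sup>2"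
    and balanced: "(\<forall>x. inner (A x) (B x) = 0) \<or> (\<forall>n. lower_scale E n \<le> 0 \<and> 0 \<le> upper_scale E n)"
  shows "(\<Sum>j<k. 2 * inner (E (A (x j))) (B (x j))) \<le> (\<Sum>j<k. spectral_spread E j)"
proof -
  have Eb: "bounded_clinear E" by (rule selfadjoint_bounded[OF E])
  define W where "W x = (1 / sqrt 2) *\<^sub>R (A x + B x)" for x
  define V where "V x = (1 / sqrt 2) *\<^sub>R (A x - B x)" for x
  have W2: "(norm (W x))\<^sup>2 = (norm (A x + B x))\<^sup>2 / 2" and V2: "(norm (V x))\<^sup>2 = (norm (A x - B x))\<^sup>2 / 2" for x
    by (simp_all add: W_def V_def power_divide)
  have "(norm (W x))\<^sup>2 \<le> (norm x)\<^sup>2" "(norm (V x))\<^sup>2 \<le> (norm x)\<^sup>2" for x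
    using plus[of x] minus[of x] unfolding W2 V2 by simp_all
  then have "norm (W x) \<le> norm x" "norm (V x) \<le> norm x" for x
    by (auto dest: power2_le_imp_le)
  moreover have "bounded_clinear W" "bounded_clinear V"
    unfolding W_def V_def by (intro bclin_intro A B)+
  ultimately have WV: "contraction W" "contraction V"
    by (simp_all add: contraction_def)
  have "norm (W x) = norm (V x)" if "inner (A x) (B x) = 0" for x
  proof (rule power2_eq_imp_eq)
    show "(norm (W x))\<^sup>2 = (norm (V x))\<^sup>2"
      unfolding W2 V2 norm_add_diff_orthogonal[OF that] ..
  qed auto
  then have bal: "(\<forall>x. norm (W x) = norm (V x)) \<or> (\<forall>n. lower_scale E n \<le> 0 \<and> 0 \<le> upper_scale E n)"
    using balanced by blast
  have "2 * inner (E (A x)) (B x) = inner (E (W x)) (W x) - inner (E (V x)) (V x)" for x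
    using selfadjoint_inner[OF E, of "B x" "A x"]
    by (simp add: W_def V_def bounded_clinear_simps Eb inner_add_left inner_add_right
        inner_diff_left inner_diff_right inner_commute field_simps)
  then show ?thesis
    using ky_fan_spread[OF E inf x WV bal] by simp
qed

text \<open>On the direct sum \<open>(A x, x)\<close> is paired with \<open>(B x, - C x)\<close>.
  The hypothesis \<open>dual\<close> is exactly their orthogonality, and the two factors
  \<open>1 / sqrt 2\<close> cancel the \<open>2\<close> in
  \<open>sum_form_le_spread\<close>.\<close>

lemma sum_block_form_le_spread:
  fixes E F :: "'a::complex_inner \<Rightarrow> 'a" and A B C :: "'a \<Rightarrow> 'a"
  assumes E: "selfadjoint E" and F: "selfadjoint F" and inf: "inf_dim TYPE('a)" and x: "orthonormal k x"
    and A: "contraction A" and B: "contraction B" and C: "contraction C"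
    and dual: "\<And>x. inner (A x) (B x) = inner x (C x)"
  shows "(\<Sum>j<k. inner (E (A (x j))) (B (x j)) - inner (F (x j)) (C (x j)))
    \<le> (\<Sum>j<k. spectral_spread (E \<oplus> F) j)"
proof -
  have Eb: "bounded_clinear E" and Fb: "bounded_clinear F"
    using E F by (auto intro: selfadjoint_bounded)
  note b = contraction_bounded[OF A] contraction_bounded[OF B] contraction_bounded[OF C]
  define A' where "A' x = (1 / sqrt 2) *\<^sub>R (A x, x)" for x
  define B' where "B' x = (1 / sqrt 2) *\<^sub>R (B x, - C x)" for x
  have orth: "inner (A' x) (B' x) = 0" for x
    by (simp add: A'_def B'_def dual)
  have A'b: "bounded_clinear A'" and B'b: "bounded_clinear B'"
    unfolding A'_def B'_def by (intro bclin_intro b)+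
  have n: "(norm (A' x))\<^sup>2 + (norm (B' x))\<^sup>2 \<le> 2 * (norm x)\<^sup>2" for x
  proof -
    have "(norm (A x))\<^sup>2 \<le> (norm x)\<^sup>2" "(norm (B x))\<^sup>2 \<le> (norm x)\<^sup>2" "(norm (C x))\<^sup>2 \<le> (norm x)\<^sup>2"
      using A B C by (auto simp: contraction_def intro!: power_mono)
    moreover have "(norm (A' x))\<^sup>2 = (norm (A x))\<^sup>2 / 2 + (norm x)\<^sup>2 / 2"
      "(norm (B' x))\<^sup>2 = (norm (B x))\<^sup>2 / 2 + (norm (C x))\<^sup>2 / 2"
      by (simp_all add: A'_def B'_def norm_Pair power_mult_distrib power_divide)
    ultimately show ?thesis
      using zero_le_power2[of "norm x"] by linarith
  qed
  have pm: "(norm (A' x + B' x))\<^sup>2 \<le> 2 * (norm x)\<^sup>2" "(norm (A' x - B' x))\<^sup>2 \<le> 2 * (norm x)\<^sup>2" for x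
    using n[of x] norm_add_diff_orthogonal[OF orth[of x]] by linarith+
  have "2 * inner ((E \<oplus> F) (A' x)) (B' x) = inner (E (A x)) (B x) - inner (F x) (C x)" for x
    by (simp add: A'_def B'_def Eb Fb bounded_clinear_simps)
  then show ?thesis
    using sum_form_le_spread[OF selfadjoint_block_diag[OF E F] inf_dim_prod[OF inf] x A'b B'b pm] orth by simp
qed

text \<open>With the contraction \<open>A = Y / m\<close>, moving \<open>A\<close> across the inner
  product turns the tested commutator into a block form whose third contraction is
  \<open>cadjoint A\<close> after \<open>U\<close>.\<close>

lemma sum_commutator_le_spread:
  fixes E F Y U :: "'a::chilbert_space \<Rightarrow> 'a"
  assumes E: "selfadjoint E" and F: "selfadjoint F" and inf: "inf_dim TYPE('a)" and x: "orthonormal k x"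
    and U: "contraction U" and Y: "bounded_clinear Y" "\<And>x. norm (Y x) \<le> m * norm x" and "m > 0"
  shows "(\<Sum>i<k. inner (E (Y (x i)) - Y (F (x i))) (U (x i))) \<le> m * (\<Sum>i<k. spectral_spread (E \<oplus> F) i)"
proof -
  have Eb: "bounded_clinear E" by (rule selfadjoint_bounded[OF E])
  define A where "A x = (1 / m) *\<^sub>R Y x" for x
  have A: "contraction A"
    unfolding contraction_def
  proof
    show "bounded_clinear A"
      unfolding A_def by (intro bclin_intro Y(1))
    show "\<forall>x. norm (A x) \<le> norm x"
      using Y(2) \<open>m > 0\<close> by (simp add: A_def pos_divide_le_eq mult.commute)
  qed
  note Ab = contraction_bounded[OF A]
  have "norm (cadjoint A (U x)) \<le> norm x" for x
    using contraction_norm_le[OF contraction_cadjoint[OF A], of "U x"] contraction_norm_le[OF U, of x]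
    by linarith
  then have C: "contraction (\<lambda>x. cadjoint A (U x))"
    using bounded_clinear_compose[OF bounded_clinear_cadjoint[OF Ab] contraction_bounded[OF U]]
    by (simp add: contraction_def)
  have YA: "Y x = m *\<^sub>R A x" for x
    using \<open>m > 0\<close> by (simp add: A_def)
  have "inner (E (Y x) - Y (F x)) (U x) = m * (inner (E (A x)) (U x) - inner (F x) (cadjoint A (U x)))" for x
    unfolding YA cadjoint_inner[OF Ab, symmetric]
    by (simp add: bounded_clinear_scaleR_eq[OF Eb] inner_diff_left right_diff_distrib)
  then have "(\<Sum>i<k. inner (E (Y (x i)) - Y (F (x i))) (U (x i)))
      = m * (\<Sum>i<k. inner (E (A (x i))) (U (x i)) - inner (F (x i)) (cadjoint A (U (x i))))"
    by (simp add: sum_distrib_left)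
  also have "\<dots> \<le> m * (\<Sum>i<k. spectral_spread (E \<oplus> F) i)"
    using \<open>m > 0\<close> cadjoint_inner[OF Ab]
    by (intro mult_left_mono sum_block_form_le_spread[OF E F inf x A U C]) auto
  finally show ?thesis .
qed

section \<open>Exchanging test vectors and layers\<close>

lemma cinner_rank_one_sum_one:
  "cinner y (rank_one_sum k (\<lambda>_. 1) x u z) = (\<Sum>i<k. cnj (cinner z (x i)) * cinner y (u i))"
  by (simp add: rank_one_sum_def cinner_sum_right cinner_scaleC_right)

lemma inner_rank_one_sum_swap:
  "inner y (rank_one_sum k (\<lambda>_. 1) x u z) = inner z (rank_one_sum k (\<lambda>_. 1) u x y)"
proof -
  have "cinner y (rank_one_sum k (\<lambda>_. 1) x u z) = cnj (cinner z (rank_one_sum k (\<lambda>_. 1) u x y))"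
    by (simp add: cinner_rank_one_sum_one mult.commute)
  then show ?thesis
    by (simp add: inner_eq_Re_cinner)
qed

text \<open>The first operator is \<open>U\<close> after the projection onto the span of
  \<open>x\<close>. The second is its adjoint, and its bound is the Bessel inequality for the
  \<open>U (x i)\<close>.\<close>

lemma contraction_rank_one_sums:
  assumes U: "contraction U" and x: "orthonormal k x"
  shows "contraction (rank_one_sum k (\<lambda>_. 1) x (\<lambda>i. U (x i)))"
    and "contraction (rank_one_sum k (\<lambda>_. 1) (\<lambda>i. U (x i)) x)"
proof -
  have "norm (rank_one_sum k (\<lambda>_. 1) x (\<lambda>i. U (x i)) z) \<le> norm z" for z
  proof -
    have "rank_one_sum k (\<lambda>_. 1) x (\<lambda>i. U (x i)) z = U (\<Sum>i<k. cinner z (x i) *\<^sub>C x i)"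
      using contraction_bounded[OF U]
      by (simp add: rank_one_sum_def bounded_clinear_sum_eq bounded_clinear_simps)
    moreover have "norm (\<Sum>i<k. cinner z (x i) *\<^sub>C x i) \<le> norm z"
      by (rule power2_le_imp_le) (simp_all add: norm_sum_orthonormal[OF x] bessel_orthonormal[OF x])
    ultimately show ?thesis
      using contraction_norm_le[OF U, of "\<Sum>i<k. cinner z (x i) *\<^sub>C x i"] by simp
  qed
  then show "contraction (rank_one_sum k (\<lambda>_. 1) x (\<lambda>i. U (x i)))"
    by (simp add: contraction_def bounded_clinear_rank_one_sum)
  have "norm (rank_one_sum k (\<lambda>_. 1) (\<lambda>i. U (x i)) x y) \<le> norm y" for y
    by (rule power2_le_imp_le)
      (use bessel_contraction[OF U x] in \<open>simp_all add: rank_one_sum_def norm_sum_orthonormal[OF x] bessel_def\<close>)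
  then show "contraction (rank_one_sum k (\<lambda>_. 1) (\<lambda>i. U (x i)) x)"
    by (simp add: contraction_def bounded_clinear_rank_one_sum)
qed

text \<open>A trace identity that interchanges the sum over the test pairs with the sum over the
  layers. Afterwards the \<open>f j\<close> act as test vectors and the pairs have become two
  mutually adjoint operators, so partial sums over the layers are open to spread estimates.\<close>

lemma commutator_rank_one_sum:
  assumes E: "bounded_clinear E" and F: "selfadjoint F"
  shows "(\<Sum>i<k. inner (E (rank_one_sum m a f g (x i)) - rank_one_sum m a f g (F (x i))) (u i))
    = (\<Sum>j<m. a j * (inner (E (g j)) (rank_one_sum k (\<lambda>_. 1) x u (f j))
        - inner (F (f j)) (rank_one_sum k (\<lambda>_. 1) u x (g j))))"
proof -
  have 1: "inner (E (rank_one_sum m a f g z) - rank_one_sum m a f g (F z)) w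
      = (\<Sum>j<m. a j * Re (cinner z (f j) * cinner (E (g j)) w - cinner z (F (f j)) * cinner (g j) w))" for z w
    unfolding rank_one_sum_def bounded_clinear_sum_eq[OF E] sum_subtractf[symmetric] inner_sum_left
    by (rule sum.cong)
      (simp_all add: inner_eq_Re_cinner cinner_simps bounded_clinear_simps E selfadjoint_cinner[OF F] algebra_simps)
  have 2: "inner (E (g j)) (rank_one_sum k (\<lambda>_. 1) x u (f j))
      = (\<Sum>i<k. Re (cinner (x i) (f j) * cinner (E (g j)) (u i)))" for j
    unfolding inner_eq_Re_cinner cinner_rank_one_sum_one Re_sum
    by (rule sum.cong) (simp_all only: cinner_commute[of "x _", symmetric])
  have 3: "inner (F (f j)) (rank_one_sum k (\<lambda>_. 1) u x (g j))
      = (\<Sum>i<k. Re (cinner (x i) (F (f j)) * cinner (g j) (u i)))" for j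
    unfolding inner_eq_Re_cinner cinner_rank_one_sum_one Re_sum
    by (rule sum.cong) (simp_all add: cinner_commute[of "x _" "F (f j)"])
  show ?thesis
    unfolding 1 2 3 sum_subtractf[symmetric] sum_distrib_left
    by (subst sum.swap) (simp add: right_diff_distrib)
qed

section \<open>Estimates with a single spread on the right\<close>

lemma selfadjoint_projection_norm:
  assumes P: "selfadjoint P" "P = P \<circ> P"
  shows "inner (x - P x) (P y) = 0" "norm (P x) \<le> norm x" "norm (x - P x) \<le> norm x"
proof -
  have PP: "P (P x) = P x" for x
    using P(2) by (metis comp_apply)
  show *: "inner (x - P x) (P y) = 0" for x y
    using selfadjoint_inner[OF P(1), of "x - P x" y] PP selfadjoint_bounded[OF P(1)]
    by (simp add: bounded_clinear_simps)
  have "(norm x)\<^sup>2 = (norm (x - P x))\<^sup>2 + (norm (P x))\<^sup>2"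
    using norm_add_Pythagorean[of "x - P x" "P x"] *[of x x] by (simp add: orthogonal_def)
  then have "(norm (P x))\<^sup>2 \<le> (norm x)\<^sup>2" "(norm (x - P x))\<^sup>2 \<le> (norm x)\<^sup>2"
    by simp_all
  then show "norm (P x) \<le> norm x" "norm (x - P x) \<le> norm x"
    by (auto dest: power2_le_imp_le)
qed

text \<open>The pair is \<open>A x = x - P x\<close> and \<open>B x = P (U x)\<close>; their values
  lie in the kernel and the range of \<open>P\<close>, hence are orthogonal.\<close>

lemma singular_values_off_diagonal_submajorized:
  fixes E P :: "'a::chilbert_space \<Rightarrow> 'a"
  assumes inf: "inf_dim TYPE('a)" and E: "selfadjoint E" and P: "selfadjoint P" "P = P \<circ> P"
  shows "(\<lambda>n. 2 * singular_values (P \<circ> E \<circ> (\<lambda>x. x - P x)) n) \<prec>\<^sub>w spectral_spread E"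
proof -
  define T where "T = P \<circ> E \<circ> (\<lambda>x. x - P x)"
  have Eb: "bounded_clinear E" and Pb: "bounded_clinear P"
    using E P by (auto intro: selfadjoint_bounded)
  have Qb: "bounded_clinear (\<lambda>x. x - P x)"
    by (intro bclin_intro Pb)
  have T: "bounded_clinear T"
    unfolding T_def comp_def
    by (rule bounded_clinear_compose[OF Pb bounded_clinear_compose[OF Eb Qb]])
  note proj = selfadjoint_projection_norm[OF P]
  show ?thesis
    unfolding T_def[symmetric]
  proof (rule singular_values_submajorizedI[OF T inf])
    fix k and x :: "nat \<Rightarrow> 'a" and U :: "'a \<Rightarrow> 'a" assume U: "contraction U" and x: "orthonormal k x"
    have PUb: "bounded_clinear (\<lambda>x. P (U x))"
      by (rule bounded_clinear_compose[OF Pb contraction_bounded[OF U]])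
    have n: "(norm (x - P x))\<^sup>2 + (norm (P (U x)))\<^sup>2 \<le> 2 * (norm x)\<^sup>2" for x
      using power_mono[OF proj(3)[of x], of 2] power_mono[OF order_trans[OF proj(2)[of "U x"] contraction_norm_le[OF U]], of 2]
        norm_ge_zero[of "x - P x"] norm_ge_zero[of "P (U x)"] by linarith
    have pm: "(norm ((x - P x) + P (U x)))\<^sup>2 \<le> 2 * (norm x)\<^sup>2" "(norm ((x - P x) - P (U x)))\<^sup>2 \<le> 2 * (norm x)\<^sup>2" for x
      using n[of x] norm_add_diff_orthogonal[OF proj(1)[of x "U x"]] by linarith+
    have "inner (T x) (U x) = inner (E (x - P x)) (P (U x))" for x
      by (simp add: T_def selfadjoint_inner[OF P(1)])
    moreover have "(\<Sum>j<k. 2 * inner (E (x j - P (x j))) (P (U (x j)))) \<le> (\<Sum>j<k. spectral_spread E j)"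
      by (rule sum_form_le_spread[OF E inf x Qb PUb pm]) (use proj(1) in blast)
    ultimately show "2 * (\<Sum>i<k. inner (T (x i)) (U (x i))) \<le> (\<Sum>n<k. spectral_spread E n)"
      by (simp add: sum_distrib_left)
  qed (use spectral_spread_nonneg[OF Eb inf] spectral_spread_antimono[OF Eb inf] in auto)
qed

text \<open>The case \<open>Y = (\<lambda>x. x)\<close>, \<open>m = 1\<close> of
  \<open>sum_commutator_le_spread\<close>.\<close>

lemma singular_values_difference_submajorized:
  fixes E F :: "'a::chilbert_space \<Rightarrow> 'a"
  assumes inf: "inf_dim TYPE('a)" and E: "selfadjoint E" and F: "selfadjoint F"
  shows "singular_values (\<lambda>x. E x - F x) \<prec>\<^sub>w spectral_spread (E \<oplus> F)"
proof -
  define T where "T x = E x - F x" for x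
  have EFb: "bounded_clinear (E \<oplus> F)"
    by (rule selfadjoint_bounded[OF selfadjoint_block_diag[OF E F]])
  have T: "bounded_clinear T"
    unfolding T_def using E F by (intro bclin_intro)
  note inf2 = inf_dim_prod[OF inf, where 'b = 'a]
  have "(\<lambda>n. 1 * singular_values T n) \<prec>\<^sub>w spectral_spread (E \<oplus> F)"
  proof (rule singular_values_submajorizedI[OF T inf])
    fix k and x :: "nat \<Rightarrow> 'a" and U :: "'a \<Rightarrow> 'a" assume U: "contraction U" and x: "orthonormal k x"
    have "(\<Sum>i<k. inner (E (x i) - F (x i)) (U (x i))) \<le> 1 * (\<Sum>i<k. spectral_spread (E \<oplus> F) i)"
      by (rule sum_commutator_le_spread[OF E F inf x U bounded_clinear_ident]) auto
    then show "1 * (\<Sum>i<k. inner (T (x i)) (U (x i))) \<le> (\<Sum>n<k. spectral_spread (E \<oplus> F) n)"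
      by (simp add: T_def)
  qed (use spectral_spread_nonneg[OF EFb inf2] spectral_spread_antimono[OF EFb inf2] in auto)
  then show ?thesis
    by (simp add: T_def[abs_def])
qed

text \<open>The operator vanishes on an infinite-dimensional summand, so \<open>0\<close> lies
  between the two scales at every index. This supplies the second alternative of
  \<open>balanced\<close>.\<close>

lemma block_zero_scales:
  fixes E :: "'a::complex_inner \<Rightarrow> 'a"
  assumes inf: "inf_dim TYPE('a)" and E: "selfadjoint E"
  shows "lower_scale (E \<oplus> (\<lambda>_::'a. 0)) n \<le> 0 \<and> 0 \<le> upper_scale (E \<oplus> (\<lambda>_::'a. 0)) n"
proof -
  let ?A = "E \<oplus> (\<lambda>_::'a. 0 :: 'a)"
  have "selfadjoint (\<lambda>_::'a. 0 :: 'a)"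
    by (simp add: selfadjoint_def bounded_clinear_zero)
  then have Ab: "bounded_clinear ?A"
    by (intro selfadjoint_bounded selfadjoint_block_diag E)
  obtain y :: "nat \<Rightarrow> 'a" where "orthonormal (Suc n) y"
    using inf by (auto simp: inf_dim_def)
  then have x: "orthonormal (Suc n) (\<lambda>i. (0 :: 'a, y i))"
    by (simp add: orthonormal_def cinner_prod_def)
  note inf2 = inf_dim_prod[OF inf, where 'b = 'a]
  have E0: "E 0 = 0"
    using E by (intro bounded_clinear_zero_eq selfadjoint_bounded)
  have fst0: "fst (\<Sum>i<Suc n. c i *\<^sub>C (0 :: 'a, y i)) = 0" for c
    by (simp add: fst_sum scaleC_prod_def del: sum.lessThan_Suc)
  have "0 \<le> upper_scale ?A n" "0 \<le> upper_scale (\<lambda>x. - ?A x) n"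
    using upper_scale_ge_orthonormal[OF Ab inf2 x, of 0]
      upper_scale_ge_orthonormal[OF bounded_clinear_minus[OF Ab] inf2 x, of 0]
    by (simp_all add: map_prod_def case_prod_beta inner_prod_def fst0 E0 del: sum.lessThan_Suc)
  then show ?thesis
    by (simp add: lower_scale_uminus)
qed

text \<open>The vectors \<open>cadjoint C x\<close> and \<open>cadjoint S (U x)\<close> need not be
  orthogonal, so the masses of \<open>W\<close> and \<open>V\<close> can differ. The zero block
  compensates, by \<open>block_zero_scales\<close>.\<close>

lemma singular_values_compression_submajorized:
  fixes C S E :: "'a::chilbert_space \<Rightarrow> 'a"
  assumes inf: "inf_dim TYPE('a)" and C: "bounded_clinear C" and S: "bounded_clinear S"
    and CS: "\<And>x. cadjoint C (C x) + cadjoint S (S x) = x" and E: "selfadjoint E"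
  shows "(\<lambda>n. 2 * singular_values (S \<circ> E \<circ> cadjoint C) n) \<prec>\<^sub>w spectral_spread (E \<oplus> (\<lambda>_ :: 'a. 0 :: 'a))"
proof -
  define T where "T = S \<circ> E \<circ> cadjoint C"
  let ?E0 = "E \<oplus> (\<lambda>_ :: 'a. 0 :: 'a)"
  have Eb: "bounded_clinear E" by (rule selfadjoint_bounded[OF E])
  have T: "bounded_clinear T"
    unfolding T_def comp_def
    by (rule bounded_clinear_compose[OF S bounded_clinear_compose[OF Eb bounded_clinear_cadjoint[OF C]]])
  have E0: "selfadjoint ?E0"
    by (rule selfadjoint_block_diag[OF E]) (simp add: selfadjoint_def bounded_clinear_zero)
  note E0b = selfadjoint_bounded[OF E0]
  note inf2 = inf_dim_prod[OF inf, where 'b = 'a]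
  \<comment> \<open>The column formed by \<open>C\<close> and \<open>S\<close> is an isometry, so
    the row formed by their adjoints is a contraction.\<close>
  have row: "(norm (cadjoint C a + cadjoint S b))\<^sup>2 \<le> (norm a)\<^sup>2 + (norm b)\<^sup>2" for a b
  proof -
    define w where "w = cadjoint C a + cadjoint S b"
    have "(norm w)\<^sup>2 = inner w (cadjoint C (C w)) + inner w (cadjoint S (S w))"
      using CS[of w] by (simp add: power2_norm_eq_inner flip: inner_add_right)
    then have 1: "(norm w)\<^sup>2 = (norm (C w))\<^sup>2 + (norm (S w))\<^sup>2"
      by (simp add: cadjoint_inner[OF C, symmetric] cadjoint_inner[OF S, symmetric] power2_norm_eq_inner)
    have "(norm w)\<^sup>2 = inner w (cadjoint C a) + inner w (cadjoint S b)"
      by (simp add: power2_norm_eq_inner w_def inner_add_right inner_add_left)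
    then have 2: "(norm w)\<^sup>2 = inner (C w) a + inner (S w) b"
      by (simp add: cadjoint_inner[OF C] cadjoint_inner[OF S])
    have "2 * inner u v \<le> (norm u)\<^sup>2 + (norm v)\<^sup>2" for u v :: 'a
      using zero_le_power2[of "norm (u - v)"]
      by (simp add: power2_norm_eq_inner inner_diff_left inner_diff_right inner_commute)
    from this[of "C w" a] this[of "S w" b] show ?thesis
      unfolding w_def[symmetric] using 1 2 by linarith
  qed
  have "(\<lambda>n. 2 * singular_values T n) \<prec>\<^sub>w spectral_spread ?E0"
  proof (rule singular_values_submajorizedI[OF T inf])
    fix k and x :: "nat \<Rightarrow> 'a" and U :: "'a \<Rightarrow> 'a" assume U: "contraction U" and x: "orthonormal k x"
    define A where "A x = (cadjoint C x, 0 :: 'a)" for x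
    define B where "B x = (cadjoint S (U x), 0 :: 'a)" for x
    have SUb: "bounded_clinear (\<lambda>x. cadjoint S (U x))"
      by (rule bounded_clinear_compose[OF bounded_clinear_cadjoint[OF S] contraction_bounded[OF U]])
    have Ab: "bounded_clinear A"
      unfolding A_def by (rule bounded_clinear_Pair[OF bounded_clinear_cadjoint[OF C] bounded_clinear_zero])
    have Bb: "bounded_clinear B"
      unfolding B_def by (rule bounded_clinear_Pair[OF SUb bounded_clinear_zero])
    have UU: "(norm (U x))\<^sup>2 \<le> (norm x)\<^sup>2" for x
      using contraction_norm_le[OF U] by (intro power_mono) auto
    have pm: "(norm (A x + B x))\<^sup>2 \<le> 2 * (norm x)\<^sup>2" "(norm (A x - B x))\<^sup>2 \<le> 2 * (norm x)\<^sup>2" for x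
    proof -
      have eq: "norm (A x + B x) = norm (cadjoint C x + cadjoint S (U x))"
        "norm (A x - B x) = norm (cadjoint C x + cadjoint S (- U x))"
        using bounded_clinear_cadjoint[OF S] by (simp_all add: A_def B_def norm_Pair bounded_clinear_minus_eq)
      show "(norm (A x + B x))\<^sup>2 \<le> 2 * (norm x)\<^sup>2" "(norm (A x - B x))\<^sup>2 \<le> 2 * (norm x)\<^sup>2"
        unfolding eq using row[of x "U x"] row[of x "- U x"] UU[of x] unfolding norm_minus_cancel
        by linarith+
    qed
    have "2 * inner (T x) (U x) = 2 * inner (?E0 (A x)) (B x)" for x
      by (simp add: T_def A_def B_def cadjoint_inner[OF S])
    moreover have "(\<Sum>j<k. 2 * inner (?E0 (A (x j))) (B (x j))) \<le> (\<Sum>j<k. spectral_spread ?E0 j)"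
      by (rule sum_form_le_spread[OF E0 inf2 x Ab Bb pm]) (use block_zero_scales[OF inf E] in blast)
    ultimately show "2 * (\<Sum>i<k. inner (T (x i)) (U (x i))) \<le> (\<Sum>n<k. spectral_spread ?E0 n)"
      by (simp add: sum_distrib_left)
  qed (use spectral_spread_nonneg[OF E0b inf2] spectral_spread_antimono[OF E0b inf2] in auto)
  then show ?thesis
    by (simp add: T_def)
qed

section \<open>Products on the right: Sylvester operators\<close>

text \<open>The remainder \<open>Y\<close> of \<open>X\<close> costs \<open>s n + \<delta>\<close>
  times the sum of the \<open>d i\<close>, and the layers in \<open>L\<close> cost the sum of
  \<open>(s j - s n) * d j\<close>. Together these give the products \<open>d i * s i\<close> and
  the error term.\<close>

lemma sylvester_sum_le:
  fixes E F X U :: "'a::chilbert_space \<Rightarrow> 'a"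
  assumes inf: "inf_dim TYPE('a)" and E: "selfadjoint E" and F: "selfadjoint F" and X: "bounded_clinear X"
    and U: "contraction U" and x: "orthonormal (Suc n) x" and "\<delta> > 0"
  shows "(\<Sum>i<Suc n. inner (E (X (x i)) - X (F (x i))) (U (x i)))
    \<le> (\<Sum>i<Suc n. spectral_spread (E \<oplus> F) i * singular_values X i) + \<delta> * (\<Sum>i<Suc n. spectral_spread (E \<oplus> F) i)"
proof -
  define s where "s = singular_values X"
  define d where "d = spectral_spread (E \<oplus> F)"
  have Eb: "bounded_clinear E" by (rule selfadjoint_bounded[OF E])
  obtain f and V :: "'a \<Rightarrow> 'a" where f: "orthonormal (Suc n) f" and V: "contraction V" and
    rem: "\<And>x. norm (X x - rank_one_sum (Suc n) (\<lambda>j. singular_values X j - singular_values X n) f (\<lambda>j. V (f j)) x)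
      \<le> (singular_values X n + \<delta>) * norm x"
    by (rule singular_value_remainder[OF X inf \<open>\<delta> > 0\<close>, of n]) (rule that; assumption)
  note rem = rem[folded s_def]
  define L where "L = rank_one_sum (Suc n) (\<lambda>j. s j - s n) f (\<lambda>j. V (f j))"
  define Y where "Y x = X x - L x" for x
  have Lb: "bounded_clinear L"
    unfolding L_def by (rule bounded_clinear_rank_one_sum)
  have Yb: "bounded_clinear Y"
    unfolding Y_def by (intro bclin_intro X Lb)
  have "s n + \<delta> > 0"
    using singular_values_nonneg[OF X inf, of n] \<open>\<delta> > 0\<close> by (simp add: s_def)
  then have Y: "(\<Sum>i<Suc n. inner (E (Y (x i)) - Y (F (x i))) (U (x i))) \<le> (s n + \<delta>) * (\<Sum>i<Suc n. d i)"
    unfolding d_def by (intro sum_commutator_le_spread[OF E F inf x U Yb]) (use rem in \<open>simp_all add: Y_def L_def\<close>)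
  define Zs where "Zs = rank_one_sum (Suc n) (\<lambda>_. 1) x (\<lambda>i. U (x i))"
  define Z where "Z = rank_one_sum (Suc n) (\<lambda>_. 1) (\<lambda>i. U (x i)) x"
  have Zs: "contraction Zs" and Z: "contraction Z"
    unfolding Zs_def Z_def by (rule contraction_rank_one_sums[OF U x])+
  have "norm (Z (V x)) \<le> norm x" for x
    using contraction_norm_le[OF Z, of "V x"] contraction_norm_le[OF V, of x] by linarith
  then have ZV: "contraction (\<lambda>x. Z (V x))"
    using bounded_clinear_compose[OF contraction_bounded[OF Z] contraction_bounded[OF V]]
    by (simp add: contraction_def)
  have dual: "inner (V y) (Zs y) = inner y (Z (V y))" for y
    unfolding Zs_def Z_def by (rule inner_rank_one_sum_swap)
  have "(\<Sum>i<Suc n. inner (E (L (x i)) - L (F (x i))) (U (x i)))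
      = (\<Sum>j<Suc n. (s j - s n) * (inner (E (V (f j))) (Zs (f j)) - inner (F (f j)) (Z (V (f j)))))"
    unfolding L_def Zs_def Z_def by (rule commutator_rank_one_sum[OF Eb F])
  also have "\<dots> \<le> (\<Sum>j<Suc n. (s j - s n) * d j)"
  \<comment> \<open>Every initial segment of the \<open>f j\<close> is an orthonormal test family,
    so the block estimate with \<open>V\<close>, \<open>Zs\<close> and \<open>Z\<close> after
    \<open>V\<close> bounds each partial sum.\<close>
  proof (rule weighted_sum_mono_of_partial_sums)
    fix m assume "m \<le> Suc n"
    show "(\<Sum>j<m. inner (E (V (f j))) (Zs (f j)) - inner (F (f j)) (Z (V (f j)))) \<le> (\<Sum>j<m. d j)"
      unfolding d_def
      by (rule sum_block_form_le_spread[OF E F inf orthonormal_mono[OF f \<open>m \<le> Suc n\<close>] V Zs ZV dual])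
  qed (use singular_values_antimono[OF X inf] in \<open>auto simp: s_def\<close>)
  finally have L: "(\<Sum>i<Suc n. inner (E (L (x i)) - L (F (x i))) (U (x i))) \<le> (\<Sum>j<Suc n. (s j - s n) * d j)" .
  have "inner (E (X y) - X (F y)) z = inner (E (L y) - L (F y)) z + inner (E (Y y) - Y (F y)) z" for y z
    by (simp add: Y_def bounded_clinear_simps Eb inner_diff_left)
  then have "(\<Sum>i<Suc n. inner (E (X (x i)) - X (F (x i))) (U (x i)))
      \<le> (\<Sum>j<Suc n. (s j - s n) * d j) + (s n + \<delta>) * (\<Sum>i<Suc n. d i)"
    using L Y by (simp only: sum.distrib)
  also have "\<dots> = (\<Sum>i<Suc n. d i * s i) + \<delta> * (\<Sum>i<Suc n. d i)"
    unfolding sum_distrib_left sum.distrib[symmetric] by (rule sum.cong) (simp_all add: algebra_simps)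
  finally show ?thesis
    by (simp add: d_def s_def)
qed

lemma singular_values_sylvester_submajorized:
  fixes E F X :: "'a::chilbert_space \<Rightarrow> 'a"
  assumes inf: "inf_dim TYPE('a)" and E: "selfadjoint E" and F: "selfadjoint F" and X: "bounded_clinear X"
  shows "singular_values (\<lambda>x. E (X x) - X (F x)) \<prec>\<^sub>w (\<lambda>n. spectral_spread (E \<oplus> F) n * singular_values X n)"
proof -
  define T where "T x = E (X x) - X (F x)" for x
  define d where "d = spectral_spread (E \<oplus> F)"
  have Eb: "bounded_clinear E" and Fb: "bounded_clinear F" and EFb: "bounded_clinear (E \<oplus> F)"
    using E F selfadjoint_block_diag[OF E F] by (auto intro: selfadjoint_bounded)
  have T: "bounded_clinear T"
    unfolding T_def
    by (rule bounded_clinear_diff[OF bounded_clinear_compose[OF Eb X] bounded_clinear_compose[OF X Fb]])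
  note inf2 = inf_dim_prod[OF inf, where 'b = 'a]
  note sv = singular_values_nonneg[OF X inf] singular_values_antimono[OF X inf]
  have d: "0 \<le> d i" "i \<le> j \<Longrightarrow> d j \<le> d i" for i j
    unfolding d_def by (rule spectral_spread_nonneg[OF EFb inf2] spectral_spread_antimono[OF EFb inf2])+
  have "(\<lambda>n. 1 * singular_values T n) \<prec>\<^sub>w (\<lambda>n. d n * singular_values X n)"
  proof (rule singular_values_submajorizedI[OF T inf])
    fix k and x :: "nat \<Rightarrow> 'a" and U :: "'a \<Rightarrow> 'a" assume U: "contraction U" and x: "orthonormal k x"
    have "(\<Sum>i<k. inner (T (x i)) (U (x i))) \<le> (\<Sum>n<k. d n * singular_values X n)"
    proof (cases k)
      case (Suc n)
      show ?thesis
        unfolding Suc T_def d_def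
        by (rule le_of_le_add_small_multiple[OF sylvester_sum_le[OF inf E F X U]])
          (use x Suc d(1) in \<open>auto simp: d_def simp del: sum.lessThan_Suc intro!: sum_nonneg\<close>)
    qed simp
    then show "1 * (\<Sum>i<k. inner (T (x i)) (U (x i))) \<le> (\<Sum>n<k. d n * singular_values X n)"
      by simp
  qed (use sv d in \<open>auto intro!: mult_mono\<close>)
  then show ?thesis
    by (simp add: T_def[abs_def] d_def)
qed

section \<open>Products on the right: commutators and doubled spectra\<close>

lemma upper_scale_double:
  fixes E :: "'a::complex_inner \<Rightarrow> 'a"
  assumes inf: "inf_dim TYPE('a)" and E: "selfadjoint E"
  shows "upper_scale E (i div 2) \<le> upper_scale (E \<oplus> E) i"
proof -
  define j where "j = i div 2"
  have EEb: "bounded_clinear (E \<oplus> E)"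
    by (rule selfadjoint_bounded[OF selfadjoint_block_diag[OF E E]])
  note inf2 = inf_dim_prod[OF inf, where 'b = 'a]
  have "upper_scale E j \<le> upper_scale (E \<oplus> E) (Suc (2 * j))"
  proof (rule field_le_epsilon)
    fix \<epsilon> :: real assume "\<epsilon> > 0"
    define N where "N = Suc (Suc (2 * j))"
    define \<delta> where "\<delta> = \<epsilon> / real N"
    have "\<delta> > 0"
      using \<open>\<epsilon> > 0\<close> by (simp add: \<delta>_def N_def)
    obtain x where x: "orthonormal (Suc j) x" "\<And>i. i < Suc j \<Longrightarrow> norm (E (x i) - upper_scale E i *\<^sub>R x i) \<le> \<delta>"
      using approx_eigenvectors[OF E inf \<open>\<delta> > 0\<close>, of "Suc j"] by blast
    \<comment> \<open>Each approximate eigenvector is placed into both summands, which gives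
      \<open>2 * j + 2\<close> orthonormal vectors at levels no lower than
      \<open>upper_scale E j\<close>.\<close>
    define y where "y i = (if even i then (x (i div 2), 0) else (0, x (i div 2)))" for i
    have lt: "i div 2 < Suc j" if "i < N" for i
      using that by (simp add: N_def)
    have eqI: "p = q" if "p div 2 = q div 2" "even p = even q" for p q :: nat
      using that by (metis div_mult_mod_eq even_iff_mod_2_eq_zero odd_iff_mod_2_eq_one)
    have y: "orthonormal N y"
      unfolding orthonormal_def
    proof (intro allI impI)
      fix p q assume "p < N" "q < N"
      then show "cinner (y p) (y q) = (if p = q then 1 else 0)"
        using orthonormalD[OF x(1) lt lt, of p q] eqI[of p q] by (auto simp: y_def cinner_prod_def)
    qed
    have E0: "E 0 = 0"
      using E by (intro bounded_clinear_zero_eq selfadjoint_bounded)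
    have "cmod (cinner ((E \<oplus> E) (y p)) (y q) - (if p = q then complex_of_real (upper_scale E (p div 2)) else 0)) \<le> \<delta>"
      if "p < N" "q < N" for p q
    proof -
      have n1: "norm (y q) = 1"
        by (rule orthonormal_norm[OF y that(2)])
      have "(E \<oplus> E) (y p) - upper_scale E (p div 2) *\<^sub>R y p
          = (if even p then (E (x (p div 2)) - upper_scale E (p div 2) *\<^sub>R x (p div 2), 0)
             else (0, E (x (p div 2)) - upper_scale E (p div 2) *\<^sub>R x (p div 2)))"
        by (simp add: y_def E0)
      then have n2: "norm ((E \<oplus> E) (y p) - upper_scale E (p div 2) *\<^sub>R y p) \<le> \<delta>"
        using x(2)[OF lt[OF that(1)]] by (simp add: norm_Pair)
      have "cinner ((E \<oplus> E) (y p)) (y q) - (if p = q then complex_of_real (upper_scale E (p div 2)) else 0)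
          = cinner ((E \<oplus> E) (y p) - upper_scale E (p div 2) *\<^sub>R y p) (y q)"
        using orthonormalD[OF y that] by (simp add: cinner_diff_left cinner_scaleR_left)
      then show ?thesis
        using cmod_cinner_le[of "(E \<oplus> E) (y p) - upper_scale E (p div 2) *\<^sub>R y p" "y q"] n1 n2 by simp
    qed
    moreover have "upper_scale E j \<le> upper_scale E (p div 2)" if "p < N" for p
      using lt[OF that] by (intro upper_scale_antimono[OF selfadjoint_bounded[OF E] inf]) simp
    ultimately have "upper_scale E j - real N * \<delta> \<le> upper_scale (E \<oplus> E) (Suc (2 * j))"
      using y unfolding N_def
      by (intro upper_scale_ge_orthonormal[OF EEb inf2] form_almost_diagonal[OF EEb, where a = "\<lambda>p. upper_scale E (p div 2)"])
    moreover have "real N * \<delta> = \<epsilon>"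
      by (simp add: \<delta>_def N_def)
    ultimately show "upper_scale E j \<le> upper_scale (E \<oplus> E) (Suc (2 * j)) + \<epsilon>"
      by linarith
  qed
  also have "\<dots> \<le> upper_scale (E \<oplus> E) i"
    by (rule upper_scale_antimono[OF EEb inf2]) (simp add: j_def)
  finally show ?thesis
    by (simp add: j_def)
qed

lemma spectral_spread_double:
  fixes E :: "'a::complex_inner \<Rightarrow> 'a"
  assumes inf: "inf_dim TYPE('a)" and E: "selfadjoint E"
  shows "spectral_spread E (i div 2) \<le> spectral_spread (E \<oplus> E) i"
proof -
  have "(\<lambda>x. - E x) \<oplus> (\<lambda>x. - E x) = (\<lambda>p. - (E \<oplus> E) p)"
    by (auto simp: fun_eq_iff)
  then show ?thesis
    using upper_scale_double[OF inf E, of i] upper_scale_double[OF inf selfadjoint_uminus[OF E], of i]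
    by (simp add: spectral_spread_eq upper_scale_uminus)
qed

text \<open>Both ends of \<open>F\<close> are peeled off:
  \<open>F x = L x - M x + Y x + c *\<^sub>R x\<close>. The scalar \<open>c\<close> commutes with
  \<open>E\<close> and centres the remainder \<open>Y\<close>, whose norm bound is half of
  \<open>spectral_spread F n\<close> plus \<open>\<delta>\<close>. The layers of \<open>L\<close>
  and \<open>M\<close> are charged to the spread of \<open>E\<close> alone.\<close>

lemma commutator_sum_le:
  fixes E F U :: "'a::chilbert_space \<Rightarrow> 'a"
  assumes inf: "inf_dim TYPE('a)" and E: "selfadjoint E" and F: "selfadjoint F"
    and U: "contraction U" and x: "orthonormal k x" and "\<delta> > 0"
  shows "(\<Sum>i<k. inner (E (F (x i)) - F (E (x i))) (U (x i)))
    \<le> (\<Sum>j<Suc n. (spectral_spread F j - spectral_spread F n) * spectral_spread E j)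
      + (spectral_spread F n / 2 + \<delta>) * (\<Sum>i<k. spectral_spread (E \<oplus> E) i)"
proof -
  have Eb: "bounded_clinear E" and Fb: "bounded_clinear F"
    using E F by (auto intro: selfadjoint_bounded)
  define u where "u = upper_scale F"
  define l where "l = lower_scale F"
  define a where "a = spectral_spread E"
  have u: "u j \<le> u i" and l: "l i \<le> l j" if "i \<le> j" for i j
    using upper_scale_antimono[OF Fb inf that] lower_scale_mono[OF Fb inf that] by (auto simp: u_def l_def)
  have lu: "l n \<le> u n"
    using lower_scale_le_upper_scale[OF Fb inf] by (simp add: u_def l_def)
  obtain f g where f: "orthonormal (Suc n) f" and g: "orthonormal (Suc n) g" and
    up: "\<And>\<psi>. scale_remainder F n n f g \<psi> \<le> (u n + \<delta>) * (norm \<psi>)\<^sup>2" and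
    lo: "\<And>\<psi>. (l n - \<delta>) * (norm \<psi>)\<^sup>2 \<le> scale_remainder F n n f g \<psi>"
    using scale_decomposition[OF F inf \<open>\<delta> > 0\<close>, of n n] unfolding u_def l_def by metis
  define L where "L = rank_one_sum (Suc n) (\<lambda>j. u j - u n) f f"
  define M where "M = rank_one_sum (Suc n) (\<lambda>j. l n - l j) g g"
  define c where "c = (u n + l n) / 2"
  define m where "m = (u n - l n) / 2 + \<delta>"
  define Y where "Y x = F x - L x + M x - c *\<^sub>R x" for x
  have Ls: "selfadjoint L" and Ms: "selfadjoint M"
    unfolding L_def M_def by (rule selfadjoint_rank_one_sum)+
  have "selfadjoint (\<lambda>x. c *\<^sub>R x :: 'a)"
    by (simp add: selfadjoint_def bounded_clinear_scaleR bounded_clinear_ident cinner_simps)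
  then have Ys: "selfadjoint Y"
    unfolding Y_def by (intro selfadjoint_diff selfadjoint_add F Ls Ms)
  have "norm (Y x) \<le> m * norm x" for x
  proof (rule norm_le_of_form_bound[OF Ys])
    fix \<psi> :: 'a
    have "inner (Y \<psi>) \<psi> = scale_remainder F n n f g \<psi> - c * (norm \<psi>)\<^sup>2"
      by (simp only: Y_def L_def M_def u_def l_def scale_remainder_def inner_diff_left inner_add_left
        inner_scaleR_left rank_one_sum_form power2_norm_eq_inner)
    moreover have "(u n + \<delta>) * (norm \<psi>)\<^sup>2 - c * (norm \<psi>)\<^sup>2 = m * (norm \<psi>)\<^sup>2"
      "(l n - \<delta>) * (norm \<psi>)\<^sup>2 - c * (norm \<psi>)\<^sup>2 = - (m * (norm \<psi>)\<^sup>2)"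
      by (simp_all add: c_def m_def field_simps)
    ultimately show "\<bar>inner (Y \<psi>) \<psi>\<bar> \<le> m * (norm \<psi>)\<^sup>2"
      using up[of \<psi>] lo[of \<psi>] unfolding abs_le_iff by linarith
  qed
  moreover have "m > 0"
    using lu \<open>\<delta> > 0\<close> unfolding m_def by (intro add_nonneg_pos) auto
  ultimately have Y: "(\<Sum>i<k. inner (E (Y (x i)) - Y (E (x i))) (U (x i))) \<le> m * (\<Sum>i<k. spectral_spread (E \<oplus> E) i)"
    by (intro sum_commutator_le_spread[OF E E inf x U selfadjoint_bounded[OF Ys]])
  define Zs where "Zs = rank_one_sum k (\<lambda>_. 1) x (\<lambda>i. U (x i))"
  define Z where "Z = rank_one_sum k (\<lambda>_. 1) (\<lambda>i. U (x i)) x"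
  have Zs: "contraction Zs" and Z: "contraction Z"
    unfolding Zs_def Z_def by (rule contraction_rank_one_sums[OF U x])+
  \<comment> \<open>\<open>Z\<close> is the adjoint of \<open>Zs\<close>, so \<open>K r\<close> is
    skew and \<open>y\<close> is orthogonal to \<open>K r y\<close> in the real inner product. The
    identity and \<open>K r\<close> thus form an admissible pair on \<open>H\<close> itself. The
    sign \<open>r = - 1\<close> serves the layers of \<open>M\<close>, which enter \<open>F\<close>
    with a minus.\<close>
  define K where "K r x = (r / 2) *\<^sub>R (Zs x - Z x)" for r x
  have Kb: "bounded_clinear (K r)" for r
    unfolding K_def by (intro bclin_intro contraction_bounded Zs Z)
  have "inner y (Zs y) = inner y (Z y)" for y
    unfolding Zs_def Z_def by (rule inner_rank_one_sum_swap)
  then have K0: "inner y (K r y) = 0" for r y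
    by (simp add: K_def inner_diff_right)
  have EK: "2 * inner (E y) (K r z) = r * (inner (E y) (Zs z) - inner (E y) (Z z))" for r y z
    by (simp add: K_def inner_diff_right)
  have Kn: "(norm (K r y))\<^sup>2 \<le> (norm y)\<^sup>2" if "\<bar>r\<bar> = 1" for r y
    using that norm_triangle_ineq4[of "Zs y" "Z y"] contraction_norm_le[OF Zs, of y] contraction_norm_le[OF Z, of y]
    by (intro power_mono) (auto simp: K_def)
  have skew: "(\<Sum>j<p. 2 * inner (E (h j)) (K r (h j))) \<le> (\<Sum>j<p. a j)"
    if h: "orthonormal p h" and r: "\<bar>r\<bar> = 1" for p h r
    unfolding a_def
  proof (rule sum_form_le_spread[OF E inf h bounded_clinear_ident Kb])
    show "(norm (y + K r y))\<^sup>2 \<le> 2 * (norm y)\<^sup>2" "(norm (y - K r y))\<^sup>2 \<le> 2 * (norm y)\<^sup>2" for y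
      using Kn[OF r, of y] norm_add_diff_orthogonal[OF K0[of y r]] by linarith+
  qed (use K0 in simp)
  have "(\<Sum>i<k. inner (E (L (x i)) - L (E (x i))) (U (x i)))
      = (\<Sum>j<Suc n. (u j - u n) * (2 * inner (E (f j)) (K 1 (f j))))"
    unfolding L_def commutator_rank_one_sum[OF Eb E] Zs_def[symmetric] Z_def[symmetric] EK by simp
  also have "\<dots> \<le> (\<Sum>j<Suc n. (u j - u n) * a j)"
    by (rule weighted_sum_mono_of_partial_sums) (auto intro!: skew orthonormal_mono[OF f] u)
  finally have L: "(\<Sum>i<k. inner (E (L (x i)) - L (E (x i))) (U (x i))) \<le> (\<Sum>j<Suc n. (u j - u n) * a j)" .
  have "- (\<Sum>i<k. inner (E (M (x i)) - M (E (x i))) (U (x i)))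
      = (\<Sum>j<Suc n. (l n - l j) * (2 * inner (E (g j)) (K (- 1) (g j))))"
    unfolding M_def commutator_rank_one_sum[OF Eb E] Zs_def[symmetric] Z_def[symmetric] sum_negf[symmetric] EK
    by (rule sum.cong) (simp_all add: algebra_simps)
  also have "\<dots> \<le> (\<Sum>j<Suc n. (l n - l j) * a j)"
    by (rule weighted_sum_mono_of_partial_sums) (auto intro!: skew orthonormal_mono[OF g] l)
  finally have M: "- (\<Sum>i<k. inner (E (M (x i)) - M (E (x i))) (U (x i))) \<le> (\<Sum>j<Suc n. (l n - l j) * a j)" .
  have "inner (E (F y) - F (E y)) z = inner (E (L y) - L (E y)) z - inner (E (M y) - M (E y)) z
      + inner (E (Y y) - Y (E y)) z" for y z
    by (simp add: Y_def bounded_clinear_simps Eb inner_diff_left inner_add_left)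
  then have "(\<Sum>i<k. inner (E (F (x i)) - F (E (x i))) (U (x i)))
      \<le> (\<Sum>j<Suc n. (u j - u n) * a j) + (\<Sum>j<Suc n. (l n - l j) * a j)
        + m * (\<Sum>i<k. spectral_spread (E \<oplus> E) i)"
    using L M Y by (simp add: sum.distrib sum_subtractf del: sum.lessThan_Suc)
  also have "(\<Sum>j<Suc n. (u j - u n) * a j) + (\<Sum>j<Suc n. (l n - l j) * a j)
      = (\<Sum>j<Suc n. (spectral_spread F j - spectral_spread F n) * a j)"
    unfolding sum.distrib[symmetric] by (rule sum.cong) (auto simp: spectral_spread_eq u_def l_def algebra_simps)
  finally show ?thesis
    by (simp add: a_def m_def spectral_spread_eq u_def l_def)
qed

text \<open>Doubling counts every \<open>j < n\<close> twice. The index \<open>n\<close> occurs once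
  or twice according to the parity of \<open>k\<close>, which is harmless since
  \<open>h n = 0\<close>.\<close>

lemma sum_halved_index:
  fixes h :: "nat \<Rightarrow> real"
  assumes "h n = 0" "k = Suc (2 * n) \<or> k = Suc (Suc (2 * n))"
  shows "2 * (\<Sum>j<Suc n. h j) = (\<Sum>i<k. h (i div 2))"
proof -
  have "(\<Sum>i<2 * n. h (i div 2)) = 2 * (\<Sum>j<n. h j)"
    by (induction n) auto
  then show ?thesis
    using assms by auto
qed

lemma singular_values_commutator_submajorized:
  fixes E F :: "'a::chilbert_space \<Rightarrow> 'a"
  assumes inf: "inf_dim TYPE('a)" and E: "selfadjoint E" and F: "selfadjoint F"
  shows "singular_values (\<lambda>x. E (F x) - F (E x)) \<prec>\<^sub>w
    (\<lambda>n. 1 / 2 * (spectral_spread (E \<oplus> E) n * spectral_spread (F \<oplus> F) n))"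
proof -
  define T where "T x = E (F x) - F (E x)" for x
  define a where "a = spectral_spread (E \<oplus> E)"
  define b where "b = spectral_spread (F \<oplus> F)"
  have Eb: "bounded_clinear E" and Fb: "bounded_clinear F"
    and EEb: "bounded_clinear (E \<oplus> E)" and FFb: "bounded_clinear (F \<oplus> F)"
    using E F selfadjoint_block_diag[OF E E] selfadjoint_block_diag[OF F F]
    by (auto intro: selfadjoint_bounded)
  have T: "bounded_clinear T"
    unfolding T_def
    by (rule bounded_clinear_diff[OF bounded_clinear_compose[OF Eb Fb] bounded_clinear_compose[OF Fb Eb]])
  note inf2 = inf_dim_prod[OF inf, where 'b = 'a]
  have ab: "0 \<le> a i" "0 \<le> b i" "i \<le> j \<Longrightarrow> a j \<le> a i" "i \<le> j \<Longrightarrow> b j \<le> b i" for i j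
    unfolding a_def b_def
    by (rule spectral_spread_nonneg[OF EEb inf2] spectral_spread_nonneg[OF FFb inf2]
        spectral_spread_antimono[OF EEb inf2] spectral_spread_antimono[OF FFb inf2]; assumption)+
  have "(\<lambda>n. 1 * singular_values T n) \<prec>\<^sub>w (\<lambda>n. 1 / 2 * (a n * b n))"
  proof (rule singular_values_submajorizedI[OF T inf])
    fix k and x :: "nat \<Rightarrow> 'a" and U :: "'a \<Rightarrow> 'a" assume U: "contraction U" and x: "orthonormal k x"
    have "(\<Sum>i<k. inner (T (x i)) (U (x i))) \<le> (\<Sum>i<k. b i * a i) / 2"
    proof (cases "k = 0")
      case False
      \<comment> \<open>The largest value of \<open>i div 2\<close> for
        \<open>i < k\<close>.\<close>
      define n where "n = (k - 1) div 2"
      have k: "k = Suc (2 * n) \<or> k = Suc (Suc (2 * n))"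
        using False unfolding n_def by presburger
      define D where "D = (\<Sum>i<k. a i)"
      have "D \<ge> 0"
        unfolding D_def using ab(1) by (intro sum_nonneg)
      define p where "p = spectral_spread F"
      define q where "q = spectral_spread E"
      have pn: "p n \<le> p j" if "j \<le> n" for j
        unfolding p_def by (rule spectral_spread_antimono[OF Fb inf that])
      have "(\<Sum>i<k. inner (T (x i)) (U (x i))) \<le> ((\<Sum>j<Suc n. (p j - p n) * q j) + p n / 2 * D) + \<delta> * D"
        if "\<delta> > 0" for \<delta>
        using commutator_sum_le[OF inf E F U x that, of n]
        unfolding T_def p_def q_def D_def a_def by (simp only: distrib_right add.assoc)
      from le_of_le_add_small_multiple[OF this \<open>D \<ge> 0\<close>]
      have "(\<Sum>i<k. inner (T (x i)) (U (x i))) \<le> (\<Sum>j<Suc n. (p j - p n) * q j) + p n / 2 * D" .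
      \<comment> \<open>Index halving brings in the factor 1/2. Once \<open>q (i div 2)\<close> is
        replaced by \<open>a i\<close>, the subtracted terms with \<open>p n\<close> cancel the
        remainder term \<open>p n / 2 * D\<close>.\<close>
      also have "(\<Sum>j<Suc n. (p j - p n) * q j) = (\<Sum>i<k. (p (i div 2) - p n) * q (i div 2)) / 2"
        using sum_halved_index[of "\<lambda>j. (p j - p n) * q j", OF _ k] by simp
      also have "(\<Sum>i<k. (p (i div 2) - p n) * q (i div 2)) \<le> (\<Sum>i<k. (p (i div 2) - p n) * a i)"
      proof (rule sum_mono, rule mult_left_mono)
        fix i assume "i \<in> {..<k}"
        then show "0 \<le> p (i div 2) - p n"
          using k by (auto intro!: pn)
        show "q (i div 2) \<le> a i"
          unfolding q_def a_def by (rule spectral_spread_double[OF inf E])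
      qed
      also have "(\<Sum>i<k. (p (i div 2) - p n) * a i) = (\<Sum>i<k. p (i div 2) * a i) - p n * D"
        by (simp add: D_def left_diff_distrib sum_subtractf sum_distrib_left)
      also have "(\<Sum>i<k. p (i div 2) * a i) \<le> (\<Sum>i<k. b i * a i)"
        unfolding p_def b_def
        by (intro sum_mono mult_right_mono spectral_spread_double[OF inf F] ab(1))
      finally show ?thesis
        by (simp add: field_simps)
    qed simp
    also have "\<dots> = (\<Sum>n<k. 1 / 2 * (a n * b n))"
      by (simp add: sum_divide_distrib mult.commute)
    finally show "1 * (\<Sum>i<k. inner (T (x i)) (U (x i))) \<le> (\<Sum>n<k. 1 / 2 * (a n * b n))"
      by simp
  qed (use ab in \<open>auto intro!: mult_mono\<close>)
  then show ?thesis
    by (simp add: T_def[abs_def] a_def b_def)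
qed

theorem theorem5p13:
  assumes separable: "separable_space (euclidean :: 'h::chilbert_space topology)"
    and infinite_dimensional: "\<not> (\<exists>B :: 'h set. finite B \<and> cspan B = UNIV)"
  shows "all_equivalent
    [\<forall>(E :: 'h \<Rightarrow> 'h) (P :: 'h \<Rightarrow> 'h). selfadjoint E \<and> selfadjoint P \<and> P = P \<circ> P \<longrightarrow>
       (\<lambda>n. 2 * singular_values (P \<circ> E \<circ> (\<lambda>x. x - P x)) n) \<prec>\<^sub>w spectral_spread E,
     \<forall>(E :: 'h \<Rightarrow> 'h) (F :: 'h \<Rightarrow> 'h). selfadjoint E \<and> selfadjoint F \<longrightarrow>
       singular_values (\<lambda>x. E (F x) - F (E x)) \<prec>\<^sub>w
         (\<lambda>n. 1 / 2 * (spectral_spread (E \<oplus> E) n * spectral_spread (F \<oplus> F) n)),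
     \<forall>(E :: 'h \<Rightarrow> 'h) (F :: 'h \<Rightarrow> 'h) (X :: 'h \<Rightarrow> 'h). selfadjoint E \<and> selfadjoint F \<and> bounded_clinear X \<longrightarrow>
       singular_values (\<lambda>x. E (X x) - X (F x)) \<prec>\<^sub>w
         (\<lambda>n. spectral_spread (E \<oplus> F) n * singular_values X n),
     \<forall>(E :: 'h \<Rightarrow> 'h) (F :: 'h \<Rightarrow> 'h). selfadjoint E \<and> selfadjoint F \<longrightarrow>
       singular_values (\<lambda>x. E x - F x) \<prec>\<^sub>w spectral_spread (E \<oplus> F),
     \<forall>(C :: 'h \<Rightarrow> 'h) (S :: 'h \<Rightarrow> 'h) (E :: 'h \<Rightarrow> 'h). bounded_clinear C \<and> bounded_clinear S \<and>
         (\<forall>x. cadjoint C (C x) + cadjoint S (S x) = x) \<and> selfadjoint E \<longrightarrow>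
       (\<lambda>n. 2 * singular_values (S \<circ> E \<circ> cadjoint C) n) \<prec>\<^sub>w
         spectral_spread (E \<oplus> (\<lambda>_ :: 'h. 0 :: 'h))]"
proof -
  note inf = inf_dimI[OF infinite_dimensional]
  have all: "all_equivalent Ps" if "\<forall>P\<in>set Ps. P" for Ps
    using that by (auto simp: all_equivalent_def)
  show ?thesis
    by (rule all, unfold list.set ball_simps, intro conjI allI impI TrueI; elim conjE)
      (rule singular_values_off_diagonal_submajorized singular_values_commutator_submajorized
        singular_values_sylvester_submajorized singular_values_difference_submajorized
        singular_values_compression_submajorized; use inf in blast)+
qed

end
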